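(* Let $(M,g,\nabla)$ be an $n$-dimensional statistical manifold and $r$ a positive integer. Let $\underline{\mathbb{R}}^r=M\times\mathbb{R}^r$ denote the trivial bundle. Suppose there exist tensors $$(h^a_{ij})\in\Gamma(S^2T^*M\otimes\underline{\mathbb{R}}^r),\quad (h^*_{aij})\in\Gamma(S^2T^*M\otimes(\underline{\mathbb{R}}^r)^* ),\quad (\tau^a_{bi})\in\Gamma(T^*M\otimes\underline{\mathbb{R}}^r\otimes(\underline{\mathbb{R}}^r)^* )$$ which satisfy the Gauss--Codazzi--Ricci equations \begin{align*} &\text{Gauss:} && R_{ijkl}=h^*_{aik}h^a_{jl}-h^*_{ajk}h^a_{il},\\ &\text{Codazzi:} && \nabla_{[i}h^a_{j]l}-h^b_{l[i}\tau^a_{bj]}=0,\qquad \nabla_{[i}h^*_{aj]}{}^k+h^*_{b[i}{}^k\tau^b_{aj]}=0,\\ &\text{Ricci:} && \nabla_{[i}\tau^a_{bj]}+\tau^a_{c[i}\tau^c_{bj]}-h^a_{l[i}h^*_{bj]}{}^l=0. \end{align*} Then $(M,g,\nabla)$ is locally embeddable to a flat statistical manifold of dimension $n+r$.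
   Context: All objects are $C^\infty$. A statistical manifold $(M,g,\nabla)$ is a manifold $M$ with a Riemannian metric $g$ and a torsion-free affine connection $\nabla$ such that $\nabla g$ is a totally symmetric $3$-tensor. It is called flat if the curvature of $\nabla$ vanishes ($g$ need not be a flat metric). An embedding $f\colon M\to\mathcal{S}$ between statistical manifolds $(M,g,\nabla)$ and $(\mathcal{S},G,D)$ is a statistical embedding if $(g,\nabla)$ is the structure induced from $(G,D)$, i.e. $g(X,Y)=G(f_*X,f_*Y)$ and $g(\nabla_XY,Z)=G(D_X(f_*Y),f_*Z)$ for all $X,Y,Z\in\Gamma(TM)$, where $D$ also denotes the pulled-back connection on $f^*T\mathcal{S}$. $(M,g,\nabla)$ is locally embeddable to a flat statistical manifold of dimension $N$ if for every $x\in M$ there exist an open neighborhood $U$ of $x$, an $N$-dimensional flat statistical manifold $(\mathcal{S},G,D)$ and a statistical embedding $f\colon U\to\mathcal{S}$ (with $U$ carrying the restriction of $(g,\nabla)$). Index conventions: indices $i,j,k,l$ run from $1$ to $n$ and refer to tensors on $M$; indices $a,b,c$ run from $1$ to $r$ and refer to the standard frame of $\underline{\mathbb{R}}^r$ or its dual; repeated indices are summed. Indices $i,j,k,l$ are lowered and raised by $g_{ij}$ and its inverse $g^{ij}$, e.g. $h^*_{ai}{}^k=g^{kl}h^*_{ail}$. The curvature is defined by $(\nabla_i\nabla_j-\nabla_j\nabla_i)X^k=R_{ij}{}^k{}_lX^l$, and $R_{ijkl}=g_{km}R_{ij}{}^m{}_l$. Here $\nabla$ is extended to tensors with values in $\underline{\mathbb{R}}^r$,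 $(\underline{\mathbb{R}}^r)^*$ and their tensor products by coupling with the canonical flat connection of the trivial bundle. Square brackets denote skew symmetrization, performed only over the indices of the type $i,j,k,l$ adjacent to the brackets (here always over $i$ and $j$) and never over $a,b,c$; e.g. $h^a_{l[i}h^*_{bj]}{}^l$ means $\frac12(h^a_{li}h^*_{bj}{}^l-h^a_{lj}h^*_{bi}{}^l)$, and $h^*_{b[i}{}^k\tau^b_{aj]}$ means $\frac12(h^*_{bi}{}^k\tau^b_{aj}-h^*_{bj}{}^k\tau^b_{ai})$. *)

theory Defs
  imports "HOL-Analysis.Analysis"
begin

text \<open>Smooth functions (of class C-infinity) on open sets. The definition is only used for open \<open>S\<close>.
  Since the domain will be some \<open>real^'n\<close>, Frechet differentiability together with continuity of
  all iterated directional derivatives is the usual notion.\<close>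

fun Ck_on :: "nat \<Rightarrow> 'a::real_normed_vector set \<Rightarrow> ('a \<Rightarrow> 'b::real_normed_vector) \<Rightarrow> bool" where
  "Ck_on 0 S f \<longleftrightarrow> continuous_on S f"
| "Ck_on (Suc k) S f \<longleftrightarrow>
     (\<forall>x\<in>S. f differentiable (at x)) \<and> (\<forall>v. Ck_on k S (\<lambda>x. frechet_derivative f (at x) v))"

definition smooth_on :: "'a::real_normed_vector set \<Rightarrow> ('a \<Rightarrow> 'b::real_normed_vector) \<Rightarrow> bool" where
  "smooth_on S f \<longleftrightarrow> (\<forall>k. Ck_on k S f)"

section \<open>Manifolds\<close>

text \<open>An atlas is an indexed family of charts \<open>cmap M \<alpha> : cdom M \<alpha> \<rightarrow> \<real>\<^sup>n\<close>,
  \<open>\<alpha> \<in> charts M\<close>. All functions are total; their values outside of the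
  indicated domains are irrelevant.\<close>

record ('a, 'c, 'n::finite) manifold =
  mspace :: "'a topology"
  charts :: "'c set"
  cdom :: "'c \<Rightarrow> 'a set"
  cmap :: "'c \<Rightarrow> 'a \<Rightarrow> real^'n"

definition cinv :: "('a, 'c, 'n::finite, 'z) manifold_scheme \<Rightarrow> 'c \<Rightarrow> real^'n \<Rightarrow> 'a" where
  "cinv M \<alpha> = inv_into (cdom M \<alpha>) (cmap M \<alpha>)"

definition smooth_manifold :: "('a, 'c, 'n::finite, 'z) manifold_scheme \<Rightarrow> bool" where
  "smooth_manifold M \<longleftrightarrow>
     Hausdorff_space (mspace M) \<and> second_countable (mspace M) \<and>
     (\<Union>\<alpha>\<in>charts M. cdom M \<alpha>) = topspace (mspace M) \<and>
     (\<forall>\<alpha>\<in>charts M.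
        openin (mspace M) (cdom M \<alpha>) \<and>
        open (cmap M \<alpha> ` cdom M \<alpha>) \<and>
        homeomorphic_map (subtopology (mspace M) (cdom M \<alpha>))
          (top_of_set (cmap M \<alpha> ` cdom M \<alpha>)) (cmap M \<alpha>)) \<and>
     (\<forall>\<alpha>\<in>charts M. \<forall>\<beta>\<in>charts M.
        smooth_on (cmap M \<alpha> ` (cdom M \<alpha> \<inter> cdom M \<beta>)) (\<lambda>x. cmap M \<beta> (cinv M \<alpha> x)))"

definition smooth_in_chart ::
  "('a, 'c, 'n::finite, 'z) manifold_scheme \<Rightarrow> 'c \<Rightarrow> ('a \<Rightarrow> real) \<Rightarrow> bool" where
  "smooth_in_chart M \<alpha> F \<longleftrightarrow> smooth_on (cmap M \<alpha> ` cdom M \<alpha>) (\<lambda>x. F (cinv M \<alpha> x))"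

text \<open>\<open>pd M \<alpha> i F\<close> is the partial derivative of \<open>F\<close> along the \<open>i\<close>-th coordinate of the chart
  \<open>\<alpha>\<close>, and \<open>jac M \<alpha> \<beta> p k i\<close> is the entry \<open>\<partial>y\<^sup>k/\<partial>x\<^sup>i\<close>
  for the coordinates \<open>x\<close> of \<open>\<alpha>\<close> and \<open>y\<close> of \<open>\<beta>\<close>.\<close>

definition pd :: "('a, 'c, 'n::finite, 'z) manifold_scheme \<Rightarrow> 'c \<Rightarrow> 'n \<Rightarrow> ('a \<Rightarrow> real) \<Rightarrow> 'a \<Rightarrow> real" where
  "pd M \<alpha> i F p =
     frechet_derivative (\<lambda>x. F (cinv M \<alpha> x)) (at (cmap M \<alpha> p)) (axis i 1)"

definition jac :: "('a, 'c, 'n::finite, 'z) manifold_scheme \<Rightarrow> 'c \<Rightarrow> 'c \<Rightarrow> 'a \<Rightarrow> 'n \<Rightarrow> 'n \<Rightarrow> real" where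
  "jac M \<alpha> \<beta> p k i = pd M \<alpha> i (\<lambda>q. cmap M \<beta> q $ k) p"

section \<open>Tensor fields and connections\<close>

text \<open>A tensor field is given by its components in all charts, subject to the tensorial
  transformation law. The argument order is chart, point, indices.\<close>

definition vector_field ::
  "('a, 'c, 'n::finite, 'z) manifold_scheme \<Rightarrow> ('c \<Rightarrow> 'a \<Rightarrow> 'n \<Rightarrow> real) \<Rightarrow> bool" where
  "vector_field M X \<longleftrightarrow>
     (\<forall>\<alpha>\<in>charts M. \<forall>k. smooth_in_chart M \<alpha> (\<lambda>p. X \<alpha> p k)) \<and>
     (\<forall>\<alpha>\<in>charts M. \<forall>\<beta>\<in>charts M. \<forall>p\<in>cdom M \<alpha> \<inter> cdom M \<beta>. \<forall>k.
        X \<beta> p k = (\<Sum>i\<in>UNIV. jac M \<alpha> \<beta> p k i * X \<alpha> p i))"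

definition covector_field ::
  "('a, 'c, 'n::finite, 'z) manifold_scheme \<Rightarrow> ('c \<Rightarrow> 'a \<Rightarrow> 'n \<Rightarrow> real) \<Rightarrow> bool" where
  "covector_field M \<omega> \<longleftrightarrow>
     (\<forall>\<alpha>\<in>charts M. \<forall>i. smooth_in_chart M \<alpha> (\<lambda>p. \<omega> \<alpha> p i)) \<and>
     (\<forall>\<alpha>\<in>charts M. \<forall>\<beta>\<in>charts M. \<forall>p\<in>cdom M \<alpha> \<inter> cdom M \<beta>. \<forall>i.
        \<omega> \<alpha> p i = (\<Sum>k\<in>UNIV. \<omega> \<beta> p k * jac M \<alpha> \<beta> p k i))"

definition symmetric_2tensor_field ::
  "('a, 'c, 'n::finite, 'z) manifold_scheme \<Rightarrow> ('c \<Rightarrow> 'a \<Rightarrow> 'n \<Rightarrow> 'n \<Rightarrow> real) \<Rightarrow> bool" where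
  "symmetric_2tensor_field M t \<longleftrightarrow>
     (\<forall>\<alpha>\<in>charts M. \<forall>i j. smooth_in_chart M \<alpha> (\<lambda>p. t \<alpha> p i j)) \<and>
     (\<forall>\<alpha>\<in>charts M. \<forall>p\<in>cdom M \<alpha>. \<forall>i j. t \<alpha> p i j = t \<alpha> p j i) \<and>
     (\<forall>\<alpha>\<in>charts M. \<forall>\<beta>\<in>charts M. \<forall>p\<in>cdom M \<alpha> \<inter> cdom M \<beta>. \<forall>i j.
        t \<alpha> p i j =
          (\<Sum>k\<in>UNIV. \<Sum>l\<in>UNIV. t \<beta> p k l * jac M \<alpha> \<beta> p k i * jac M \<alpha> \<beta> p l j))"

definition riemannian_metric ::
  "('a, 'c, 'n::finite, 'z) manifold_scheme \<Rightarrow> ('c \<Rightarrow> 'a \<Rightarrow> 'n \<Rightarrow> 'n \<Rightarrow> real) \<Rightarrow> bool" where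
  "riemannian_metric M g \<longleftrightarrow>
     symmetric_2tensor_field M g \<and>
     (\<forall>\<alpha>\<in>charts M. \<forall>p\<in>cdom M \<alpha>. \<forall>u. u \<noteq> (\<lambda>_. 0) \<longrightarrow>
        (\<Sum>i\<in>UNIV. \<Sum>j\<in>UNIV. g \<alpha> p i j * u i * u j) > 0)"

text \<open>An affine connection is given by its Christoffel symbols
  \<open>\<nabla>\<^sub>i \<partial>\<^sub>j = \<Gamma>\<^sup>k\<^sub>i\<^sub>j \<partial>\<^sub>k\<close>, with \<open>\<Gamma> \<alpha> p k i j\<close> standing for
  \<open>\<Gamma>\<^sup>k\<^sub>i\<^sub>j\<close> in the chart \<open>\<alpha>\<close> at \<open>p\<close>.
  The transformation law is obtained by applying \<open>\<nabla>\<^sub>i\<close> to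
  \<open>\<partial>/\<partial>x\<^sup>j = (\<partial>y\<^sup>m/\<partial>x\<^sup>j) \<partial>/\<partial>y\<^sup>m\<close>.\<close>

definition affine_connection ::
  "('a, 'c, 'n::finite, 'z) manifold_scheme \<Rightarrow> ('c \<Rightarrow> 'a \<Rightarrow> 'n \<Rightarrow> 'n \<Rightarrow> 'n \<Rightarrow> real) \<Rightarrow> bool" where
  "affine_connection M \<Gamma> \<longleftrightarrow>
     (\<forall>\<alpha>\<in>charts M. \<forall>k i j. smooth_in_chart M \<alpha> (\<lambda>p. \<Gamma> \<alpha> p k i j)) \<and>
     (\<forall>\<alpha>\<in>charts M. \<forall>\<beta>\<in>charts M. \<forall>p\<in>cdom M \<alpha> \<inter> cdom M \<beta>. \<forall>k i j.
        (\<Sum>m\<in>UNIV. \<Gamma> \<alpha> p m i j * jac M \<alpha> \<beta> p k m) =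
          pd M \<alpha> i (\<lambda>q. jac M \<alpha> \<beta> q k j) p +
          (\<Sum>l\<in>UNIV. \<Sum>m\<in>UNIV. \<Gamma> \<beta> p k l m * jac M \<alpha> \<beta> p l i * jac M \<alpha> \<beta> p m j))"

section \<open>Statistical manifolds\<close>

record ('a, 'c, 'n::finite) stat_manifold = "('a, 'c, 'n) manifold" +
  met :: "'c \<Rightarrow> 'a \<Rightarrow> 'n \<Rightarrow> 'n \<Rightarrow> real"
  chris :: "'c \<Rightarrow> 'a \<Rightarrow> 'n \<Rightarrow> 'n \<Rightarrow> 'n \<Rightarrow> real"

text \<open>Covariant derivatives, acting on the components of a tensor field in a fixed chart \<open>\<alpha>\<close>.
  The direction of differentiation is the first index:
  \<open>\<nabla>\<^sub>i X\<^sup>k\<close>, \<open>\<nabla>\<^sub>i \<omega>\<^sub>j\<close>,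
  \<open>\<nabla>\<^sub>i t\<^sub>j\<^sub>l\<close> and \<open>\<nabla>\<^sub>i A\<^sub>j\<^sup>k\<close>.\<close>

definition cov_vec ::
  "('a, 'c, 'n::finite) stat_manifold \<Rightarrow> 'c \<Rightarrow> ('a \<Rightarrow> 'n \<Rightarrow> real) \<Rightarrow> 'a \<Rightarrow> 'n \<Rightarrow> 'n \<Rightarrow> real" where
  "cov_vec M \<alpha> X p i k =
     pd M \<alpha> i (\<lambda>q. X q k) p + (\<Sum>m\<in>UNIV. chris M \<alpha> p k i m * X p m)"

definition cov_covec ::
  "('a, 'c, 'n::finite) stat_manifold \<Rightarrow> 'c \<Rightarrow> ('a \<Rightarrow> 'n \<Rightarrow> real) \<Rightarrow> 'a \<Rightarrow> 'n \<Rightarrow> 'n \<Rightarrow> real" where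
  "cov_covec M \<alpha> \<omega> p i j =
     pd M \<alpha> i (\<lambda>q. \<omega> q j) p - (\<Sum>m\<in>UNIV. chris M \<alpha> p m i j * \<omega> p m)"

definition cov_2tensor ::
  "('a, 'c, 'n::finite) stat_manifold \<Rightarrow> 'c \<Rightarrow> ('a \<Rightarrow> 'n \<Rightarrow> 'n \<Rightarrow> real) \<Rightarrow>
     'a \<Rightarrow> 'n \<Rightarrow> 'n \<Rightarrow> 'n \<Rightarrow> real" where
  "cov_2tensor M \<alpha> t p i j l =
     pd M \<alpha> i (\<lambda>q. t q j l) p
       - (\<Sum>m\<in>UNIV. chris M \<alpha> p m i j * t p m l)
       - (\<Sum>m\<in>UNIV. chris M \<alpha> p m i l * t p j m)"

definition cov_endo ::
  "('a, 'c, 'n::finite) stat_manifold \<Rightarrow> 'c \<Rightarrow> ('a \<Rightarrow> 'n \<Rightarrow> 'n \<Rightarrow> real) \<Rightarrow>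
     'a \<Rightarrow> 'n \<Rightarrow> 'n \<Rightarrow> 'n \<Rightarrow> real" where
  "cov_endo M \<alpha> A p i j k =
     pd M \<alpha> i (\<lambda>q. A q j k) p
       - (\<Sum>m\<in>UNIV. chris M \<alpha> p m i j * A p m k)
       + (\<Sum>m\<in>UNIV. chris M \<alpha> p k i m * A p j m)"

text \<open>The component \<open>k\<close> of the torsion applied to the coordinate fields
  \<open>\<partial>\<^sub>i\<close> and \<open>\<partial>\<^sub>j\<close>, which commute.\<close>

definition torsion ::
  "('a, 'c, 'n::finite) stat_manifold \<Rightarrow> 'c \<Rightarrow> 'a \<Rightarrow> 'n \<Rightarrow> 'n \<Rightarrow> 'n \<Rightarrow> real" where
  "torsion M \<alpha> p k i j = chris M \<alpha> p k i j - chris M \<alpha> p k j i"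

definition statistical_manifold :: "('a, 'c, 'n::finite) stat_manifold \<Rightarrow> bool" where
  "statistical_manifold M \<longleftrightarrow>
     smooth_manifold M \<and>
     riemannian_metric M (met M) \<and>
     affine_connection M (chris M) \<and>
     (\<forall>\<alpha>\<in>charts M. \<forall>p\<in>cdom M \<alpha>. \<forall>k i j. torsion M \<alpha> p k i j = 0) \<and>
     (\<forall>\<alpha>\<in>charts M. \<forall>p\<in>cdom M \<alpha>. \<forall>i j l.
        cov_2tensor M \<alpha> (met M \<alpha>) p i j l = cov_2tensor M \<alpha> (met M \<alpha>) p j i l \<and>
        cov_2tensor M \<alpha> (met M \<alpha>) p i j l = cov_2tensor M \<alpha> (met M \<alpha>) p i l j)"

text \<open>\<open>curv M \<alpha> p i j k l\<close> is \<open>R\<^sub>i\<^sub>j\<^sup>k\<^sub>l\<close>, obtained from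
  \<open>(\<nabla>\<^sub>i\<nabla>\<^sub>j - \<nabla>\<^sub>j\<nabla>\<^sub>i) X\<^sup>k = R\<^sub>i\<^sub>j\<^sup>k\<^sub>l X\<^sup>l\<close> with
  the coordinate field \<open>\<partial>\<^sub>l\<close> for \<open>X\<close>. Here \<open>\<nabla>\<^sub>j X\<^sup>k\<close> is
  differentiated as a tensor of type \<open>(1,1)\<close>.\<close>

definition curv ::
  "('a, 'c, 'n::finite) stat_manifold \<Rightarrow> 'c \<Rightarrow> 'a \<Rightarrow> 'n \<Rightarrow> 'n \<Rightarrow> 'n \<Rightarrow> 'n \<Rightarrow> real" where
  "curv M \<alpha> p i j k l =
     (let e = (\<lambda>_ m. if m = l then 1 else 0)
      in cov_endo M \<alpha> (cov_vec M \<alpha> e) p i j k - cov_endo M \<alpha> (cov_vec M \<alpha> e) p j i k)"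

definition curv_low ::
  "('a, 'c, 'n::finite) stat_manifold \<Rightarrow> 'c \<Rightarrow> 'a \<Rightarrow> 'n \<Rightarrow> 'n \<Rightarrow> 'n \<Rightarrow> 'n \<Rightarrow> real" where
  "curv_low M \<alpha> p i j k l = (\<Sum>m\<in>UNIV. met M \<alpha> p k m * curv M \<alpha> p i j m l)"

definition flat :: "('a, 'c, 'n::finite) stat_manifold \<Rightarrow> bool" where
  "flat M \<longleftrightarrow> (\<forall>\<alpha>\<in>charts M. \<forall>p\<in>cdom M \<alpha>. \<forall>i j k l. curv M \<alpha> p i j k l = 0)"

text \<open>\<open>raise M \<alpha> t p i k\<close> is \<open>t\<^sub>i\<^sup>k = g\<^sup>k\<^sup>l t\<^sub>i\<^sub>l\<close>.\<close>

definition met_inv :: "('a, 'c, 'n::finite) stat_manifold \<Rightarrow> 'c \<Rightarrow> 'a \<Rightarrow> 'n \<Rightarrow> 'n \<Rightarrow> real" where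
  "met_inv M \<alpha> p k l = matrix_inv (\<chi> i j. met M \<alpha> p i j) $ k $ l"

definition raise ::
  "('a, 'c, 'n::finite) stat_manifold \<Rightarrow> 'c \<Rightarrow> ('a \<Rightarrow> 'n \<Rightarrow> 'n \<Rightarrow> real) \<Rightarrow> 'a \<Rightarrow> 'n \<Rightarrow> 'n \<Rightarrow> real" where
  "raise M \<alpha> t p i k = (\<Sum>l\<in>UNIV. met_inv M \<alpha> p k l * t p i l)"

definition skew :: "('n \<Rightarrow> 'n \<Rightarrow> real) \<Rightarrow> 'n \<Rightarrow> 'n \<Rightarrow> real" where
  "skew A i j = (A i j - A j i) / 2"

section \<open>The Gauss--Codazzi--Ricci equations\<close>

text \<open>Sections of bundles tensored with the trivial bundle of rank \<open>r\<close> and its dual are families of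
  tensor fields indexed by \<open>'r\<close>, on which the coupled connection acts componentwise. Thus
  \<open>h a\<close>, \<open>hs a\<close> and \<open>\<tau> a b\<close> are the tensor fields
  \<open>h\<^sup>a\<^sub>i\<^sub>j\<close>, \<open>h\<^sup>*\<^sub>a\<^sub>i\<^sub>j\<close> and \<open>\<tau>\<^sup>a\<^sub>b\<^sub>i\<close>.\<close>

definition gauss_eq ::
  "('a, 'c, 'n::finite) stat_manifold \<Rightarrow> ('r::finite \<Rightarrow> 'c \<Rightarrow> 'a \<Rightarrow> 'n \<Rightarrow> 'n \<Rightarrow> real) \<Rightarrow>
     ('r \<Rightarrow> 'c \<Rightarrow> 'a \<Rightarrow> 'n \<Rightarrow> 'n \<Rightarrow> real) \<Rightarrow> bool" where
  "gauss_eq M h hs \<longleftrightarrow>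
     (\<forall>\<alpha>\<in>charts M. \<forall>p\<in>cdom M \<alpha>. \<forall>i j k l.
        curv_low M \<alpha> p i j k l =
          (\<Sum>a\<in>UNIV. hs a \<alpha> p i k * h a \<alpha> p j l - hs a \<alpha> p j k * h a \<alpha> p i l))"

definition codazzi_eq ::
  "('a, 'c, 'n::finite) stat_manifold \<Rightarrow> ('r::finite \<Rightarrow> 'c \<Rightarrow> 'a \<Rightarrow> 'n \<Rightarrow> 'n \<Rightarrow> real) \<Rightarrow>
     ('r \<Rightarrow> 'r \<Rightarrow> 'c \<Rightarrow> 'a \<Rightarrow> 'n \<Rightarrow> real) \<Rightarrow> bool" where
  "codazzi_eq M h \<tau> \<longleftrightarrow>
     (\<forall>\<alpha>\<in>charts M. \<forall>p\<in>cdom M \<alpha>. \<forall>a i j l.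
        skew (\<lambda>i j. cov_2tensor M \<alpha> (h a \<alpha>) p i j l) i j
          - (\<Sum>b\<in>UNIV. skew (\<lambda>i j. h b \<alpha> p l i * \<tau> a b \<alpha> p j) i j) = 0)"

definition codazzi_dual_eq ::
  "('a, 'c, 'n::finite) stat_manifold \<Rightarrow> ('r::finite \<Rightarrow> 'c \<Rightarrow> 'a \<Rightarrow> 'n \<Rightarrow> 'n \<Rightarrow> real) \<Rightarrow>
     ('r \<Rightarrow> 'r \<Rightarrow> 'c \<Rightarrow> 'a \<Rightarrow> 'n \<Rightarrow> real) \<Rightarrow> bool" where
  "codazzi_dual_eq M hs \<tau> \<longleftrightarrow>
     (\<forall>\<alpha>\<in>charts M. \<forall>p\<in>cdom M \<alpha>. \<forall>a i j k.
        skew (\<lambda>i j. cov_endo M \<alpha> (raise M \<alpha> (hs a \<alpha>)) p i j k) i j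
          + (\<Sum>b\<in>UNIV. skew (\<lambda>i j. raise M \<alpha> (hs b \<alpha>) p i k * \<tau> b a \<alpha> p j) i j) = 0)"

definition ricci_eq ::
  "('a, 'c, 'n::finite) stat_manifold \<Rightarrow> ('r::finite \<Rightarrow> 'c \<Rightarrow> 'a \<Rightarrow> 'n \<Rightarrow> 'n \<Rightarrow> real) \<Rightarrow>
     ('r \<Rightarrow> 'c \<Rightarrow> 'a \<Rightarrow> 'n \<Rightarrow> 'n \<Rightarrow> real) \<Rightarrow> ('r \<Rightarrow> 'r \<Rightarrow> 'c \<Rightarrow> 'a \<Rightarrow> 'n \<Rightarrow> real) \<Rightarrow> bool" where
  "ricci_eq M h hs \<tau> \<longleftrightarrow>
     (\<forall>\<alpha>\<in>charts M. \<forall>p\<in>cdom M \<alpha>. \<forall>a b i j.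
        skew (\<lambda>i j. cov_covec M \<alpha> (\<tau> a b \<alpha>) p i j) i j
          + (\<Sum>c\<in>UNIV. skew (\<lambda>i j. \<tau> a c \<alpha> p i * \<tau> c b \<alpha> p j) i j)
          - (\<Sum>l\<in>UNIV. skew (\<lambda>i j. h a \<alpha> p l i * raise M \<alpha> (hs b \<alpha>) p j l) i j) = 0)"

section \<open>Statistical embeddings\<close>

definition restrict_to ::
  "('a, 'c, 'n::finite) stat_manifold \<Rightarrow> 'a set \<Rightarrow> ('a, 'c, 'n) stat_manifold" where
  "restrict_to M U =
     M\<lparr>mspace := subtopology (mspace M) U, cdom := (\<lambda>\<alpha>. cdom M \<alpha> \<inter> U)\<rparr>"

definition smooth_embedding ::
  "('a, 'c, 'n::finite, 'y) manifold_scheme \<Rightarrow> ('b, 'd, 'm::finite, 'z) manifold_scheme \<Rightarrow>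
     ('a \<Rightarrow> 'b) \<Rightarrow> bool" where
  "smooth_embedding M S f \<longleftrightarrow>
     embedding_map (mspace M) (mspace S) f \<and>
     (\<forall>\<alpha>\<in>charts M. \<forall>\<beta>\<in>charts S.
        smooth_on (cmap M \<alpha> ` (cdom M \<alpha> \<inter> f -` cdom S \<beta>))
          (\<lambda>x. cmap S \<beta> (f (cinv M \<alpha> x)))) \<and>
     (\<forall>\<alpha>\<in>charts M. \<forall>\<beta>\<in>charts S. \<forall>p\<in>cdom M \<alpha> \<inter> f -` cdom S \<beta>.
        inj (frechet_derivative (\<lambda>x. cmap S \<beta> (f (cinv M \<alpha> x))) (at (cmap M \<alpha> p))))"

definition met_at ::
  "('a, 'c, 'n::finite) stat_manifold \<Rightarrow> 'c \<Rightarrow> 'a \<Rightarrow> ('n \<Rightarrow> real) \<Rightarrow> ('n \<Rightarrow> real) \<Rightarrow> real" where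
  "met_at M \<alpha> p u v = (\<Sum>i\<in>UNIV. \<Sum>j\<in>UNIV. met M \<alpha> p i j * u i * v j)"

text \<open>\<open>nabla M X Y\<close> is \<open>\<nabla>\<^sub>X Y\<close>.\<close>

definition nabla ::
  "('a, 'c, 'n::finite) stat_manifold \<Rightarrow> ('c \<Rightarrow> 'a \<Rightarrow> 'n \<Rightarrow> real) \<Rightarrow> ('c \<Rightarrow> 'a \<Rightarrow> 'n \<Rightarrow> real) \<Rightarrow>
     'c \<Rightarrow> 'a \<Rightarrow> 'n \<Rightarrow> real" where
  "nabla M X Y \<alpha> p k = (\<Sum>i\<in>UNIV. X \<alpha> p i * cov_vec M \<alpha> (Y \<alpha>) p i k)"

text \<open>The differential \<open>df\<close> and the push-forward \<open>f\<^sub>* Y\<close>, a section of the pull-back of the tangent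
  bundle of \<open>S\<close>, computed in a chart \<open>\<alpha>\<close> of \<open>M\<close> and a chart \<open>\<beta>\<close> of \<open>S\<close>.\<close>

definition diff_map ::
  "('a, 'c, 'n::finite, 'y) manifold_scheme \<Rightarrow> ('b, 'd, 'm::finite, 'z) manifold_scheme \<Rightarrow>
     ('a \<Rightarrow> 'b) \<Rightarrow> 'c \<Rightarrow> 'd \<Rightarrow> 'a \<Rightarrow> 'm \<Rightarrow> 'n \<Rightarrow> real" where
  "diff_map M S f \<alpha> \<beta> p b i = pd M \<alpha> i (\<lambda>q. cmap S \<beta> (f q) $ b) p"

definition push ::
  "('a, 'c, 'n::finite, 'y) manifold_scheme \<Rightarrow> ('b, 'd, 'm::finite, 'z) manifold_scheme \<Rightarrow>
     ('a \<Rightarrow> 'b) \<Rightarrow> 'c \<Rightarrow> 'd \<Rightarrow> ('a \<Rightarrow> 'n \<Rightarrow> real) \<Rightarrow> 'a \<Rightarrow> 'm \<Rightarrow> real" where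
  "push M S f \<alpha> \<beta> Y p b = (\<Sum>i\<in>UNIV. diff_map M S f \<alpha> \<beta> p b i * Y p i)"

text \<open>The pulled-back connection: with \<open>\<Gamma>\<close> the Christoffel symbols of \<open>D\<close>,
  \<open>(D\<^sub>X V)\<^sup>c = X\<^sup>i (\<partial>\<^sub>i V\<^sup>c + \<Gamma>\<^sup>c\<^sub>b\<^sub>d(f) \<partial>\<^sub>i f\<^sup>b V\<^sup>d)\<close>
  for a section \<open>V\<close> along \<open>f\<close>.\<close>

definition pullback_nabla ::
  "('a, 'c, 'n::finite, 'y) manifold_scheme \<Rightarrow> ('b, 'd, 'm::finite) stat_manifold \<Rightarrow>
     ('a \<Rightarrow> 'b) \<Rightarrow> 'c \<Rightarrow> 'd \<Rightarrow> ('a \<Rightarrow> 'n \<Rightarrow> real) \<Rightarrow> ('a \<Rightarrow> 'm \<Rightarrow> real) \<Rightarrow> 'a \<Rightarrow> 'm \<Rightarrow> real" where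
  "pullback_nabla M S f \<alpha> \<beta> X V p c =
     (\<Sum>i\<in>UNIV. X p i *
        (pd M \<alpha> i (\<lambda>q. V q c) p +
         (\<Sum>b\<in>UNIV. \<Sum>d\<in>UNIV. chris S \<beta> (f p) c b d * diff_map M S f \<alpha> \<beta> p b i * V p d)))"

definition statistical_embedding ::
  "('a, 'c, 'n::finite) stat_manifold \<Rightarrow> ('b, 'd, 'm::finite) stat_manifold \<Rightarrow> ('a \<Rightarrow> 'b) \<Rightarrow> bool" where
  "statistical_embedding M S f \<longleftrightarrow>
     smooth_embedding M S f \<and>
     (\<forall>X Y Z. vector_field M X \<and> vector_field M Y \<and> vector_field M Z \<longrightarrow>
        (\<forall>\<alpha>\<in>charts M. \<forall>\<beta>\<in>charts S. \<forall>p\<in>cdom M \<alpha> \<inter> f -` cdom S \<beta>.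
           met_at M \<alpha> p (X \<alpha> p) (Y \<alpha> p) =
             met_at S \<beta> (f p) (push M S f \<alpha> \<beta> (X \<alpha>) p) (push M S f \<alpha> \<beta> (Y \<alpha>) p) \<and>
           met_at M \<alpha> p (nabla M X Y \<alpha> p) (Z \<alpha> p) =
             met_at S \<beta> (f p)
               (pullback_nabla M S f \<alpha> \<beta> (X \<alpha>) (push M S f \<alpha> \<beta> (Y \<alpha>)) p)
               (push M S f \<alpha> \<beta> (Z \<alpha>) p)))"

text \<open>The type argument gives the dimension \<open>N\<close> as the size of the index type \<open>'m\<close>. A second
  countable Hausdorff manifold has at most continuum many points and a countable subatlas, so
  taking the points of \<open>S\<close> in \<open>real^'m\<close> (with an arbitrary topology on an arbitrary subset) and
  the chart indices in \<open>nat\<close> loses no generality.\<close>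

definition locally_embeddable_to_flat ::
  "'m::finite itself \<Rightarrow> ('a, 'c, 'n::finite) stat_manifold \<Rightarrow> bool" where
  "locally_embeddable_to_flat _ M \<longleftrightarrow>
     (\<forall>x\<in>topspace (mspace M).
        \<exists>U (S :: (real^'m, nat, 'm) stat_manifold) f.
          openin (mspace M) U \<and> x \<in> U \<and>
          statistical_manifold S \<and> flat S \<and>
          statistical_embedding (restrict_to M U) S f)"

end

theory Submission
  imports Defs
begin

text \<open>The connection \<open>D\<^sub>i \<partial>\<^sub>j = \<Gamma>\<^sup>k\<^sub>i\<^sub>j \<partial>\<^sub>k + h\<^sup>a\<^sub>i\<^sub>j e\<^sub>a\<close>,
  \<open>D\<^sub>i e\<^sub>a = - h\<^sup>*\<^sub>a\<^sub>i\<^sup>k \<partial>\<^sub>k + \<tau>\<^sup>b\<^sub>a\<^sub>i e\<^sub>b\<close> on the sum of the tangent bundle and the trivial bundle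
  is flat by the Gauss--Codazzi--Ricci equations. In a chart, a parallel frame together with a
  primitive gives an immersion \<open>f\<close> into \<open>\<real>\<^sup>n\<^sup>+\<^sup>r\<close> and transversal fields \<open>\<xi>\<^sub>a\<close>. The same linear
  system with the inhomogeneous term \<open>g\<^sub>i\<^sub>j\<close>, which remains integrable because \<open>\<nabla>g\<close> and \<open>h\<^sup>*\<close> are
  symmetric, yields functions \<open>\<psi>\<close>, \<open>p\<^sub>i\<close>, \<open>q\<^sub>a\<close>. Near \<open>f(M)\<close> the function
  \<open>\<phi>(f(x) + t\<^sup>a \<xi>\<^sub>a(x)) = \<psi>(x) + t\<^sup>a q\<^sub>a(x) + |t|\<^sup>2/2\<close> is well defined, and its Hessian \<open>G\<close> restricts to \<open>g\<close>,
  makes \<open>\<xi>\<^sub>a\<close> orthogonal to \<open>f(M)\<close> and is positive definite near a given point. So \<open>G\<close> and the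
  standard flat connection of \<open>\<real>\<^sup>n\<^sup>+\<^sup>r\<close> form the required flat statistical manifold.\<close>

section \<open>Functions of class \<open>C\<^sup>k\<close>\<close>

text \<open>The equations are exactly the compatibility conditions of an overdetermined linear
  system, so everything rests on its integrability. To treat immersion and potential at once, the
  primitive \<psi> and a constant c are adjoined as unknowns. The system becomes homogeneous:
  solutions with c = 0 give the coordinates of the immersion, and c = 1 switches on the source g. A
  potential is sought because a Hessian G = D d\<phi> is symmetric with symmetric derivative merely
  by commutation of partial derivatives; the conditions that remain concern the values of G along
  the immersed chart. Differentiating d\<phi>(\<partial>_j f) = p_j and d\<phi>(\<xi>_a) = q_a shows
  that G takes the values g and 0 there precisely when p and q solve the inhomogeneous system. Since
  \<psi> + t^a q_a is affine in t, its Hessian vanishes on pairs of transversal directions; the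
  quadratic term supplies the identity matrix. A further obstacle is that the system is solved in
  one chart, while an embedding has to be tested in all of them; the transformation laws carry the
  Gauss formula over.\<close>

lemma has_derivative_cong_open:
  assumes "open S" "x \<in> S" "\<And>y. y \<in> S \<Longrightarrow> f y = g y"
  shows "(f has_derivative D) (at x) \<longleftrightarrow> (g has_derivative D) (at x)"
  using assms by (metis has_derivative_transform_within_open)

lemma frechet_derivative_cong_open:
  assumes "open S" "x \<in> S" "\<And>y. y \<in> S \<Longrightarrow> f y = g y"
  shows "frechet_derivative f (at x) = frechet_derivative g (at x)"
  unfolding frechet_derivative_def using has_derivative_cong_open[OF assms] by simp

lemma Ck_on_cong:
  assumes "open S" "\<And>y. y \<in> S \<Longrightarrow> f y = g y"
  shows "Ck_on k S f \<longleftrightarrow> Ck_on k S g"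
  using assms(2)
proof (induction k arbitrary: f g)
  case 0
  then show ?case by (simp cong: continuous_on_cong)
next
  case (Suc k)
  have "f differentiable (at x) \<longleftrightarrow> g differentiable (at x)" if "x \<in> S" for x
    unfolding differentiable_def using has_derivative_cong_open[OF assms(1) that Suc.prems] by simp
  moreover have "Ck_on k S (\<lambda>x. frechet_derivative f (at x) v) \<longleftrightarrow> Ck_on k S (\<lambda>x. frechet_derivative g (at x) v)" for v
    by (rule Suc.IH) (metis frechet_derivative_cong_open assms(1) Suc.prems)
  ultimately show ?case by auto
qed

text \<open>Uniqueness of derivatives lets any explicit family \<open>D\<close> take the place of
  \<open>frechet_derivative\<close> in \<open>Ck_on\<close>; openness of \<open>S\<close> ensures
  that agreement on \<open>S\<close> survives further differentiation.\<close>

lemma Ck_on_SucI: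
  assumes "open S" "\<And>x. x \<in> S \<Longrightarrow> (f has_derivative D x) (at x)" "\<And>v. Ck_on k S (\<lambda>x. D x v)"
  shows "Ck_on (Suc k) S f"
proof -
  have "Ck_on k S (\<lambda>x. frechet_derivative f (at x) v)" for v
    using assms(3)[of v] Ck_on_cong[OF assms(1), of "\<lambda>x. frechet_derivative f (at x) v" "\<lambda>x. D x v" k]
    by (simp add: frechet_derivative_at[OF assms(2), symmetric])
  then show ?thesis
    using assms(2) by (auto simp: differentiable_def)
qed

lemma Ck_on_Suc_has_derivative:
  assumes "Ck_on (Suc k) S f" "x \<in> S"
  shows "(f has_derivative frechet_derivative f (at x)) (at x)"
  using assms frechet_derivative_works by auto

lemma Ck_on_subset: "Ck_on k S f \<Longrightarrow> T \<subseteq> S \<Longrightarrow> Ck_on k T f"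
  by (induction k arbitrary: f) (auto intro: continuous_on_subset)

lemma Ck_on_SucD: "Ck_on (Suc k) S f \<Longrightarrow> Ck_on k S f"
proof (induction k arbitrary: f)
  case 0
  then show ?case
    by (auto intro!: continuous_at_imp_continuous_on differentiable_imp_continuous_within)
next
  case (Suc k)
  then show ?case by (metis Ck_on.simps(2))
qed

lemma Ck_on_continuous: "Ck_on k S f \<Longrightarrow> continuous_on S f"
  by (induction k) (auto dest: Ck_on_SucD simp del: Ck_on.simps(2))

lemma Ck_on_const: "open S \<Longrightarrow> Ck_on k S (\<lambda>x. c)"
  by (induction k arbitrary: c) (auto intro!: Ck_on_SucI has_derivative_const simp del: Ck_on.simps(2))

lemma Ck_on_bounded_linear:
  assumes "bounded_linear L" "open S"
  shows "Ck_on k S f \<Longrightarrow> Ck_on k S (\<lambda>x. L (f x))"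
proof (induction k arbitrary: f)
  case 0
  then show ?case by (simp add: bounded_linear.continuous_on[OF assms(1)])
next
  case (Suc k)
  show ?case
  proof (rule Ck_on_SucI[OF assms(2)])
    show "((\<lambda>x. L (f x)) has_derivative (\<lambda>v. L (frechet_derivative f (at x) v))) (at x)" if "x \<in> S" for x
      by (rule bounded_linear.has_derivative[OF assms(1) Ck_on_Suc_has_derivative[OF Suc.prems that]])
    show "Ck_on k S (\<lambda>x. L (frechet_derivative f (at x) v))" for v
      by (rule Suc.IH) (use Suc.prems in simp)
  qed
qed

lemma Ck_on_linear: "bounded_linear L \<Longrightarrow> open S \<Longrightarrow> Ck_on k S L"
proof (cases k)
  case (Suc n)
  assume *: "bounded_linear L" "open S"
  show ?thesis unfolding Suc
    by (rule Ck_on_SucI[OF *(2) bounded_linear_imp_has_derivative[OF *(1)]]) (rule Ck_on_const[OF *(2)])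
qed (auto intro: linear_continuous_on)

lemma Ck_on_add: "open S \<Longrightarrow> Ck_on k S f \<Longrightarrow> Ck_on k S g \<Longrightarrow> Ck_on k S (\<lambda>x. f x + g x)"
proof (induction k arbitrary: f g)
  case (Suc k)
  show ?case
    by (rule Ck_on_SucI[OF Suc.prems(1) has_derivative_add[OF Ck_on_Suc_has_derivative[OF Suc.prems(2)]
          Ck_on_Suc_has_derivative[OF Suc.prems(3)]]]) (use Suc in auto)
qed (auto intro: continuous_on_add)

lemma Ck_on_bilinear:
  assumes "bounded_bilinear B" "open S"
  shows "Ck_on k S f \<Longrightarrow> Ck_on k S g \<Longrightarrow> Ck_on k S (\<lambda>x. B (f x) (g x))"
proof (induction k arbitrary: f g)
  case 0
  then show ?case by (simp add: bounded_bilinear.continuous_on[OF assms(1)])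
next
  case (Suc k)
  show ?case
  proof (rule Ck_on_SucI[OF assms(2)])
    show "((\<lambda>x. B (f x) (g x)) has_derivative
      (\<lambda>v. B (f x) (frechet_derivative g (at x) v) + B (frechet_derivative f (at x) v) (g x))) (at x)" if "x \<in> S" for x
      by (rule bounded_bilinear.FDERIV[OF assms(1)]; rule Ck_on_Suc_has_derivative; (rule Suc.prems that))
    show "Ck_on k S (\<lambda>x. B (f x) (frechet_derivative g (at x) v) + B (frechet_derivative f (at x) v) (g x))" for v
      using Suc.prems Suc.IH[OF _ Ck_on_SucD[OF Suc.prems(2)]] Suc.IH[OF Ck_on_SucD[OF Suc.prems(1)]]
      by (auto intro!: Ck_on_add[OF assms(2)])
  qed
qed

lemmas Ck_on_mult = Ck_on_bilinear[OF bounded_bilinear_mult]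
lemmas Ck_on_scaleR = Ck_on_bilinear[OF bounded_bilinear_scaleR]

lemma Ck_on_minus: "open S \<Longrightarrow> Ck_on k S f \<Longrightarrow> Ck_on k S (\<lambda>x. - f x)"
  by (rule Ck_on_bounded_linear[OF bounded_linear_minus[OF bounded_linear_ident]])

lemma Ck_on_sum:
  "open S \<Longrightarrow> (\<And>i. i \<in> I \<Longrightarrow> Ck_on k S (f i)) \<Longrightarrow> Ck_on k S (\<lambda>x. \<Sum>i\<in>I. f i x)"
  by (induction I rule: infinite_finite_induct) (auto intro!: Ck_on_const Ck_on_add)

lemma Ck_on_prod:
  fixes f :: "'i \<Rightarrow> 'a::real_normed_vector \<Rightarrow> real"
  shows "open S \<Longrightarrow> (\<And>i. i \<in> I \<Longrightarrow> Ck_on k S (f i)) \<Longrightarrow> Ck_on k S (\<lambda>x. \<Prod>i\<in>I. f i x)"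
  by (induction I rule: infinite_finite_induct) (auto intro!: Ck_on_const Ck_on_mult)

text \<open>The induction hypothesis covers derivatives along fixed directions only, whereas the
  chain rule applies the derivative of \<open>g\<close> to the moving vector
  \<open>frechet_derivative f (at x) v\<close>. Expanding this vector over \<open>Basis\<close>
  makes the directions constant, which is why the middle space is Euclidean.\<close>

lemma Ck_on_compose:
  fixes f :: "'a::real_normed_vector \<Rightarrow> 'b::euclidean_space" and g :: "'b \<Rightarrow> 'c::real_normed_vector"
  assumes "open S" "open T" "f ` S \<subseteq> T"
  shows "Ck_on k S f \<Longrightarrow> Ck_on k T g \<Longrightarrow> Ck_on k S (\<lambda>x. g (f x))"
proof (induction k arbitrary: g)
  case 0
  then show ?case using assms(3) by (auto intro: continuous_on_compose2)
next
  case (Suc k)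
  let ?D = "\<lambda>x v. \<Sum>b\<in>Basis. (frechet_derivative f (at x) v \<bullet> b) *\<^sub>R frechet_derivative g (at (f x)) b"
  show ?case
  proof (rule Ck_on_SucI[OF assms(1)])
    show "((\<lambda>x. g (f x)) has_derivative ?D x) (at x)" if "x \<in> S" for x
    proof -
      have g: "(g has_derivative frechet_derivative g (at (f x))) (at (f x))"
        using Ck_on_Suc_has_derivative[OF Suc.prems(2)] that assms(3) by blast
      have eq: "frechet_derivative g (at (f x)) w = (\<Sum>b\<in>Basis. (w \<bullet> b) *\<^sub>R frechet_derivative g (at (f x)) b)" for w
        using has_derivative_linear[OF g]
        by (subst euclidean_representation[of w, symmetric])
          (simp add: linear_sum linear_cmul)
      have "((\<lambda>x. g (f x)) has_derivative (\<lambda>v. frechet_derivative g (at (f x)) (frechet_derivative f (at x) v))) (at x)"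
        using diff_chain_at[OF Ck_on_Suc_has_derivative[OF Suc.prems(1) that] g] by (simp add: o_def)
      then show ?thesis by (subst (asm) eq)
    qed
    show "Ck_on k S (\<lambda>x. ?D x v)" for v
    proof (intro Ck_on_sum[OF assms(1)] Ck_on_scaleR[OF assms(1)])
      show "Ck_on k S (\<lambda>x. frechet_derivative f (at x) v \<bullet> b)" for b
        by (rule Ck_on_bounded_linear[OF bounded_linear_inner_left assms(1)]) (use Suc.prems in simp)
      show "Ck_on k S (\<lambda>x. frechet_derivative g (at (f x)) b)" for b
        by (rule Suc.IH[OF Ck_on_SucD[OF Suc.prems(1)]]) (use Suc.prems in simp)
    qed
  qed
qed

lemma Ck_on_inverse_real: "Ck_on k {x. x \<noteq> 0} (inverse :: real \<Rightarrow> real)"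
proof (induction k)
  case 0
  then show ?case by (auto intro!: continuous_intros)
next
  case (Suc k)
  have o: "open {x. x \<noteq> (0::real)}" by (simp add: open_Collect_neq)
  show ?case
    by (rule Ck_on_SucI[OF o, where D = "\<lambda>x v. - (inverse x * v * inverse x)"])
      (auto intro!: has_derivative_inverse' Ck_on_minus Ck_on_mult Ck_on_const Suc o)
qed

lemma Ck_on_divide:
  fixes f g :: "'a::real_normed_vector \<Rightarrow> real"
  assumes "open S" "Ck_on k S f" "Ck_on k S g" "\<And>x. x \<in> S \<Longrightarrow> g x \<noteq> 0"
  shows "Ck_on k S (\<lambda>x. f x / g x)"
proof -
  have o: "open {x. x \<noteq> (0::real)}" by (simp add: open_Collect_neq)
  show ?thesis
    unfolding divide_inverse
    by (intro Ck_on_mult assms Ck_on_compose[OF _ o _ _ Ck_on_inverse_real]) (use assms in auto)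
qed

lemma Ck_on_vec_iff:
  fixes f :: "'a::real_normed_vector \<Rightarrow> real^'n"
  assumes "open S"
  shows "Ck_on k S f \<longleftrightarrow> (\<forall>i. Ck_on k S (\<lambda>x. f x $ i))"
proof
  assume "Ck_on k S f"
  then show "\<forall>i. Ck_on k S (\<lambda>x. f x $ i)"
    by (auto intro: Ck_on_bounded_linear[OF bounded_linear_vec_nth assms])
next
  assume *: "\<forall>i. Ck_on k S (\<lambda>x. f x $ i)"
  have "f = (\<lambda>x. \<Sum>i\<in>UNIV. (f x $ i) *\<^sub>R axis i 1)"
    by (rule ext) (simp add: vec_eq_iff axis_def if_distrib cong: if_cong)
  moreover have "Ck_on k S (\<lambda>x. \<Sum>i\<in>UNIV. (f x $ i) *\<^sub>R (axis i 1 :: real^'n))"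
    by (intro Ck_on_sum Ck_on_scaleR assms Ck_on_const) (use * in auto)
  ultimately show "Ck_on k S f" by metis
qed

section \<open>Determinants and matrix inversion\<close>

lemma Ck_on_det:
  fixes A :: "'a::real_normed_vector \<Rightarrow> real^'n^'n"
  assumes "open S" "\<And>i j. Ck_on k S (\<lambda>x. A x $ i $ j)"
  shows "Ck_on k S (\<lambda>x. det (A x))"
  unfolding det_def by (intro Ck_on_sum Ck_on_mult Ck_on_prod Ck_on_const assms)

lemma matrix_inv_nonsingular:
  fixes A :: "real^'n^'n"
  assumes "det A \<noteq> 0"
  shows "A ** matrix_inv A = mat 1" "matrix_inv A ** A = mat 1"
proof -
  have "\<exists>B. A ** B = mat 1 \<and> B ** A = mat 1"
    using assms by (simp add: invertible_det_nz[symmetric] invertible_def)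
  from someI_ex[OF this] show "A ** matrix_inv A = mat 1" "matrix_inv A ** A = mat 1"
    by (simp_all add: matrix_inv_def)
qed

text \<open>Cramer's rule, applied to the columns of the inverse: the entries become quotients of
  determinants, so their smoothness follows from that of the entries of \<open>A\<close>.\<close>

lemma matrix_inv_entry:
  fixes A :: "real^'n^'n"
  assumes "det A \<noteq> 0"
  shows "matrix_inv A $ k $ l = det (\<chi> i j. if j = k then (axis l 1 :: real^'n) $ i else A $ i $ j) / det A"
proof -
  have "A ** matrix_inv A = mat 1"
    by (rule matrix_inv_nonsingular(1)[OF assms])
  then have "A *v (matrix_inv A *v axis l 1) = axis l 1"
    by (simp add: matrix_vector_mul_assoc)
  from iffD1[OF cramer[OF assms] this] show ?thesis
    by (simp add: matrix_vector_mult_basis column_def vec_eq_iff)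
qed

lemma Ck_on_matrix_inv:
  fixes A :: "'a::real_normed_vector \<Rightarrow> real^'n^'n"
  assumes "open S" "\<And>i j. Ck_on k S (\<lambda>x. A x $ i $ j)" "\<And>x. x \<in> S \<Longrightarrow> det (A x) \<noteq> 0"
  shows "Ck_on k S (\<lambda>x. matrix_inv (A x) $ m $ l)"
proof -
  have "Ck_on k S (\<lambda>x. (\<chi> i j. if j = m then (axis l 1 :: real^'n) $ i else A x $ i $ j) $ i $ j)" for i j
    by (cases "j = m") (simp_all add: assms Ck_on_const)
  then have "Ck_on k S (\<lambda>x. det (\<chi> i j. if j = m then (axis l 1 :: real^'n) $ i else A x $ i $ j) / det (A x))"
    by (intro Ck_on_divide Ck_on_det assms)
  then show ?thesis
    by (subst Ck_on_cong[OF assms(1) matrix_inv_entry[OF assms(3)]])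
qed

lemma smooth_onD: "smooth_on S f \<Longrightarrow> Ck_on k S f"
  by (simp add: smooth_on_def)

lemma smooth_on_has_derivative:
  "smooth_on S f \<Longrightarrow> x \<in> S \<Longrightarrow> (f has_derivative frechet_derivative f (at x)) (at x)"
  using Ck_on_Suc_has_derivative smooth_onD by blast

lemma smooth_on_frechet_derivative:
  "smooth_on S f \<Longrightarrow> smooth_on S (\<lambda>x. frechet_derivative f (at x) v)"
  unfolding smooth_on_def by (metis Ck_on.simps(2))

lemma smooth_on_continuous: "smooth_on S f \<Longrightarrow> continuous_on S f"
  using Ck_on_continuous smooth_onD by blast

lemma smooth_on_cong:
  "open S \<Longrightarrow> (\<And>y. y \<in> S \<Longrightarrow> f y = g y) \<Longrightarrow> smooth_on S f \<longleftrightarrow> smooth_on S g"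
  unfolding smooth_on_def using Ck_on_cong by blast

lemma smooth_on_subset: "smooth_on S f \<Longrightarrow> T \<subseteq> S \<Longrightarrow> smooth_on T f"
  unfolding smooth_on_def using Ck_on_subset by blast

lemma smooth_on_const: "open S \<Longrightarrow> smooth_on S (\<lambda>x. c)"
  unfolding smooth_on_def using Ck_on_const by blast

lemma smooth_on_linear: "bounded_linear L \<Longrightarrow> open S \<Longrightarrow> smooth_on S L"
  unfolding smooth_on_def using Ck_on_linear by blast

lemma smooth_on_bounded_linear:
  "bounded_linear L \<Longrightarrow> open S \<Longrightarrow> smooth_on S f \<Longrightarrow> smooth_on S (\<lambda>x. L (f x))"
  unfolding smooth_on_def using Ck_on_bounded_linear by blast

lemma smooth_on_add: "open S \<Longrightarrow> smooth_on S f \<Longrightarrow> smooth_on S g \<Longrightarrow> smooth_on S (\<lambda>x. f x + g x)"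
  unfolding smooth_on_def using Ck_on_add by blast

lemma smooth_on_minus: "open S \<Longrightarrow> smooth_on S f \<Longrightarrow> smooth_on S (\<lambda>x. - f x)"
  unfolding smooth_on_def using Ck_on_minus by blast

lemma smooth_on_mult:
  fixes f g :: "'a::real_normed_vector \<Rightarrow> real"
  shows "open S \<Longrightarrow> smooth_on S f \<Longrightarrow> smooth_on S g \<Longrightarrow> smooth_on S (\<lambda>x. f x * g x)"
  unfolding smooth_on_def using Ck_on_mult by blast

lemma smooth_on_scaleR:
  "open S \<Longrightarrow> smooth_on S f \<Longrightarrow> smooth_on S g \<Longrightarrow> smooth_on S (\<lambda>x. f x *\<^sub>R g x)"
  unfolding smooth_on_def using Ck_on_scaleR by blast

lemma smooth_on_sum:
  "open S \<Longrightarrow> (\<And>i. i \<in> I \<Longrightarrow> smooth_on S (f i)) \<Longrightarrow> smooth_on S (\<lambda>x. \<Sum>i\<in>I. f i x)"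
  unfolding smooth_on_def using Ck_on_sum[of S I _ f] by blast

lemma smooth_on_compose:
  fixes f :: "'a::real_normed_vector \<Rightarrow> 'b::euclidean_space"
  shows "open S \<Longrightarrow> open T \<Longrightarrow> f ` S \<subseteq> T \<Longrightarrow> smooth_on S f \<Longrightarrow> smooth_on T g \<Longrightarrow> smooth_on S (\<lambda>x. g (f x))"
  unfolding smooth_on_def using Ck_on_compose by blast

lemma smooth_on_vec_iff:
  fixes f :: "'a::real_normed_vector \<Rightarrow> real^'n"
  shows "open S \<Longrightarrow> smooth_on S f \<longleftrightarrow> (\<forall>i. smooth_on S (\<lambda>x. f x $ i))"
  unfolding smooth_on_def using Ck_on_vec_iff by blast

lemma smooth_on_matrix_inv:
  fixes A :: "'a::real_normed_vector \<Rightarrow> real^'n^'n"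
  assumes "open S" "\<And>i j. smooth_on S (\<lambda>x. A x $ i $ j)" "\<And>x. x \<in> S \<Longrightarrow> det (A x) \<noteq> 0"
  shows "smooth_on S (\<lambda>x. matrix_inv (A x) $ m $ l)"
  using assms Ck_on_matrix_inv[of S _ A m l] unfolding smooth_on_def by auto

text \<open>Mean value theorem along the two sides of the parallelogram spanned by \<open>u\<close> and \<open>v\<close>, applied to the
  second difference of \<open>f\<close>.\<close>

lemma second_difference_mvt:
  fixes f :: "'a::real_normed_vector \<Rightarrow> real"
  assumes f: "Ck_on 2 S f" and e: "e > 0"
    and S: "\<And>s t. 0 \<le> s \<Longrightarrow> s \<le> e \<Longrightarrow> 0 \<le> t \<Longrightarrow> t \<le> e \<Longrightarrow> x + s *\<^sub>R u + t *\<^sub>R v \<in> S"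
  obtains s t where "0 \<le> s" "s \<le> e" "0 \<le> t" "t \<le> e"
    "f (x + e *\<^sub>R u + e *\<^sub>R v) - f (x + e *\<^sub>R u) - f (x + e *\<^sub>R v) + f x =
      e * e * frechet_derivative (\<lambda>y. frechet_derivative f (at y) u) (at (x + s *\<^sub>R u + t *\<^sub>R v)) v"
proof -
  let ?fu = "\<lambda>y. frechet_derivative f (at y) u"
  have f2: "Ck_on (Suc (Suc 0)) S f" using f by (simp only: numeral_2_eq_2)
  have d1: "(f has_derivative frechet_derivative f (at y)) (at y)" if "y \<in> S" for y
    using Ck_on_Suc_has_derivative[OF f2 that] .
  have d2: "(?fu has_derivative frechet_derivative ?fu (at y)) (at y)" if "y \<in> S" for y
    using Ck_on_Suc_has_derivative[of 0 S ?fu y] f2 that by auto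
  have sc: "frechet_derivative f (at y) (c *\<^sub>R w) = c * frechet_derivative f (at y) w" if "y \<in> S" for y c w
    using has_derivative_linear[OF d1[OF that]] by (simp add: linear_cmul)
  have sc2: "frechet_derivative ?fu (at y) (c *\<^sub>R w) = c * frechet_derivative ?fu (at y) w" if "y \<in> S" for y c w
    using has_derivative_linear[OF d2[OF that]] by (simp add: linear_cmul)
  have D1: "((\<lambda>s. f (x + s *\<^sub>R u + t *\<^sub>R v)) has_field_derivative ?fu (x + s *\<^sub>R u + t *\<^sub>R v)) (at s)"
    if "0 \<le> s" "s \<le> e" "0 \<le> t" "t \<le> e" for s t
  proof -
    have "((\<lambda>s. x + s *\<^sub>R u + t *\<^sub>R v) has_derivative (\<lambda>h. h *\<^sub>R u)) (at s)"
      by (auto intro!: derivative_eq_intros)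
    from diff_chain_at[OF this d1[OF S[OF that]]] show ?thesis
      by (simp add: o_def has_field_derivative_def sc[OF S[OF that]] mult_commute_abs)
  qed
  have D2: "((\<lambda>t. ?fu (x + s *\<^sub>R u + t *\<^sub>R v)) has_field_derivative frechet_derivative ?fu (at (x + s *\<^sub>R u + t *\<^sub>R v)) v) (at t)"
    if "0 \<le> s" "s \<le> e" "0 \<le> t" "t \<le> e" for s t
  proof -
    have "((\<lambda>t. x + s *\<^sub>R u + t *\<^sub>R v) has_derivative (\<lambda>h. h *\<^sub>R v)) (at t)"
      by (auto intro!: derivative_eq_intros)
    from diff_chain_at[OF this d2[OF S[OF that]]] show ?thesis
      by (simp add: o_def has_field_derivative_def sc2[OF S[OF that]] mult_commute_abs)
  qed
  have "\<exists>s>0. s < e \<and> (f (x + e *\<^sub>R u + e *\<^sub>R v) - f (x + e *\<^sub>R u + 0 *\<^sub>R v)) - (f (x + 0 *\<^sub>R u + e *\<^sub>R v) - f (x + 0 *\<^sub>R u + 0 *\<^sub>R v))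
     = (e - 0) * (?fu (x + s *\<^sub>R u + e *\<^sub>R v) - ?fu (x + s *\<^sub>R u + 0 *\<^sub>R v))"
    by (rule MVT2[OF e]) (rule DERIV_diff; rule D1; use e in simp)
  then obtain s where s: "0 < s" "s < e"
    and seq: "f (x + e *\<^sub>R u + e *\<^sub>R v) - f (x + e *\<^sub>R u) - f (x + e *\<^sub>R v) + f x
      = e * (?fu (x + s *\<^sub>R u + e *\<^sub>R v) - ?fu (x + s *\<^sub>R u + 0 *\<^sub>R v))"
    by auto
  have "\<exists>t>0. t < e \<and> ?fu (x + s *\<^sub>R u + e *\<^sub>R v) - ?fu (x + s *\<^sub>R u + 0 *\<^sub>R v)
      = (e - 0) * frechet_derivative ?fu (at (x + s *\<^sub>R u + t *\<^sub>R v)) v"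
    by (rule MVT2[OF e]) (rule D2; use s in simp)
  then obtain t where t: "0 < t" "t < e" and teq: "?fu (x + s *\<^sub>R u + e *\<^sub>R v) - ?fu (x + s *\<^sub>R u + 0 *\<^sub>R v)
      = e * frechet_derivative ?fu (at (x + s *\<^sub>R u + t *\<^sub>R v)) v"
    by auto
  show ?thesis
    by (rule that[of s t]) (use s t seq teq in \<open>auto simp: algebra_simps\<close>)
qed

text \<open>The second difference over a parallelogram does not depend on the order of its sides.
  Divided by \<open>e * e\<close> it equals each of the two mixed derivatives at some point of the
  parallelogram, and both tend to their values at \<open>x\<close> by continuity.\<close>

lemma frechet_derivative_commute:
  fixes f :: "'a::real_normed_vector \<Rightarrow> real"
  assumes f: "Ck_on 2 S f" and S: "open S" and x: "x \<in> S"
  shows "frechet_derivative (\<lambda>y. frechet_derivative f (at y) u) (at x) v =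
    frechet_derivative (\<lambda>y. frechet_derivative f (at y) v) (at x) u"
proof -
  let ?H = "\<lambda>u v y. frechet_derivative (\<lambda>y. frechet_derivative f (at y) u) (at y) v"
  have cont: "continuous_on S (?H u v)" for u v
    using f by (simp add: numeral_2_eq_2)
  have near: "\<forall>\<^sub>F e in at_right 0. \<forall>s t. 0 \<le> s \<longrightarrow> s \<le> e \<longrightarrow> 0 \<le> t \<longrightarrow> t \<le> e \<longrightarrow> x + s *\<^sub>R u + t *\<^sub>R v \<in> T"
    if T: "open T" "x \<in> T" for T u v
  proof -
    obtain r where r: "r > 0" "ball x r \<subseteq> T" using T open_contains_ball by blast
    \<comment> \<open>With this \<open>d\<close> every point with \<open>s\<close> and
      \<open>t\<close> below \<open>d\<close> lies within \<open>r\<close> of \<open>x\<close>; the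
      summand 1 keeps the denominator positive when \<open>u\<close> and \<open>v\<close>
      vanish.\<close>
    define d where "d = r / (norm u + norm v + 1)"
    have np: "norm u + norm v + 1 > 0" by (simp add: add_nonneg_pos)
    have d: "d > 0" unfolding d_def using r np by simp
    have "x + s *\<^sub>R u + t *\<^sub>R v \<in> T" if "0 < e" "e < d" "0 \<le> s" "s \<le> e" "0 \<le> t" "t \<le> e" for e s t
    proof -
      have "norm (s *\<^sub>R u + t *\<^sub>R v) \<le> s * norm u + t * norm v"
        using that by (intro norm_triangle_le) auto
      also have "\<dots> \<le> e * norm u + e * norm v"
        using that by (intro add_mono mult_right_mono) auto
      also have "\<dots> \<le> e * (norm u + norm v + 1)" using that by (simp add: algebra_simps)
      also have "\<dots> < d * (norm u + norm v + 1)" using that np by (intro mult_strict_right_mono)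
      also have "\<dots> = r" unfolding d_def using np by simp
      finally have "dist x (x + (s *\<^sub>R u + t *\<^sub>R v)) < r" 
        by (metis dist_norm dist_add_cancel dist_commute add.right_neutral diff_zero)
      then show ?thesis using r by (auto simp: add.assoc)
    qed
    then show ?thesis unfolding eventually_at_right_field using d by blast
  qed
  have close: "\<forall>\<^sub>F e in at_right 0. \<bar>(f (x + e *\<^sub>R u + e *\<^sub>R v) - f (x + e *\<^sub>R u) - f (x + e *\<^sub>R v) + f x) / (e * e) - ?H u v x\<bar> \<le> d"
    if "d > 0" for d u v
  proof -
    define T where "T = S \<inter> {y \<in> S. \<bar>?H u v y - ?H u v x\<bar> < d}"
    have "continuous_on S (\<lambda>y. \<bar>?H u v y - ?H u v x\<bar>)"
      by (intro continuous_intros cont)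
    then have "open {y \<in> S. \<bar>?H u v y - ?H u v x\<bar> < d}"
      using continuous_openin_preimage_gen[of S "\<lambda>y. \<bar>?H u v y - ?H u v x\<bar>" "{..<d}"] S
      by (simp add: openin_open_eq vimage_def Int_def)
    then have T: "open T" "x \<in> T" using S x that unfolding T_def by auto
    show ?thesis using near[OF T, of u v] eventually_at_right_less[of "0::real"]
    proof eventually_elim
      case (elim e)
      have "x + s *\<^sub>R u + t *\<^sub>R v \<in> S" if "0 \<le> s" "s \<le> e" "0 \<le> t" "t \<le> e" for s t
        using elim that unfolding T_def by blast
      then obtain s t where st: "0 \<le> s" "s \<le> e" "0 \<le> t" "t \<le> e"
        and eq: "f (x + e *\<^sub>R u + e *\<^sub>R v) - f (x + e *\<^sub>R u) - f (x + e *\<^sub>R v) + f x = e * e * ?H u v (x + s *\<^sub>R u + t *\<^sub>R v)"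
        using second_difference_mvt[OF f elim(2)] by metis
      have "x + s *\<^sub>R u + t *\<^sub>R v \<in> T" using elim st by blast
      then show ?case unfolding eq T_def using elim(2) by auto
    qed
  qed
  have "\<bar>?H u v x - ?H v u x\<bar> \<le> 2 * d" if "d > 0" for d
  proof -
    have "\<forall>\<^sub>F e in at_right (0::real). \<bar>?H u v x - ?H v u x\<bar> \<le> 2 * d"
      using close[OF that, of u v] close[OF that, of v u]
    proof eventually_elim
      case (elim e)
      have eq: "f (x + e *\<^sub>R v + e *\<^sub>R u) - f (x + e *\<^sub>R v) - f (x + e *\<^sub>R u) + f x =
        f (x + e *\<^sub>R u + e *\<^sub>R v) - f (x + e *\<^sub>R u) - f (x + e *\<^sub>R v) + f x" by (simp add: algebra_simps)
      show ?case using elim(1) elim(2)[unfolded eq] by linarith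
    qed
    then show ?thesis by (simp add: eventually_const_iff)
  qed
  note small = this
  show ?thesis
  proof (rule ccontr)
    assume "\<not> ?thesis"
    \<comment> \<open>A positive gap would, with tolerance a quarter of it, be at most half of
      itself.\<close>
    with small[of "\<bar>?H u v x - ?H v u x\<bar> / 4"] show False by auto
  qed
qed

section \<open>Integrable linear systems\<close>

text \<open>The system is \<open>F' x v = A x v (F x)\<close> with prescribed \<open>F 0\<close>.
  Differentiating the right side along \<open>u\<close> gives
  \<open>A' x u v (F x) + A x v (A x u (F x))\<close>, and \<open>integrable\<close> is the symmetry
  in \<open>u\<close> and \<open>v\<close> that second derivatives force. The bound
  \<open>C * r \<le> 1 / 4\<close> makes the radial integral operator contract values by 1/4 and
  defects by 1/2.\<close>

locale integrable_linear_system =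
  fixes A :: "'x::euclidean_space \<Rightarrow> 'x \<Rightarrow>\<^sub>L 'v::euclidean_space \<Rightarrow>\<^sub>L 'v"
    and A' :: "'x \<Rightarrow> 'x \<Rightarrow>\<^sub>L 'x \<Rightarrow>\<^sub>L 'v \<Rightarrow>\<^sub>L 'v"
    and r C :: real
  assumes r: "r > 0" and C: "C \<ge> 0" and Cr: "C * r \<le> 1 / 4"
    and dA: "\<And>x. x \<in> ball 0 r \<Longrightarrow> (A has_derivative A' x) (at x)"
    and contA': "continuous_on (ball 0 r) A'"
    and normA: "\<And>x. x \<in> ball 0 r \<Longrightarrow> norm (A x) \<le> C"
    and integrable: "\<And>x u v. x \<in> ball 0 r \<Longrightarrow>
      A' x u v + (A x v o\<^sub>L A x u) = A' x v u + (A x u o\<^sub>L A x v)"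
begin

lemma contA: "continuous_on (ball 0 r) A"
  using dA has_derivative_continuous continuous_at_imp_continuous_on by blast

lemma norm_A_apply: "x \<in> ball 0 r \<Longrightarrow> norm (A x u w) \<le> C * norm u * norm w"
proof -
  assume x: "x \<in> ball 0 r"
  have "norm (A x u w) \<le> norm (A x u) * norm w" by (rule norm_blinfun)
  also have "\<dots> \<le> (norm (A x) * norm u) * norm w" by (intro mult_right_mono norm_blinfun) simp
  also have "\<dots> \<le> C * norm u * norm w" using normA[OF x] by (intro mult_right_mono) auto
  finally show ?thesis .
qed

section \<open>Integration along rays\<close>

lemma scale_in_ball: "(x::'x) \<in> ball 0 r \<Longrightarrow> t \<in> {0..1} \<Longrightarrow> t *\<^sub>R x \<in> ball 0 r"
proof -
  assume *: "x \<in> ball 0 r" "t \<in> {0..1}"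
  then have "\<bar>t\<bar> * norm x \<le> 1 * norm x" by (intro mult_right_mono) auto
  with * show ?thesis by (simp add: dist_norm)
qed

text \<open>Along a ray a solution satisfies the ordinary differential equation d/dt F(t x) = A(t x)
  x F(t x), so it is a fixed point of \<open>step w\<close>. That the equation holds in all
  directions, and not only radially, is where integrability enters.\<close>

definition step :: "'v \<Rightarrow> ('x \<Rightarrow> 'v) \<Rightarrow> 'x \<Rightarrow> 'v" where
  "step w F x = w + integral {0..1} (\<lambda>t. A (t *\<^sub>R x) x (F (t *\<^sub>R x)))"

text \<open>The product rule for the integrand of \<open>step\<close>, in which \<open>x\<close>
  occurs three times. It is written with composition and evaluation of bounded linear maps because
  this form displays the joint continuity in \<open>x\<close> and \<open>t\<close>; the readable
  form is \<open>dstep_integrand_apply\<close>.\<close>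

definition dstep_integrand :: "('x \<Rightarrow> 'v) \<Rightarrow> ('x \<Rightarrow> 'x \<Rightarrow>\<^sub>L 'v) \<Rightarrow> 'x \<Rightarrow> real \<Rightarrow> 'x \<Rightarrow>\<^sub>L 'v" where
  "dstep_integrand F F' x t =
     (blinfun.prod_left (F (t *\<^sub>R x)) o\<^sub>L A (t *\<^sub>R x))
     + t *\<^sub>R (blinfun.prod_left (F (t *\<^sub>R x)) o\<^sub>L (blinfun.prod_left x o\<^sub>L A' (t *\<^sub>R x)))
     + t *\<^sub>R (A (t *\<^sub>R x) x o\<^sub>L F' (t *\<^sub>R x))"

definition dstep :: "('x \<Rightarrow> 'v) \<Rightarrow> ('x \<Rightarrow> 'x \<Rightarrow>\<^sub>L 'v) \<Rightarrow> 'x \<Rightarrow> 'x \<Rightarrow>\<^sub>L 'v" where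
  "dstep F F' x = integral {0..1} (dstep_integrand F F' x)"

lemma dstep_integrand_apply:
  "dstep_integrand F F' x t v = A (t *\<^sub>R x) v (F (t *\<^sub>R x)) + t *\<^sub>R A' (t *\<^sub>R x) v x (F (t *\<^sub>R x))
    + t *\<^sub>R A (t *\<^sub>R x) x (F' (t *\<^sub>R x) v)"
  by (simp add: dstep_integrand_def blinfun.bilinear_simps)

context
  fixes F :: "'x \<Rightarrow> 'v" and F' :: "'x \<Rightarrow> 'x \<Rightarrow>\<^sub>L 'v"
  assumes dF: "\<And>x. x \<in> ball 0 r \<Longrightarrow> (F has_derivative blinfun_apply (F' x)) (at x)"
    and contF': "continuous_on (ball 0 r) F'"
begin

lemma contF: "continuous_on (ball 0 r) F"
  using dF has_derivative_continuous continuous_at_imp_continuous_on by blast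

lemma continuous_on_scaled:
  fixes G :: "'x \<Rightarrow> 'z::topological_space"
  assumes "continuous_on (ball 0 r) G"
  shows "continuous_on (ball 0 r \<times> {0..1}) (\<lambda>z. G (snd z *\<^sub>R fst z))"
proof (rule continuous_on_compose2[OF assms])
  show "(\<lambda>z::'x \<times> real. snd z *\<^sub>R fst z) ` (ball 0 r \<times> {0..1}) \<subseteq> ball 0 r"
  proof (rule image_subsetI)
    fix z :: "'x \<times> real" assume "z \<in> ball 0 r \<times> {0..1}"
    then show "snd z *\<^sub>R fst z \<in> ball 0 r" using scale_in_ball[of "fst z" "snd z"] by auto
  qed
qed (intro continuous_intros)

lemma continuous_dstep_integrand:
  "continuous_on (ball 0 r \<times> cbox 0 1) (\<lambda>(x, t). dstep_integrand F F' x t)"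
  unfolding dstep_integrand_def split_beta box_real
  by (intro continuous_intros continuous_on_scaled contA contA' contF contF'
      bounded_linear.continuous_on[OF blinfun.bounded_linear_prod_left]
      bounded_bilinear.continuous_on[OF bounded_bilinear_blinfun_compose])

lemma continuous_on_ray:
  fixes G :: "'x \<Rightarrow> 'z::topological_space"
  assumes "continuous_on (ball 0 r) G" "x \<in> ball 0 r"
  shows "continuous_on {0..1} (\<lambda>t. G (t *\<^sub>R x))"
proof (rule continuous_on_compose2[OF assms(1)])
  show "(\<lambda>t. t *\<^sub>R x) ` {0..1} \<subseteq> ball 0 r"
    using scale_in_ball[OF assms(2)] by blast
qed (intro continuous_intros)

lemma step_integrable:
  assumes "x \<in> ball 0 r"
  shows "(\<lambda>t. A (t *\<^sub>R x) x (F (t *\<^sub>R x))) integrable_on {0..1}"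
  by (intro integrable_continuous_interval continuous_intros continuous_on_ray contA contF assms)

lemma dstep_integrable:
  assumes "x \<in> ball 0 r"
  shows "dstep_integrand F F' x integrable_on {0..1}"
  unfolding dstep_integrand_def
  by (intro integrable_continuous_interval continuous_intros continuous_on_ray contA contA' contF contF' assms
      bounded_linear.continuous_on[OF blinfun.bounded_linear_prod_left]
      bounded_bilinear.continuous_on[OF bounded_bilinear_blinfun_compose])

lemma continuous_dstep: "continuous_on (ball 0 r) (dstep F F')"
  unfolding dstep_def
  using integral_continuous_on_param[OF continuous_dstep_integrand]
  by (simp add: box_real)

lemma step_has_derivative:
  assumes x: "x \<in> ball 0 r"
  shows "(step w F has_derivative dstep F F' x) (at x)"
proof -
  have "((\<lambda>x. integral (cbox 0 1) (\<lambda>t. A (t *\<^sub>R x) x (F (t *\<^sub>R x)))) has_derivative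
      integral (cbox 0 1) (dstep_integrand F F' x)) (at x within ball 0 r)"
  proof (rule leibniz_rule[OF _ _ continuous_dstep_integrand x convex_ball])
    fix x :: 'x and t :: real assume x: "x \<in> ball 0 r" and t: "t \<in> cbox 0 1"
    have tx: "t *\<^sub>R x \<in> ball 0 r" using scale_in_ball[OF x] t by (simp add: box_real)
    have s: "((\<lambda>x. t *\<^sub>R x) has_derivative (\<lambda>v. t *\<^sub>R v)) (at x within ball 0 r)"
      by (auto intro!: derivative_eq_intros)
    have a: "((\<lambda>x. A (t *\<^sub>R x)) has_derivative (\<lambda>v. A' (t *\<^sub>R x) (t *\<^sub>R v))) (at x within ball 0 r)"
      by (rule has_derivative_compose[OF s dA[OF tx]])
    have f: "((\<lambda>x. F (t *\<^sub>R x)) has_derivative (\<lambda>v. F' (t *\<^sub>R x) (t *\<^sub>R v))) (at x within ball 0 r)"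
      by (rule has_derivative_compose[OF s dF[OF tx]])
    show "((\<lambda>x. A (t *\<^sub>R x) x (F (t *\<^sub>R x))) has_derivative
        blinfun_apply (dstep_integrand F F' x t)) (at x within ball 0 r)"
      by (rule has_derivative_eq_rhs[OF blinfun.FDERIV[OF blinfun.FDERIV[OF a has_derivative_ident] f]])
        (auto simp: dstep_integrand_apply blinfun.bilinear_simps fun_eq_iff)
  next
    show "(\<lambda>t. A (t *\<^sub>R x) x (F (t *\<^sub>R x))) integrable_on cbox 0 1" if "x \<in> ball 0 r" for x
      using step_integrable[OF that] by (simp add: box_real)
  qed
  then have "((\<lambda>x. integral {0..1} (\<lambda>t. A (t *\<^sub>R x) x (F (t *\<^sub>R x)))) has_derivative dstep F F' x) (at x)"
    unfolding dstep_def box_real using at_within_open[OF x open_ball] by simp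
  then show ?thesis
    unfolding step_def[abs_def] using has_derivative_add[OF has_derivative_const] by fastforce
qed

text \<open>The homotopy formula: the defect of \<open>step w F\<close> with respect to the equation is obtained from
  the defect of \<open>F\<close> by integration along rays, since \<open>t A(tx)(v) F(tx)\<close> is a primitive of the
  remaining part of the integrand.\<close>

lemma dstep_defect:
  assumes x: "x \<in> ball 0 r"
    and E: "\<And>y u. y \<in> ball 0 r \<Longrightarrow> norm (F' y u - A y u (F y)) \<le> E * norm u"
  shows "norm (dstep F F' x v - A x v (F x)) \<le> E / 2 * norm v"
proof -
  let ?e = "\<lambda>y u. F' y u - A y u (F y)"
  let ?g = "\<lambda>t. A (t *\<^sub>R x) v (F (t *\<^sub>R x)) + t *\<^sub>R A' (t *\<^sub>R x) x v (F (t *\<^sub>R x)) + t *\<^sub>R A (t *\<^sub>R x) v (F' (t *\<^sub>R x) x)"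
  let ?h = "\<lambda>t. t *\<^sub>R (A (t *\<^sub>R x) x (?e (t *\<^sub>R x) v) - A (t *\<^sub>R x) v (?e (t *\<^sub>R x) x))"
  have "(?g has_integral 1 *\<^sub>R A (1 *\<^sub>R x) v (F (1 *\<^sub>R x)) - 0 *\<^sub>R A (0 *\<^sub>R x) v (F (0 *\<^sub>R x))) {0..1}"
  proof (rule fundamental_theorem_of_calculus)
    fix t :: real assume t: "t \<in> {0..1}"
    have tx: "t *\<^sub>R x \<in> ball 0 r" using scale_in_ball[OF x t] .
    have s: "((\<lambda>t. t *\<^sub>R x) has_derivative (\<lambda>h. h *\<^sub>R x)) (at t within {0..1})"
      by (auto intro!: derivative_eq_intros)
    have a: "((\<lambda>t. A (t *\<^sub>R x)) has_derivative (\<lambda>h. A' (t *\<^sub>R x) (h *\<^sub>R x))) (at t within {0..1})"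
      by (rule has_derivative_compose[OF s dA[OF tx]])
    have f: "((\<lambda>t. F (t *\<^sub>R x)) has_derivative (\<lambda>h. F' (t *\<^sub>R x) (h *\<^sub>R x))) (at t within {0..1})"
      by (rule has_derivative_compose[OF s dF[OF tx]])
    show "((\<lambda>t. t *\<^sub>R A (t *\<^sub>R x) v (F (t *\<^sub>R x))) has_vector_derivative ?g t) (at t within {0..1})"
      unfolding has_vector_derivative_def
      by (rule has_derivative_eq_rhs[OF bounded_bilinear.FDERIV[OF bounded_bilinear_scaleR has_derivative_ident
              blinfun.FDERIV[OF blinfun.FDERIV[OF a has_derivative_const] f]]])
        (auto simp: blinfun.bilinear_simps fun_eq_iff algebra_simps)
  qed simp
  then have g: "(?g has_integral A x v (F x)) {0..1}" by simp
  have d: "((\<lambda>t. dstep_integrand F F' x t v) has_integral dstep F F' x v) {0..1}"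
    unfolding dstep_def blinfun_apply_integral[OF dstep_integrable[OF x]]
    using integrable_linear[OF dstep_integrable[OF x] blinfun.bounded_linear_left, of v]
    by (auto intro!: integrable_integral simp: o_def)
  \<comment> \<open>Integrability exchanges the two arguments of \<open>A'\<close> at the price of a
    commutator of \<open>A y v\<close> and \<open>A y x\<close> at the point y = t x; its terms turn
    the derivatives \<open>F'\<close> into defects.\<close>
  have "dstep_integrand F F' x t v - ?g t = ?h t" if "t \<in> {0..1}" for t
  proof -
    have "(A' (t *\<^sub>R x) v x + (A (t *\<^sub>R x) x o\<^sub>L A (t *\<^sub>R x) v)) (F (t *\<^sub>R x))
      = (A' (t *\<^sub>R x) x v + (A (t *\<^sub>R x) v o\<^sub>L A (t *\<^sub>R x) x)) (F (t *\<^sub>R x))"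
      using integrable[OF scale_in_ball[OF x that], of v x] by simp
    then have *: "A' (t *\<^sub>R x) v x (F (t *\<^sub>R x)) = A' (t *\<^sub>R x) x v (F (t *\<^sub>R x))
        + A (t *\<^sub>R x) v (A (t *\<^sub>R x) x (F (t *\<^sub>R x))) - A (t *\<^sub>R x) x (A (t *\<^sub>R x) v (F (t *\<^sub>R x)))"
      by (simp add: blinfun.bilinear_simps algebra_simps)
    show ?thesis
      unfolding dstep_integrand_apply * by (simp add: blinfun.bilinear_simps scaleR_diff_right scaleR_add_right)
  qed
  then have h: "(?h has_integral dstep F F' x v - A x v (F x)) {0..1}"
    by (rule has_integral_eq[OF _ has_integral_diff[OF d g]])
  \<comment> \<open>\<open>E\<close> is not assumed nonnegative; the bound itself forces it unless
    \<open>v\<close> is zero.\<close>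
  have E0: "E \<ge> 0 \<or> norm v = 0"
      using order_trans[OF norm_ge_zero E[OF x, of v]] by (auto simp: zero_le_mult_iff)
  then have Ev: "0 \<le> E / 2 * norm v" by auto
  have "norm (dstep F F' x v - A x v (F x)) \<le> (E / 2 * norm v) * Henstock_Kurzweil_Integration.content {0..1::real}"
  proof (rule has_integral_bound_real[OF Ev finite.emptyI h])
    fix t :: real assume "t \<in> {0..1} - {}"
    then have t: "t \<in> {0..1}" by simp
    have tx: "t *\<^sub>R x \<in> ball 0 r" using scale_in_ball[OF x t] .
    have nx: "norm x \<le> r" using x by simp
    have "norm (A (t *\<^sub>R x) x (?e (t *\<^sub>R x) v)) \<le> C * norm x * norm (?e (t *\<^sub>R x) v)"
      by (rule norm_A_apply[OF tx])
    also have "\<dots> \<le> C * norm x * (E * norm v)" using C by (intro mult_left_mono E tx) auto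
    also have "\<dots> = C * norm v * (E * norm x)" by simp
    finally have 1: "norm (A (t *\<^sub>R x) x (?e (t *\<^sub>R x) v)) \<le> C * norm v * (E * norm x)" .
    have "norm (A (t *\<^sub>R x) v (?e (t *\<^sub>R x) x)) \<le> C * norm v * norm (?e (t *\<^sub>R x) x)"
      by (rule norm_A_apply[OF tx])
    also have "\<dots> \<le> C * norm v * (E * norm x)" using C by (intro mult_left_mono E tx) auto
    finally have 2: "norm (A (t *\<^sub>R x) v (?e (t *\<^sub>R x) x)) \<le> C * norm v * (E * norm x)" .
    \<comment> \<open>Both terms of \<open>?h\<close> have this same bound, which is at most a
      quarter of \<open>E * norm v\<close>; together they give the factor 1/2.\<close>
    have "C * norm v * (E * norm x) = (C * norm x) * (E * norm v)" by simp
    also have "\<dots> \<le> (C * r) * (E * norm v)"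
      using E0 C nx by (intro mult_right_mono mult_left_mono) auto
    also have "\<dots> \<le> 1 / 4 * (E * norm v)" using E0 Cr by (intro mult_right_mono) auto
    finally have 3: "C * norm v * (E * norm x) \<le> E * norm v / 4" by simp
    have "norm (A (t *\<^sub>R x) x (?e (t *\<^sub>R x) v) - A (t *\<^sub>R x) v (?e (t *\<^sub>R x) x)) \<le> E / 2 * norm v"
      using norm_triangle_ineq4[of "A (t *\<^sub>R x) x (?e (t *\<^sub>R x) v)" "A (t *\<^sub>R x) v (?e (t *\<^sub>R x) x)"] 1 2 3 by linarith
    then have "\<bar>t\<bar> * norm (A (t *\<^sub>R x) x (?e (t *\<^sub>R x) v) - A (t *\<^sub>R x) v (?e (t *\<^sub>R x) x)) \<le> 1 * (E / 2 * norm v)"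
      using t by (intro mult_mono) auto
    then show "norm (?h t) \<le> E / 2 * norm v" by simp
  qed
  then show ?thesis by simp
qed

end

section \<open>Contraction and Picard iteration\<close>

lemma step_diff:
  assumes x: "x \<in> ball 0 r" and "continuous_on (ball 0 r) F" "continuous_on (ball 0 r) G"
    and d: "\<And>y. y \<in> ball 0 r \<Longrightarrow> norm (F y - G y) \<le> d"
  shows "norm (step w F x - step w G x) \<le> d / 4"
proof -
  have ray: "continuous_on {0..1} (\<lambda>t. H (t *\<^sub>R x))" if "continuous_on (ball 0 r) H" for H :: "'x \<Rightarrow> 'z::topological_space"
  proof (rule continuous_on_compose2[OF that])
    show "(\<lambda>t. t *\<^sub>R x) ` {0..1} \<subseteq> ball 0 r"
      using scale_in_ball[OF x] by blast
  qed (intro continuous_intros)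
  have i: "((\<lambda>t. A (t *\<^sub>R x) x (H (t *\<^sub>R x))) has_integral step w H x - w) {0..1}"
    if "continuous_on (ball 0 r) H" for H
    unfolding step_def add_diff_cancel_left'
    by (intro integrable_integral integrable_continuous_interval continuous_intros ray contA that)
  have "((\<lambda>t. A (t *\<^sub>R x) x (F (t *\<^sub>R x) - G (t *\<^sub>R x))) has_integral step w F x - step w G x) {0..1}"
    using has_integral_diff[OF i[OF assms(2)] i[OF assms(3)]] by (simp add: blinfun.bilinear_simps)
  note hi = this
  have d0: "d \<ge> 0" using order_trans[OF norm_ge_zero d[OF x]] .
  have bd: "norm (A (t *\<^sub>R x) x (F (t *\<^sub>R x) - G (t *\<^sub>R x))) \<le> d / 4" if "t \<in> {0..1}" for t
  proof -
    have tx: "t *\<^sub>R x \<in> ball 0 r" using scale_in_ball[OF x that] .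
    have "norm (A (t *\<^sub>R x) x (F (t *\<^sub>R x) - G (t *\<^sub>R x))) \<le> C * norm x * norm (F (t *\<^sub>R x) - G (t *\<^sub>R x))"
      by (rule norm_A_apply[OF tx])
    also have "\<dots> \<le> C * r * d" using x d[OF tx] C r by (intro mult_mono) auto
    also have "\<dots> \<le> 1 / 4 * d" using Cr d0 by (intro mult_right_mono) auto
    finally show ?thesis by simp
  qed
  have "norm (step w F x - step w G x) \<le> d / 4 * Henstock_Kurzweil_Integration.content {0..1::real}"
    by (rule has_integral_bound_real[OF _ finite.emptyI hi]) (use d0 bd in auto)
  then show ?thesis by simp
qed

text \<open>The Picard iterates are paired with their derivatives. Their defects tend to zero by
  \<open>dstep_defect\<close>, so that the derivatives converge uniformly as well.\<close>

fun picard :: "'v \<Rightarrow> nat \<Rightarrow> ('x \<Rightarrow> 'v) \<times> ('x \<Rightarrow> 'x \<Rightarrow>\<^sub>L 'v)" where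
  "picard w 0 = ((\<lambda>_. w), (\<lambda>_. 0))"
| "picard w (Suc k) = (step w (fst (picard w k)), dstep (fst (picard w k)) (snd (picard w k)))"

lemma picard_derivative:
  "(\<forall>x\<in>ball 0 r. (fst (picard w k) has_derivative snd (picard w k) x) (at x)) \<and>
    continuous_on (ball 0 r) (snd (picard w k))"
proof (induction k)
  case 0
  then show ?case by (auto intro!: derivative_eq_intros)
next
  case (Suc k)
  then show ?case
    unfolding picard.simps fst_conv snd_conv by (intro conjI ballI step_has_derivative continuous_dstep) auto
qed

lemma picard_continuous: "continuous_on (ball 0 r) (fst (picard w k))"
  using picard_derivative contF by blast

lemma picard_increment:
  "x \<in> ball 0 r \<Longrightarrow> norm (fst (picard w (Suc k)) x - fst (picard w k) x) \<le> norm w * (1 / 4) ^ k"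
proof (induction k arbitrary: x)
  case 0
  \<comment> \<open>\<open>step w\<close> sends the zero function to the constant \<open>w\<close>,
    which is the zeroth iterate; the first increment is thus also a difference of two values of
    \<open>step w\<close>.\<close>
  have "norm (step w (\<lambda>_. w) x - step w (\<lambda>_. 0) x) \<le> norm w / 4"
    by (rule step_diff[OF 0]) auto
  also have "\<dots> \<le> norm w" by simp
  finally show ?case by (simp add: step_def)
next
  case (Suc k)
  have "norm (step w (fst (picard w (Suc k))) x - step w (fst (picard w k)) x) \<le> norm w * (1 / 4) ^ k / 4"
    by (rule step_diff[OF Suc.prems picard_continuous picard_continuous Suc.IH])
  then show ?case by simp
qed

text \<open>One step halves the defect and, because \<open>A\<close> is then paired with the new
  iterate, adds at most \<open>C * norm w * (1/4)^k * norm v\<close>. With rate 3/4 and constant 5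
  the induction closes because 5/2 + 1 = 7/2 is below 5 * 3/4 = 15/4.\<close>

lemma picard_defect:
  "x \<in> ball 0 r \<Longrightarrow> norm (snd (picard w k) x v - A x v (fst (picard w k) x)) \<le> 5 * C * norm w * (3 / 4) ^ k * norm v"
proof (induction k arbitrary: x v)
  case 0
  have "norm (A x v w) \<le> 1 * (C * norm v * norm w)"
    using norm_A_apply[OF 0] by simp
  also have "\<dots> \<le> 5 * (C * norm v * norm w)" using C by (intro mult_right_mono) auto
  finally show ?case by (simp add: mult_ac)
next
  case (Suc k)
  let ?F = "\<lambda>k. fst (picard w k)" and ?F' = "\<lambda>k. snd (picard w k)"
  have le: "(1/4) ^ k \<le> (3/4::real) ^ k" by (intro power_mono) auto
  have "norm (A x v (?F (Suc k) x - ?F k x)) \<le> C * norm v * norm (?F (Suc k) x - ?F k x)"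
    by (rule norm_A_apply[OF Suc.prems])
  also have "\<dots> \<le> C * norm v * (norm w * (3/4) ^ k)"
    using C le by (intro mult_left_mono order_trans[OF picard_increment[OF Suc.prems]]) auto
  finally have 1: "norm (A x v (?F (Suc k) x - ?F k x)) \<le> C * norm w * (3/4)^k * norm v" by (simp add: mult_ac)
  have 2: "norm (dstep (?F k) (?F' k) x v - A x v (?F k x)) \<le> (5 * C * norm w * (3 / 4) ^ k) / 2 * norm v"
    by (rule dstep_defect[OF _ _ Suc.prems Suc.IH]) (use picard_derivative in blast)+
  have "norm (?F' (Suc k) x v - A x v (?F (Suc k) x)) =
      norm ((dstep (?F k) (?F' k) x v - A x v (?F k x)) - A x v (?F (Suc k) x - ?F k x))"
    by (simp add: blinfun.bilinear_simps)
  also have "\<dots> \<le> (5 * C * norm w * (3 / 4) ^ k) / 2 * norm v + C * norm w * (3/4)^k * norm v"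
    using norm_triangle_ineq4 1 2 by (smt (verit))
  also have "\<dots> = 7 / 2 * (C * norm w * (3/4)^k * norm v)" by simp
  also have "\<dots> \<le> 15 / 4 * (C * norm w * (3/4)^k * norm v)"
    using C by (intro mult_right_mono) auto
  also have "\<dots> = 5 * C * norm w * (3 / 4) ^ Suc k * norm v" by simp
  finally show ?case .
qed

lemma picard_limit:
  assumes x: "x \<in> ball 0 r"
  obtains L where "\<And>k. norm (fst (picard w k) x - L) \<le> 2 * norm w * (1/4) ^ k"
    "(\<lambda>k. fst (picard w k) x) \<longlonglongrightarrow> L"
proof -
  let ?f = "\<lambda>k. fst (picard w k) x"
  \<comment> \<open>The sharper factor \<open>2 - 2 * (1/4)^m\<close> reproduces itself in the
    induction on \<open>m\<close>; the mere bound 2 would not.\<close>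
  have tail: "norm (?f (k + m) - ?f k) \<le> (2 - 2 * (1/4)^m) * (norm w * (1/4) ^ k)" for k m
  proof (induction m)
    case (Suc m)
    have "norm (?f (k + Suc m) - ?f k) = norm ((?f (Suc (k + m)) - ?f (k + m)) + (?f (k + m) - ?f k))"
      by simp
    also have "\<dots> \<le> norm w * (1 / 4) ^ (k + m) + (2 - 2 * (1/4)^m) * (norm w * (1/4) ^ k)"
      by (intro norm_triangle_mono picard_increment[OF x] Suc)
    also have "\<dots> = (2 - (1/4)^m) * (norm w * (1/4) ^ k)"
      by (simp add: power_add algebra_simps)
    also have "\<dots> \<le> (2 - 2 * (1/4)^Suc m) * (norm w * (1/4) ^ k)"
      by (intro mult_right_mono) auto
    finally show ?case .
  qed simp
  have tail2: "norm (?f (k + m) - ?f k) \<le> 2 * norm w * (1/4) ^ k" for k m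
  proof -
    have "(2 - 2 * (1/4)^m) * (norm w * (1/4) ^ k) \<le> 2 * (norm w * (1/4) ^ k)"
      by (intro mult_right_mono) auto
    with tail[of k m] show ?thesis by simp
  qed
  have "Cauchy ?f"
  proof (rule metric_CauchyI)
    fix e :: real assume e: "e > 0"
    have "(\<lambda>k. 4 * norm w * (1 / 4) ^ k) \<longlonglongrightarrow> 4 * norm w * 0"
      by (intro tendsto_intros LIMSEQ_power_zero) simp
    then have "\<forall>\<^sub>F k in sequentially. 4 * norm w * (1 / 4) ^ k < e"
      using e by (intro order_tendstoD) auto
    then obtain k where k: "4 * norm w * (1 / 4) ^ k < e"
      by (meson eventually_sequentially le_refl)
    have "dist (?f m) (?f n) < e" if "m \<ge> k" "n \<ge> k" for m n
    proof -
      have "dist (?f m) (?f n) \<le> dist (?f m) (?f k) + dist (?f n) (?f k)"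
        by (rule dist_triangle2)
      also have "\<dots> \<le> 2 * norm w * (1/4) ^ k + 2 * norm w * (1/4) ^ k"
        using tail2[of k "m - k"] tail2[of k "n - k"] that by (intro add_mono) (simp_all add: dist_norm)
      finally show ?thesis using k by simp
    qed
    then show "\<exists>M. \<forall>m\<ge>M. \<forall>n\<ge>M. dist (?f m) (?f n) < e" by blast
  qed
  then obtain L where L: "?f \<longlonglongrightarrow> L"
    using Cauchy_convergent convergent_def by blast
  have "norm (?f k - L) \<le> 2 * norm w * (1/4) ^ k" for k
  proof (rule Lim_norm_ubound[of sequentially "\<lambda>m. ?f k - ?f (m + k)"])
    show "(\<lambda>m. ?f k - ?f (m + k)) \<longlonglongrightarrow> ?f k - L"
      by (intro tendsto_intros LIMSEQ_ignore_initial_segment L)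
    show "\<forall>\<^sub>F m in sequentially. norm (?f k - ?f (m + k)) \<le> 2 * norm w * (1/4) ^ k"
      using tail2[of k] by (simp add: norm_minus_commute add.commute)
  qed simp
  then show ?thesis using that L by blast
qed

text \<open>The derivatives of the iterates converge to \<open>A x h (L x)\<close> uniformly
  relative to \<open>norm h\<close>: to the constant 7 the defect contributes 5 and the distance of
  the iterate from its limit contributes 2. Term-by-term differentiation then yields the equation
  for the limit.\<close>

theorem solution_exists:
  obtains F where "F 0 = w" "\<And>x. x \<in> ball 0 r \<Longrightarrow> (F has_derivative (\<lambda>v. A x v (F x))) (at x)"
proof -
  have "\<forall>x\<in>ball 0 r. \<exists>l. (\<forall>k. norm (fst (picard w k) x - l) \<le> 2 * norm w * (1/4) ^ k) \<and>
      (\<lambda>k. fst (picard w k) x) \<longlonglongrightarrow> l"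
    using picard_limit by blast
  then obtain L where L: "\<And>x k. x \<in> ball 0 r \<Longrightarrow> norm (fst (picard w k) x - L x) \<le> 2 * norm w * (1/4) ^ k"
    and lim: "\<And>x. x \<in> ball 0 r \<Longrightarrow> (\<lambda>k. fst (picard w k) x) \<longlonglongrightarrow> L x"
    by metis
  have at0: "fst (picard w k) 0 = w" for k
    by (cases k) (auto simp: step_def blinfun.bilinear_simps)
  have 0: "0 \<in> ball 0 r" using r by simp
  have "\<exists>g. \<forall>x\<in>ball 0 r. (\<lambda>k. fst (picard w k) x) \<longlonglongrightarrow> g x \<and>
      (g has_derivative (\<lambda>v. A x v (L x))) (at x within ball 0 r)"
  proof (rule has_derivative_sequence[where f = "\<lambda>k. fst (picard w k)", OF convex_ball _ _ 0 lim[OF 0]])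
    show "(fst (picard w k) has_derivative snd (picard w k) x) (at x within ball 0 r)" if "x \<in> ball 0 r" for k x
      using picard_derivative that has_derivative_at_withinI by blast
    fix e :: real assume e: "e > 0"
    have "(\<lambda>k. 7 * C * norm w * (3 / 4) ^ k) \<longlonglongrightarrow> 7 * C * norm w * 0"
      by (intro tendsto_intros LIMSEQ_power_zero) simp
    then have "\<forall>\<^sub>F k in sequentially. 7 * C * norm w * (3 / 4) ^ k < e"
      using e by (intro order_tendstoD) auto
    then show "\<forall>\<^sub>F k in sequentially. \<forall>x\<in>ball 0 r. \<forall>h. norm (snd (picard w k) x h - A x h (L x)) \<le> e * norm h"
    proof (eventually_elim, intro ballI allI)
      fix k and x h :: 'x assume k: "7 * C * norm w * (3 / 4) ^ k < e" and x: "x \<in> ball 0 r"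
      have le: "(1/4) ^ k \<le> (3/4::real) ^ k" by (intro power_mono) auto
      have "norm (A x h (fst (picard w k) x - L x)) \<le> C * norm h * norm (fst (picard w k) x - L x)"
        by (rule norm_A_apply[OF x])
      also have "\<dots> \<le> C * norm h * (2 * norm w * (3/4) ^ k)"
        using C le by (intro mult_left_mono order_trans[OF L[OF x]]) auto
      finally have 1: "norm (A x h (fst (picard w k) x - L x)) \<le> 2 * (C * norm w * (3/4)^k * norm h)" by (simp add: mult_ac)
      have "norm (snd (picard w k) x h - A x h (L x)) =
        norm ((snd (picard w k) x h - A x h (fst (picard w k) x)) + A x h (fst (picard w k) x - L x))"
        by (simp add: blinfun.bilinear_simps)
      also have "\<dots> \<le> 5 * C * norm w * (3 / 4) ^ k * norm h + 2 * (C * norm w * (3/4)^k * norm h)"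
        using picard_defect[OF x] 1 by (intro norm_triangle_mono)
      also have "\<dots> = (7 * C * norm w * (3 / 4) ^ k) * norm h" by simp
      also have "\<dots> \<le> e * norm h" using k by (intro mult_right_mono) auto
      finally show "norm (snd (picard w k) x h - A x h (L x)) \<le> e * norm h" .
    qed
  qed
  then obtain g where g: "\<And>x. x \<in> ball 0 r \<Longrightarrow> (\<lambda>k. fst (picard w k) x) \<longlonglongrightarrow> g x"
    "\<And>x. x \<in> ball 0 r \<Longrightarrow> (g has_derivative (\<lambda>v. A x v (L x))) (at x within ball 0 r)"
    by blast
  \<comment> \<open>Term-by-term differentiation yields a limit function of its own, to be
    identified with the \<open>L\<close> in the derivative.\<close>
  have gL: "g x = L x" if "x \<in> ball 0 r" for x
    using LIMSEQ_unique[OF g(1) lim] that by blast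
  show ?thesis
  proof (rule that[of g])
    show "g 0 = w" using g(1)[OF 0] unfolding at0 by (simp add: LIMSEQ_const_iff)
    show "(g has_derivative (\<lambda>v. A x v (g x))) (at x)" if "x \<in> ball 0 r" for x
      using g(2)[OF that] gL[OF that] at_within_open[OF that open_ball] by simp
  qed
qed

end

section \<open>Linear systems given by coefficient functions\<close>

lemma linear_axis_sum:
  fixes L :: "real^'n \<Rightarrow> 'a::real_vector"
  assumes "linear L"
  shows "L v = (\<Sum>k\<in>UNIV. (v $ k) *\<^sub>R L (axis k 1))"
proof -
  have "v = (\<Sum>k\<in>UNIV. (v $ k) *\<^sub>R axis k 1)"
    using basis_expansion[of v] by (simp add: scalar_mult_eq_scaleR)
  then have "L v = L (\<Sum>k\<in>UNIV. (v $ k) *\<^sub>R axis k 1)" by simp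
  also have "\<dots> = (\<Sum>k\<in>UNIV. (v $ k) *\<^sub>R L (axis k 1))"
    using assms by (simp add: linear_sum linear_cmul)
  finally show ?thesis .
qed

abbreviation partial :: "'n \<Rightarrow> (real^'n \<Rightarrow> 'a::real_normed_vector) \<Rightarrow> real^'n \<Rightarrow> 'a" where
  "partial i f x \<equiv> frechet_derivative f (at x) (axis i 1)"

lemma smooth_on_partial: "smooth_on S f \<Longrightarrow> smooth_on S (partial i f)"
  by (rule smooth_on_frechet_derivative)

lemma smooth_on_partials:
  assumes "smooth_on S f" "x \<in> S"
  shows "(f has_derivative (\<lambda>v. \<Sum>k\<in>UNIV. (v $ k) *\<^sub>R partial k f x)) (at x)"
  using smooth_on_has_derivative[OF assms] linear_axis_sum[OF has_derivative_linear[OF smooth_on_has_derivative[OF assms]]]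
  by (metis (no_types, lifting) ext)

lemma partial_eqI: "(f has_derivative D) (at x) \<Longrightarrow> partial i f x = D (axis i 1)"
  by (simp add: frechet_derivative_at[symmetric])

lemma axis_nth: "axis s (1::real) $ r = (if r = s then 1 else 0)"
  by (simp add: axis_def)

text \<open>Matrix units as bounded linear maps. The operator of a system is a combination of such
  constants with scalar coefficient functions, so its derivative and continuity reduce to
  theirs.\<close>

definition elem1 :: "'s::finite \<Rightarrow> 's \<Rightarrow> (real^'s) \<Rightarrow>\<^sub>L (real^'s)" where
  "elem1 s t = Blinfun (\<lambda>w. (w $ t) *\<^sub>R axis s 1)"

definition elem2 :: "'n::finite \<Rightarrow> 's::finite \<Rightarrow> 's \<Rightarrow> (real^'n) \<Rightarrow>\<^sub>L (real^'s) \<Rightarrow>\<^sub>L (real^'s)" where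
  "elem2 i s t = Blinfun (\<lambda>v. (v $ i) *\<^sub>R elem1 s t)"

definition elem3 :: "'n::finite \<Rightarrow> 'n \<Rightarrow> 's::finite \<Rightarrow> 's \<Rightarrow> (real^'n) \<Rightarrow>\<^sub>L (real^'n) \<Rightarrow>\<^sub>L (real^'s) \<Rightarrow>\<^sub>L (real^'s)" where
  "elem3 k i s t = Blinfun (\<lambda>v. (v $ k) *\<^sub>R elem2 i s t)"

lemma elem1_apply [simp]: "elem1 s t w = (w $ t) *\<^sub>R axis s 1"
  unfolding elem1_def
  by (simp add: bounded_linear_Blinfun_apply[OF bounded_linear_compose[OF bounded_linear_scaleR_left bounded_linear_vec_nth]])

lemma elem2_apply [simp]: "elem2 i s t v = (v $ i) *\<^sub>R elem1 s t"
  unfolding elem2_def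
  by (simp add: bounded_linear_Blinfun_apply[OF bounded_linear_compose[OF bounded_linear_scaleR_left bounded_linear_vec_nth]])

lemma elem3_apply [simp]: "elem3 k i s t v = (v $ k) *\<^sub>R elem2 i s t"
  unfolding elem3_def
  by (simp add: bounded_linear_Blinfun_apply[OF bounded_linear_compose[OF bounded_linear_scaleR_left bounded_linear_vec_nth]])

text \<open>The system is \<partial>_i F_s = \<Sum>_t \<open>a i s t\<close> F_t. The condition
  \<open>compat\<close> equates the coefficients of F_t in \<partial>_i \<partial>_j F_s and
  \<partial>_j \<partial>_i F_s after first derivatives have been replaced by means of the
  system.\<close>

context
  fixes a :: "'n::finite \<Rightarrow> 's::finite \<Rightarrow> 's \<Rightarrow> real^'n \<Rightarrow> real" and S :: "(real^'n) set"
  assumes S: "open S"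
    and smooth: "\<And>i s t. smooth_on S (a i s t)"
    and compat: "\<And>x i j s t. x \<in> S \<Longrightarrow>
      partial i (a j s t) x + (\<Sum>u\<in>UNIV. a j s u x * a i u t x) =
      partial j (a i s t) x + (\<Sum>u\<in>UNIV. a i s u x * a j u t x)"
begin

definition sysA :: "real^'n \<Rightarrow> (real^'n) \<Rightarrow>\<^sub>L (real^'s) \<Rightarrow>\<^sub>L (real^'s)" where
  "sysA x = (\<Sum>i\<in>UNIV. \<Sum>t\<in>UNIV. \<Sum>s\<in>UNIV. a i s t x *\<^sub>R elem2 i s t)"

definition sysA' :: "real^'n \<Rightarrow> (real^'n) \<Rightarrow>\<^sub>L (real^'n) \<Rightarrow>\<^sub>L (real^'s) \<Rightarrow>\<^sub>L (real^'s)" where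
  "sysA' x = (\<Sum>k\<in>UNIV. \<Sum>i\<in>UNIV. \<Sum>t\<in>UNIV. \<Sum>s\<in>UNIV. partial k (a i s t) x *\<^sub>R elem3 k i s t)"

lemma sysA_apply: "sysA x v w $ s = (\<Sum>i\<in>UNIV. \<Sum>t\<in>UNIV. v $ i * a i s t x * w $ t)"
  by (simp add: sysA_def blinfun.bilinear_simps blinfun.sum_left axis_nth if_distrib
      sum.delta' mult_ac cong: if_cong)

lemma sysA'_apply: "sysA' x u v w $ s =
    (\<Sum>k\<in>UNIV. \<Sum>i\<in>UNIV. \<Sum>t\<in>UNIV. u $ k * v $ i * w $ t * partial k (a i s t) x)"
  by (simp add: sysA'_def blinfun.bilinear_simps blinfun.sum_left axis_nth if_distrib
      sum.delta' mult_ac cong: if_cong)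

lemma sysA_has_derivative: "x \<in> S \<Longrightarrow> (sysA has_derivative sysA' x) (at x)"
  unfolding sysA_def[abs_def]
proof (rule has_derivative_eq_rhs)
  assume x: "x \<in> S"
  show "((\<lambda>x. \<Sum>i\<in>UNIV. \<Sum>t\<in>UNIV. \<Sum>s\<in>UNIV. a i s t x *\<^sub>R elem2 i s t) has_derivative
     (\<lambda>v. \<Sum>i\<in>UNIV. \<Sum>t\<in>UNIV. \<Sum>s\<in>UNIV. (\<Sum>k\<in>UNIV. (v $ k) *\<^sub>R partial k (a i s t) x) *\<^sub>R elem2 i s t)) (at x)"
    by (intro has_derivative_sum has_derivative_scaleR_left smooth_on_partials[OF smooth x])
  show "(\<lambda>v. \<Sum>i\<in>UNIV. \<Sum>t\<in>UNIV. \<Sum>s\<in>UNIV. (\<Sum>k\<in>UNIV. (v $ k) *\<^sub>R partial k (a i s t) x) *\<^sub>R elem2 i s t) = sysA' x"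
  proof
    fix v
    have "sysA' x v = (\<Sum>k\<in>UNIV. \<Sum>i\<in>UNIV. \<Sum>t\<in>UNIV. \<Sum>s\<in>UNIV. ((v $ k) * partial k (a i s t) x) *\<^sub>R elem2 i s t)"
      by (simp add: sysA'_def blinfun.bilinear_simps blinfun.sum_left mult.commute)
    also have "\<dots> = (\<Sum>i\<in>UNIV. \<Sum>k\<in>UNIV. \<Sum>t\<in>UNIV. \<Sum>s\<in>UNIV. ((v $ k) * partial k (a i s t) x) *\<^sub>R elem2 i s t)"
      by (rule sum.swap)
    also have "\<dots> = (\<Sum>i\<in>UNIV. \<Sum>t\<in>UNIV. \<Sum>k\<in>UNIV. \<Sum>s\<in>UNIV. ((v $ k) * partial k (a i s t) x) *\<^sub>R elem2 i s t)"
      by (intro sum.cong refl sum.swap)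
    also have "\<dots> = (\<Sum>i\<in>UNIV. \<Sum>t\<in>UNIV. \<Sum>s\<in>UNIV. \<Sum>k\<in>UNIV. ((v $ k) * partial k (a i s t) x) *\<^sub>R elem2 i s t)"
      by (intro sum.cong refl sum.swap)
    finally show "(\<Sum>i\<in>UNIV. \<Sum>t\<in>UNIV. \<Sum>s\<in>UNIV. (\<Sum>k\<in>UNIV. (v $ k) *\<^sub>R partial k (a i s t) x) *\<^sub>R elem2 i s t) = sysA' x v"
      by (simp add: scaleR_sum_left)
  qed
qed

lemma sysA'_continuous: "continuous_on S sysA'"
  unfolding sysA'_def[abs_def]
  by (intro continuous_intros smooth_on_continuous[OF smooth_on_partial[OF smooth]])

lemma sysA_integrable:
  assumes x: "x \<in> S"
  shows "sysA' x u v + (sysA x v o\<^sub>L sysA x u) = sysA' x v u + (sysA x u o\<^sub>L sysA x v)"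
proof -
  let ?P = "\<lambda>s k i q. partial k (a i s q) x + (\<Sum>t\<in>UNIV. a i s t x * a k t q x)"
  have eq: "(sysA' x u v + (sysA x v o\<^sub>L sysA x u)) w $ s =
      (\<Sum>k\<in>UNIV. \<Sum>i\<in>UNIV. \<Sum>q\<in>UNIV. u $ k * v $ i * w $ q * ?P s k i q)" for u v w s
  proof -
    have "sysA x v (sysA x u w) $ s = (\<Sum>i\<in>UNIV. \<Sum>t\<in>UNIV. \<Sum>k\<in>UNIV. \<Sum>q\<in>UNIV. u $ k * v $ i * w $ q * (a i s t x * a k t q x))"
      unfolding sysA_apply by (simp add: sum_distrib_left mult_ac)
    also have "\<dots> = (\<Sum>i\<in>UNIV. \<Sum>k\<in>UNIV. \<Sum>t\<in>UNIV. \<Sum>q\<in>UNIV. u $ k * v $ i * w $ q * (a i s t x * a k t q x))"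
      by (intro sum.cong refl sum.swap)
    also have "\<dots> = (\<Sum>k\<in>UNIV. \<Sum>i\<in>UNIV. \<Sum>t\<in>UNIV. \<Sum>q\<in>UNIV. u $ k * v $ i * w $ q * (a i s t x * a k t q x))"
      by (rule sum.swap)
    also have "\<dots> = (\<Sum>k\<in>UNIV. \<Sum>i\<in>UNIV. \<Sum>q\<in>UNIV. \<Sum>t\<in>UNIV. u $ k * v $ i * w $ q * (a i s t x * a k t q x))"
      by (intro sum.cong refl sum.swap)
    finally show ?thesis
      by (simp add: blinfun.add_left sysA'_apply sum.distrib distrib_left sum_distrib_left)
  qed
  have "(sysA' x u v + (sysA x v o\<^sub>L sysA x u)) w $ s = (sysA' x v u + (sysA x u o\<^sub>L sysA x v)) w $ s" for w s
  proof -
    have "(\<Sum>k\<in>UNIV. \<Sum>i\<in>UNIV. \<Sum>q\<in>UNIV. u $ k * v $ i * w $ q * ?P s k i q)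
      = (\<Sum>i\<in>UNIV. \<Sum>k\<in>UNIV. \<Sum>q\<in>UNIV. v $ i * u $ k * w $ q * ?P s i k q)"
    proof -
      have "u $ k * v $ i * w $ q * ?P s k i q = v $ i * u $ k * w $ q * ?P s i k q" for k i q
        using compat[OF x, where i = k and j = i and s = s and t = q] by (simp only: mult.commute)
      then show ?thesis by (subst sum.swap) (simp only:)
    qed
    then show ?thesis unfolding eq .
  qed
  then show ?thesis by (intro blinfun_eqI) (simp add: vec_eq_iff)
qed

text \<open>By linearity the radius can be fixed before the initial value \<open>w\<close>, so the
  solutions for all \<open>w\<close> share one ball.\<close>

lemma linear_system_solution:
  assumes x0: "x0 \<in> S"
  obtains r where "r > 0" "ball x0 r \<subseteq> S"
    "\<And>w. \<exists>F. F x0 = w \<and> smooth_on (ball x0 r) F \<and> (\<forall>x\<in>ball x0 r.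
       (F has_derivative (\<lambda>v. \<chi> s. \<Sum>i\<in>UNIV. \<Sum>t\<in>UNIV. v $ i * a i s t x * F x $ t)) (at x))"
proof -
  obtain r0 where r0: "r0 > 0" "cball x0 r0 \<subseteq> S"
    using S x0 open_contains_cball by blast
  have contA: "continuous_on S sysA"
    using sysA_has_derivative has_derivative_continuous continuous_at_imp_continuous_on by blast
  have "bounded (sysA ` cball x0 r0)"
    by (intro compact_imp_bounded compact_continuous_image continuous_on_subset[OF contA r0(2)] compact_cball)
  then obtain C where C: "C > 0" "\<And>x. x \<in> cball x0 r0 \<Longrightarrow> norm (sysA x) \<le> C"
    unfolding bounded_pos by blast
  \<comment> \<open>Continuity on a compact ball bounds the coefficients by \<open>C\<close>; the
    radius is then cut down to meet \<open>C * r \<le> 1 / 4\<close>.\<close>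
  define r where "r = min r0 (1 / (4 * C))"
  have rp: "r > 0" "r \<le> r0" "C * r \<le> 1 / 4"
    using r0 C by (auto simp: r_def min_def field_simps)
  have in_S: "x0 + x \<in> S" and in_c: "x0 + x \<in> cball x0 r0" if "x \<in> ball 0 r" for x
  proof -
    show "x0 + x \<in> cball x0 r0" using that rp by (simp add: dist_norm)
    then show "x0 + x \<in> S" using r0 by blast
  qed
  have shift: "((\<lambda>x. x0 + x) has_derivative (\<lambda>v. v)) (at x)" for x :: "real^'n"
    by (auto intro!: derivative_eq_intros)
  interpret integrable_linear_system "\<lambda>x. sysA (x0 + x)" "\<lambda>x. sysA' (x0 + x)" r C
  proof
    show "((\<lambda>x. sysA (x0 + x)) has_derivative sysA' (x0 + x)) (at x)" if "x \<in> ball 0 r" for x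
      using has_derivative_compose[OF shift sysA_has_derivative[OF in_S[OF that]]] .
    show "continuous_on (ball 0 r) (\<lambda>x. sysA' (x0 + x))"
    proof (rule continuous_on_compose2[OF sysA'_continuous])
      show "(\<lambda>x. x0 + x) ` ball 0 r \<subseteq> S" using in_S by blast
    qed (intro continuous_intros)
  qed (use rp C in_c in_S sysA_integrable in auto)
  have sub: "ball x0 r \<subseteq> S" using r0 rp by force
  show ?thesis
  proof (rule that[OF rp(1) sub])
    fix w
    obtain G where G0: "G 0 = w" and G: "\<And>x. x \<in> ball 0 r \<Longrightarrow> (G has_derivative (\<lambda>v. sysA (x0 + x) v (G x))) (at x)"
      using solution_exists by metis
    define F where "F x = G (x - x0)" for x
    let ?D = "\<lambda>x v. \<chi> s. \<Sum>i\<in>UNIV. \<Sum>t\<in>UNIV. v $ i * a i s t x * F x $ t"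
    have D: "(F has_derivative ?D x) (at x)" if "x \<in> ball x0 r" for x
    proof -
      have "((\<lambda>x. x - x0) has_derivative (\<lambda>v. v)) (at x)" by (auto intro!: derivative_eq_intros)
      from has_derivative_compose[OF this G] that
      have "(F has_derivative (\<lambda>v. sysA x v (F x))) (at x)"
        unfolding F_def by (simp add: dist_norm norm_minus_commute)
      then show ?thesis by (rule has_derivative_eq_rhs) (simp add: fun_eq_iff vec_eq_iff sysA_apply)
    qed
    \<comment> \<open>The equation expresses the derivative of \<open>F\<close> by \<open>F\<close>
      and smooth coefficients, so each order of differentiability yields the next.\<close>
    have "Ck_on k (ball x0 r) F" for k
    proof (induction k)
      case 0
      show ?case
        unfolding Ck_on.simps
        by (intro continuous_at_imp_continuous_on ballI has_derivative_continuous[OF D])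
    next
      case (Suc k)
      show ?case
      proof (rule Ck_on_SucI[OF open_ball D])
        show "Ck_on k (ball x0 r) (\<lambda>x. ?D x v)" for v
          unfolding Ck_on_vec_iff[OF open_ball] vec_lambda_beta
          using Suc[unfolded Ck_on_vec_iff[OF open_ball]]
          by (intro allI Ck_on_sum Ck_on_mult Ck_on_const Ck_on_subset[OF smooth_onD[OF smooth] sub] open_ball) auto
      qed
    qed
    then show "\<exists>F. F x0 = w \<and> smooth_on (ball x0 r) F \<and> (\<forall>x\<in>ball x0 r.
       (F has_derivative (\<lambda>v. \<chi> s. \<Sum>i\<in>UNIV. \<Sum>t\<in>UNIV. v $ i * a i s t x * F x $ t)) (at x))"
      using D G0 by (intro exI[of _ F] conjI) (simp_all add: smooth_on_def F_def)
  qed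
qed

end

section \<open>Inverse functions and positive definite forms\<close>

text \<open>The derivative of the inverse at \<open>y\<close> is the inverse matrix of the
  derivative of \<open>f\<close> at \<open>g y\<close>. As matrix inversion is smooth where the
  determinant does not vanish, this formula lifts \<open>g\<close> from class C^k to class
  C^(k+1).\<close>

lemma smooth_inverse_function:
  fixes f :: "real^'m \<Rightarrow> real^'m"
  assumes S: "open S" and f: "smooth_on S f" and x0: "x0 \<in> S"
    and inj: "inj (frechet_derivative f (at x0))"
  obtains U V g where "open U" "U \<subseteq> S" "x0 \<in> U" "open V" "homeomorphism U V f g" "smooth_on V g"
proof -
  let ?D = "\<lambda>x. frechet_derivative f (at x)"
  define f' where "f' x = Blinfun (?D x)" for x
  have Df: "(f has_derivative ?D x) (at x)" if "x \<in> S" for x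
    by (rule smooth_on_has_derivative[OF f that])
  have f'_apply: "blinfun_apply (f' x) = ?D x" if "x \<in> S" for x
    unfolding f'_def by (rule bounded_linear_Blinfun_apply[OF has_derivative_bounded_linear[OF Df[OF that]]])
  have contf': "continuous_on S f'"
  proof (rule continuous_on_blinfun_componentwise)
    fix i :: "real^'m"
    have "continuous_on S (\<lambda>x. ?D x i)"
      by (rule smooth_on_continuous[OF smooth_on_frechet_derivative[OF f]])
    then show "continuous_on S (\<lambda>x. f' x i)"
      by (simp add: f'_apply cong: continuous_on_cong)
  qed
  have bl: "bounded_linear (?D x0)" by (rule has_derivative_bounded_linear[OF Df[OF x0]])
  obtain h where h: "linear h" "h \<circ> ?D x0 = id"
    using linear_injective_left_inverse[OF bounded_linear.linear[OF bl] inj] by blast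
  have hbl: "bounded_linear h" using h(1) linear_conv_bounded_linear by blast
  have inv: "Blinfun h o\<^sub>L f' x0 = id_blinfun"
    by (rule blinfun_eqI) (use h(2) in \<open>simp add: bounded_linear_Blinfun_apply[OF hbl] f'_apply[OF x0] fun_eq_iff\<close>)
  have derf: "(f has_derivative blinfun_apply (f' x)) (at x)" if "x \<in> S" for x
    using Df[OF that] f'_apply[OF that] by simp
  obtain U V g g' where U: "open U" "U \<subseteq> S" "x0 \<in> U" and V: "open V" and "f x0 \<in> V" and hom: "homeomorphism U V f g"
    and g: "\<And>y. y \<in> V \<Longrightarrow> (g has_derivative (g' y)) (at y)"
    and g': "\<And>y. y \<in> V \<Longrightarrow> g' y = Hilbert_Choice.inv (blinfun_apply (f' (g y)))"
    and bij: "\<And>y. y \<in> V \<Longrightarrow> bij (blinfun_apply (f' (g y)))"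
    by (rule inverse_function_theorem[OF S derf contf' x0 inv]) (assumption, rule that)
  have gU: "g y \<in> U" if "y \<in> V" for y
    using hom that by (auto simp: homeomorphism_def)
  let ?M = "\<lambda>x. matrix (?D x)"
  have lin: "linear (?D x)" if "x \<in> S" for x
    using has_derivative_linear[OF Df[OF that]] .
  have det: "det (?M x) \<noteq> 0" if "x \<in> U" for x
  proof -
    have "x \<in> g ` V" using hom that unfolding homeomorphism_def by simp
    then obtain y where y: "y \<in> V" "x = g y" by blast
    have xS: "x \<in> S" using that U(2) by blast
    have "inj (?D x)" using bij[OF y(1)] f'_apply[OF xS] y(2) by (simp add: bij_def)
    then show ?thesis
      using det_nz_iff_inj[OF lin[OF xS]] by simp
  qed
  have Minv: "smooth_on U (\<lambda>x. matrix_inv (?M x) $ i $ j)" for i j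
  proof (rule smooth_on_matrix_inv[OF U(1)])
    show "smooth_on U (\<lambda>x. ?M x $ i $ j)" for i j
      unfolding matrix_def by (simp add: smooth_on_bounded_linear[OF bounded_linear_vec_nth U(1)]
          smooth_on_subset[OF smooth_on_partial[OF f] U(2)])
  qed (rule det)
  have g'_eq: "g' y v = matrix_inv (?M (g y)) *v v" if "y \<in> V" for y v
  proof -
    have x: "g y \<in> S" "g y \<in> U" using gU[OF that] U by auto
    have "?M (g y) ** matrix_inv (?M (g y)) = mat 1"
      by (rule matrix_inv_nonsingular(1)[OF det[OF x(2)]])
    then have "?M (g y) *v (matrix_inv (?M (g y)) *v v) = v"
      by (simp add: matrix_vector_mul_assoc)
    then have "?D (g y) (matrix_inv (?M (g y)) *v v) = v"
      using matrix_works[of "?D (g y)"] lin[OF x(1)] by (simp add: linear_matrix_vector_mul_eq)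
    then show ?thesis
      using g'[OF that] bij[OF that] f'_apply[OF x(1)] by (metis bij_inv_eq_iff)
  qed
  have "Ck_on k V g" for k
  proof (induction k)
    case 0
    show ?case
      unfolding Ck_on.simps
      by (intro continuous_at_imp_continuous_on ballI has_derivative_continuous[OF g])
  next
    case (Suc k)
    show ?case
    proof (rule Ck_on_SucI[OF V])
      show "(g has_derivative (\<lambda>v. matrix_inv (?M (g y)) *v v)) (at y)" if "y \<in> V" for y
        by (rule has_derivative_eq_rhs[OF g[OF that]]) (simp add: g'_eq[OF that] fun_eq_iff)
      show "Ck_on k V (\<lambda>y. matrix_inv (?M (g y)) *v v)" for v
        unfolding Ck_on_vec_iff[OF V] matrix_vector_mult_def vec_lambda_beta
        by (intro allI Ck_on_sum Ck_on_mult Ck_on_const V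
            Ck_on_compose[where f = g, OF V U(1) _ Suc smooth_onD[OF Minv]]) (use gU in auto)
    qed
  qed
  then have "smooth_on V g" by (simp add: smooth_on_def)
  then show ?thesis using that U V hom by blast
qed

text \<open>On the compact unit sphere the form at \<open>y0\<close> has a positive minimum, and
  near \<open>y0\<close> all values on the sphere change by at most half of it. Homogeneity of
  degree 2 carries positivity to all nonzero vectors.\<close>

lemma positive_definite_near:
  fixes G :: "'a::metric_space \<Rightarrow> 'm::finite \<Rightarrow> 'm \<Rightarrow> real"
  assumes V: "open V" and y0: "y0 \<in> V" and cont: "\<And>i j. continuous_on V (\<lambda>y. G y i j)"
    and pos: "\<And>u. u \<noteq> (\<lambda>_. 0) \<Longrightarrow> (\<Sum>i\<in>UNIV. \<Sum>j\<in>UNIV. G y0 i j * u i * u j) > 0"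
  obtains W where "open W" "y0 \<in> W" "W \<subseteq> V"
    "\<And>y u. y \<in> W \<Longrightarrow> u \<noteq> (\<lambda>_. 0) \<Longrightarrow> (\<Sum>i\<in>UNIV. \<Sum>j\<in>UNIV. G y i j * u i * u j) > 0"
proof -
  let ?Q = "\<lambda>y (u::real^'m). \<Sum>i\<in>UNIV. \<Sum>j\<in>UNIV. G y i j * u $ i * u $ j"
  let ?S = "sphere (0::real^'m) 1"
  have ne: "?S \<noteq> {}" by (metis norm_axis_1 mem_sphere_0 empty_iff)
  have nz: "(\<lambda>i. u $ i) \<noteq> (\<lambda>_. 0)" if "u \<in> ?S" for u :: "real^'m"
  proof
    assume "(\<lambda>i. u $ i) = (\<lambda>_. 0)"
    then have "u = 0" by (simp add: vec_eq_iff fun_eq_iff)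
    with that show False by simp
  qed
  have contQ: "continuous_on (V \<times> ?S) (\<lambda>(y, u). ?Q y u)"
    unfolding split_beta
    by (intro continuous_intros continuous_on_compose2[OF cont continuous_on_fst[OF continuous_on_id]]) auto
  have "continuous_on ?S (?Q y0)"
    by (intro continuous_intros)
  then obtain c where c: "c \<in> ?S" "\<And>u. u \<in> ?S \<Longrightarrow> ?Q y0 c \<le> ?Q y0 u"
    using continuous_attains_inf[OF compact_sphere ne] by blast
  have c0: "?Q y0 c > 0" using pos[OF nz[OF c(1)]] .
  then have half: "?Q y0 c / 2 > 0" by simp
  obtain X where X: "y0 \<in> X" "open X" and "\<forall>y\<in>X \<inter> V. \<forall>u\<in>?S.
      dist ((\<lambda>(y, u). ?Q y u) (y, u)) ((\<lambda>(y, u). ?Q y u) (y0, u)) \<le> ?Q y0 c / 2"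
    using continuous_on_prod_compactE[OF contQ compact_sphere y0 half] .
  then have Xd: "\<forall>y\<in>X \<inter> V. \<forall>u\<in>?S. \<bar>?Q y u - ?Q y0 u\<bar> \<le> ?Q y0 c / 2"
    by (simp only: prod.case dist_real_def)
  show ?thesis
  proof (rule that[of "X \<inter> V"])
    fix y and u :: "'m \<Rightarrow> real" assume y: "y \<in> X \<inter> V" and u: "u \<noteq> (\<lambda>_. 0)"
    define v :: "real^'m" where "v = (\<chi> i. u i)"
    have v: "norm v > 0" using u by (auto simp: v_def vec_eq_iff fun_eq_iff)
    let ?w = "(1 / norm v) *\<^sub>R v"
    have w: "?w \<in> ?S" using v by simp
    have "\<bar>?Q y ?w - ?Q y0 ?w\<bar> \<le> ?Q y0 c / 2" using Xd y w by blast
    then have "?Q y ?w > 0" using c(2)[OF w] c0 by linarith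
    moreover have "?Q y ?w = (1 / norm v)\<^sup>2 * ?Q y v"
      by (simp add: sum_distrib_left power2_eq_square mult_ac)
    ultimately have "?Q y v > 0" using v by (simp add: zero_less_mult_iff)
    then show "(\<Sum>i\<in>UNIV. \<Sum>j\<in>UNIV. G y i j * u i * u j) > 0" by (simp add: v_def)
  qed (use X V y0 in auto)
qed

section \<open>The Gauss--Codazzi--Ricci equations in a chart\<close>

lemma sum_UNIV_sum:
  "(\<Sum>u\<in>UNIV. f u) = (\<Sum>a\<in>UNIV. f (Inl a)) + (\<Sum>b\<in>UNIV. f (Inr b))" for f :: "'a::finite + 'b::finite \<Rightarrow> 'c::comm_monoid_add"
  using sum.Plus[of "UNIV :: 'a set" "UNIV :: 'b set" f] by simp

lemma sum_delta_mult: "(\<Sum>k\<in>UNIV. (if k = i then 1 else 0) * f k) = f i" for i :: "'i::finite" and f :: "'i \<Rightarrow> real"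
  by (simp add: if_distrib[of "\<lambda>c. c * _"] cong: if_cong)

lemma sum_mult_delta: "(\<Sum>k\<in>UNIV. f k * (if k = i then 1 else 0)) = f i" for i :: "'i::finite" and f :: "'i \<Rightarrow> real"
  by (simp add: if_distrib[of "\<lambda>c. _ * c"] cong: if_cong)

lemma sum_delta_scaleR: "(\<Sum>k\<in>UNIV. (if k = i then 1 else 0) *\<^sub>R f k) = f i"
  for i :: "'i::finite" and f :: "'i \<Rightarrow> 'v::real_vector"
  by (simp add: if_distrib[of "\<lambda>c. c *\<^sub>R _"] cong: if_cong)

lemma has_derivative_vec_iff:
  fixes f :: "'a::real_normed_vector \<Rightarrow> real^'n"
  shows "(f has_derivative D) (at x) \<longleftrightarrow> (\<forall>i. ((\<lambda>x. f x $ i) has_derivative (\<lambda>v. D v $ i)) (at x))"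
  unfolding has_derivative_componentwise_within[of f]
  by (auto simp: Basis_vec_def inner_axis)

lemma partial_const [simp]: "partial i (\<lambda>x. c) x = 0"
  by (rule partial_eqI[OF has_derivative_const])

lemma partial_minus:
  assumes "smooth_on S f" "x \<in> S"
  shows "partial i (\<lambda>x. - f x) x = - partial i f x"
  using partial_eqI[OF has_derivative_minus[OF smooth_on_has_derivative[OF assms]]] .

text \<open>The Gauss--Codazzi--Ricci equations in a chart: \<open>Gm k i j\<close> are the Christoffel symbols and
  \<open>K a i k\<close> stands for \<open>h\<^sup>*\<^sub>a\<^sub>i\<^sup>k\<close>. All equations are written in the form
  \<open>E i j = E j i\<close>, after cancelling the terms that are symmetric since the torsion vanishes.\<close>

locale gcr_chart =
  fixes S :: "(real^'n::finite) set"
    and g :: "'n \<Rightarrow> 'n \<Rightarrow> real^'n \<Rightarrow> real"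
    and Gm :: "'n \<Rightarrow> 'n \<Rightarrow> 'n \<Rightarrow> real^'n \<Rightarrow> real"
    and h K :: "'r::finite \<Rightarrow> 'n \<Rightarrow> 'n \<Rightarrow> real^'n \<Rightarrow> real"
    and \<tau> :: "'r \<Rightarrow> 'r \<Rightarrow> 'n \<Rightarrow> real^'n \<Rightarrow> real"
  assumes open_S: "open S"
    and smooth_g: "smooth_on S (g i j)"
    and smooth_Gm: "smooth_on S (Gm k i j)"
    and smooth_h: "smooth_on S (h a i j)"
    and smooth_K: "smooth_on S (K a i k)"
    and smooth_\<tau>: "smooth_on S (\<tau> a b i)"
    and g_sym: "x \<in> S \<Longrightarrow> g i j x = g j i x"
    and g_pos: "x \<in> S \<Longrightarrow> u \<noteq> (\<lambda>_. 0) \<Longrightarrow> (\<Sum>i\<in>UNIV. \<Sum>j\<in>UNIV. g i j x * u i * u j) > 0"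
    and Gm_sym: "x \<in> S \<Longrightarrow> Gm k i j x = Gm k j i x"
    and h_sym: "x \<in> S \<Longrightarrow> h a i j x = h a j i x"
    and K_sym: "x \<in> S \<Longrightarrow> (\<Sum>k\<in>UNIV. K a j k x * g i k x) = (\<Sum>k\<in>UNIV. K a i k x * g j k x)"
    and g_codazzi: "x \<in> S \<Longrightarrow> partial i (g j k) x + (\<Sum>m\<in>UNIV. Gm m j k x * g i m x) =
      partial j (g i k) x + (\<Sum>m\<in>UNIV. Gm m i k x * g j m x)"
    and gauss: "x \<in> S \<Longrightarrow>
      partial i (Gm l j k) x + (\<Sum>m\<in>UNIV. Gm m j k x * Gm l i m x) - (\<Sum>a\<in>UNIV. h a j k x * K a i l x) =
      partial j (Gm l i k) x + (\<Sum>m\<in>UNIV. Gm m i k x * Gm l j m x) - (\<Sum>a\<in>UNIV. h a i k x * K a j l x)"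
    and codazzi: "x \<in> S \<Longrightarrow>
      partial i (h b j k) x + (\<Sum>m\<in>UNIV. Gm m j k x * h b i m x) + (\<Sum>a\<in>UNIV. h a j k x * \<tau> b a i x) =
      partial j (h b i k) x + (\<Sum>m\<in>UNIV. Gm m i k x * h b j m x) + (\<Sum>a\<in>UNIV. h a i k x * \<tau> b a j x)"
    and codazzi_dual: "x \<in> S \<Longrightarrow>
      partial i (K a j k) x + (\<Sum>l\<in>UNIV. K a j l x * Gm k i l x) + (\<Sum>b\<in>UNIV. \<tau> b a j x * K b i k x) =
      partial j (K a i k) x + (\<Sum>l\<in>UNIV. K a i l x * Gm k j l x) + (\<Sum>b\<in>UNIV. \<tau> b a i x * K b j k x)"
    and ricci: "x \<in> S \<Longrightarrow>
      partial i (\<tau> b a j) x + (\<Sum>c\<in>UNIV. \<tau> c a j x * \<tau> b c i x) - (\<Sum>l\<in>UNIV. K a j l x * h b i l x) =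
      partial j (\<tau> b a i) x + (\<Sum>c\<in>UNIV. \<tau> c a i x * \<tau> b c j x) - (\<Sum>l\<in>UNIV. K a i l x * h b j l x)"
begin

text \<open>The coefficients of the system
  \<open>\<partial>\<^sub>i \<psi> = p\<^sub>i\<close>, \<open>\<partial>\<^sub>i c = 0\<close>,
  \<open>\<partial>\<^sub>i p\<^sub>j = \<Gamma>\<^sup>k\<^sub>i\<^sub>j p\<^sub>k + h\<^sup>a\<^sub>i\<^sub>j q\<^sub>a + c g\<^sub>i\<^sub>j\<close>,
  \<open>\<partial>\<^sub>i q\<^sub>a = - h\<^sup>*\<^sub>a\<^sub>i\<^sup>k p\<^sub>k + \<tau>\<^sup>b\<^sub>a\<^sub>i q\<^sub>b\<close>.
  The unknowns \<open>p\<close> and \<open>q\<close> have the indices \<open>Inl (Inl j)\<close> and \<open>Inl (Inr a)\<close>, while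
  \<open>\<psi>\<close> and \<open>c\<close> have the indices \<open>Inr True\<close> and \<open>Inr False\<close>.\<close>

fun coef :: "'n \<Rightarrow> ('n + 'r) + bool \<Rightarrow> ('n + 'r) + bool \<Rightarrow> real^'n \<Rightarrow> real" where
  "coef i (Inl (Inl j)) (Inl (Inl k)) = Gm k i j"
| "coef i (Inl (Inl j)) (Inl (Inr b)) = h b i j"
| "coef i (Inl (Inl j)) (Inr c) = (if c then (\<lambda>_. 0) else g i j)"
| "coef i (Inl (Inr a)) (Inl (Inl k)) = (\<lambda>x. - K a i k x)"
| "coef i (Inl (Inr a)) (Inl (Inr b)) = \<tau> b a i"
| "coef i (Inl (Inr a)) (Inr c) = (\<lambda>_. 0)"
| "coef i (Inr c) (Inl (Inl k)) = (\<lambda>_. if c \<and> k = i then 1 else 0)"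
| "coef i (Inr c) (Inl (Inr b)) = (\<lambda>_. 0)"
| "coef i (Inr c) (Inr d) = (\<lambda>_. 0)"

lemma smooth_coef: "smooth_on S (coef i s t)"
  by (induction i s t rule: coef.induct)
    (auto intro!: smooth_g smooth_Gm smooth_h smooth_K smooth_\<tau> smooth_on_minus smooth_on_const open_S)

text \<open>Each block of rows and columns is one hypothesis: (p, p) is Gauss, (p, q) Codazzi, (p,
  c) the total symmetry of \<nabla>g, (q, p) dual Codazzi, (q, q) Ricci, (q, c) the symmetry of h^*.
  The row of \<psi> asks for the symmetry of \<Gamma>, h and g in i and j; the row of c is
  zero.\<close>

lemma coef_compat:
  assumes x: "x \<in> S"
  shows "partial i (coef j s t) x + (\<Sum>u\<in>UNIV. coef j s u x * coef i u t x) =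
      partial j (coef i s t) x + (\<Sum>u\<in>UNIV. coef i s u x * coef j u t x)"
proof (cases "(i, s, t)" rule: coef.cases)
  case (1 _ j' k)
  then show ?thesis using gauss[OF x, where i=i and l=k and j=j and k=j'] by (simp add: sum_UNIV_sum UNIV_bool sum_negf)
next
  case (2 _ j' b)
  then show ?thesis using codazzi[OF x, where i=i and b=b and j=j and k=j'] by (simp add: sum_UNIV_sum UNIV_bool)
next
  case (3 _ j' c)
  then show ?thesis using g_codazzi[OF x, where i=i and j=j and k=j'] by (cases c) (simp_all add: sum_UNIV_sum UNIV_bool)
next
  case (4 _ a k)
  then show ?thesis using codazzi_dual[OF x, where i=i and a=a and j=j and k=k]
    by (simp add: sum_UNIV_sum UNIV_bool sum_negf partial_minus[OF smooth_K x])
next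
  case (5 _ a b)
  then show ?thesis using ricci[OF x, where i=i and b=b and a=a and j=j] by (simp add: sum_UNIV_sum UNIV_bool sum_negf)
next
  case (6 _ a c)
  then show ?thesis using K_sym[OF x, where a=a and i=i and j=j] by (cases c) (simp_all add: sum_UNIV_sum UNIV_bool sum_negf)
next
  case (7 _ c k)
  then show ?thesis using Gm_sym[OF x] by (cases c) (simp_all add: sum_UNIV_sum UNIV_bool sum_delta_mult)
next
  case (8 _ c b)
  then show ?thesis using h_sym[OF x] by (cases c) (simp_all add: sum_UNIV_sum UNIV_bool sum_delta_mult)
next
  case (9 _ c d)
  then show ?thesis using g_sym[OF x] by (cases c; cases d) (simp_all add: sum_UNIV_sum UNIV_bool sum_delta_mult)
qed

end

lemma (in gcr_chart) solution_family:
  assumes x0: "x0 \<in> S"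
  obtains r sol where "r > 0" "ball x0 r \<subseteq> S" "\<And>w. sol w x0 = w" "\<And>w. smooth_on (ball x0 r) (sol w)"
    "\<And>w x s. x \<in> ball x0 r \<Longrightarrow> ((\<lambda>x. sol w x $ s) has_derivative
       (\<lambda>v. \<Sum>i\<in>UNIV. v $ i * (\<Sum>t\<in>UNIV. coef i s t x * sol w x $ t))) (at x)"
proof -
  obtain r where r: "r > 0" "ball x0 r \<subseteq> S"
    and ex: "\<And>w. \<exists>F. F x0 = w \<and> smooth_on (ball x0 r) F \<and> (\<forall>x\<in>ball x0 r.
       (F has_derivative (\<lambda>v. \<chi> s. \<Sum>i\<in>UNIV. \<Sum>t\<in>UNIV. v $ i * coef i s t x * F x $ t)) (at x))"
    using linear_system_solution[OF open_S smooth_coef coef_compat x0] by blast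
  from ex have "\<forall>w. \<exists>F. F x0 = w \<and> smooth_on (ball x0 r) F \<and> (\<forall>x\<in>ball x0 r.
       (F has_derivative (\<lambda>v. \<chi> s. \<Sum>i\<in>UNIV. \<Sum>t\<in>UNIV. v $ i * coef i s t x * F x $ t)) (at x))"
    by blast
  from choice[OF this] obtain sol where sol: "\<And>w. sol w x0 = w" "\<And>w. smooth_on (ball x0 r) (sol w)"
    and D: "\<And>w x. x \<in> ball x0 r \<Longrightarrow> (sol w has_derivative
      (\<lambda>v. \<chi> s. \<Sum>i\<in>UNIV. \<Sum>t\<in>UNIV. v $ i * coef i s t x * sol w x $ t)) (at x)"
    by blast
  have "((\<lambda>x. sol w x $ s) has_derivative
       (\<lambda>v. \<Sum>i\<in>UNIV. v $ i * (\<Sum>t\<in>UNIV. coef i s t x * sol w x $ t))) (at x)"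
    if "x \<in> ball x0 r" for w x s
    using D[OF that, of w, unfolded has_derivative_vec_iff] by (simp add: sum_distrib_left mult.assoc)
  with r sol show ?thesis using that by blast
qed

section \<open>Immersion, transversal frame and potential\<close>

locale gcr_solution = gcr_chart S g Gm h K \<tau>
  for S :: "(real^'n::finite) set" and g Gm
    and h K :: "'r::finite \<Rightarrow> 'n \<Rightarrow> 'n \<Rightarrow> real^'n \<Rightarrow> real" and \<tau> +
  fixes x0 :: "real^'n" and r :: real
    and sol :: "real^(('n + 'r) + bool) \<Rightarrow> real^'n \<Rightarrow> real^(('n + 'r) + bool)"
  assumes r: "r > 0" and ball_S: "ball x0 r \<subseteq> S"
    and sol_x0: "\<And>w. sol w x0 = w"
    and smooth_sol: "\<And>w. smooth_on (ball x0 r) (sol w)"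
    and sol_deriv: "\<And>w x s. x \<in> ball x0 r \<Longrightarrow> ((\<lambda>x. sol w x $ s) has_derivative
       (\<lambda>v. \<Sum>i\<in>UNIV. v $ i * (\<Sum>t\<in>UNIV. coef i s t x * sol w x $ t))) (at x)"
begin

text \<open>\<open>frame (Inl j)\<close> is \<open>\<partial>\<^sub>j imm\<close> for the immersion \<open>imm\<close>, and
  \<open>frame (Inr a)\<close> is the \<open>a\<close>-th transversal field.\<close>

definition frame :: "'n + 'r \<Rightarrow> real^'n \<Rightarrow> real^('n + 'r)" where
  "frame B x = (\<chi> A. sol (axis (Inl A) 1) x $ Inl B)"

text \<open>Starting from the unit vector with index \<open>Inl A\<close> means c = 0, so p and q
  solve the homogeneous system; the unknown \<psi> of this solution is a primitive of p and serves
  as the coordinate \<open>A\<close> of the immersion.\<close>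

definition imm :: "real^'n \<Rightarrow> real^('n + 'r)" where
  "imm x = (\<chi> A. sol (axis (Inl A) 1) x $ Inr True)"

text \<open>All initial values are zero except c = 1, which turns on the source g.\<close>

definition pot :: "real^'n \<Rightarrow> real" where
  "pot x = sol (axis (Inr False) 1) x $ Inr True"

text \<open>The unknowns p and q of the same solution. They become the derivatives of the potential
  along the frame: the tangential ones by \<open>pot_deriv\<close>, the transversal ones because
  \<open>tube_pot\<close> receives them as its first order terms.\<close>

definition grad :: "'n + 'r \<Rightarrow> real^'n \<Rightarrow> real" where
  "grad B x = sol (axis (Inr False) 1) x $ Inl B"

lemma smooth_sol_nth: "smooth_on (ball x0 r) (\<lambda>x. sol w x $ s)"
  by (rule smooth_on_bounded_linear[OF bounded_linear_vec_nth open_ball smooth_sol])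

lemma smooth_frame: "smooth_on (ball x0 r) (frame B)"
  unfolding frame_def[abs_def] smooth_on_vec_iff[OF open_ball] by (simp add: smooth_sol_nth)

lemma smooth_imm: "smooth_on (ball x0 r) imm"
  unfolding imm_def[abs_def] smooth_on_vec_iff[OF open_ball] by (simp add: smooth_sol_nth)

lemma smooth_pot: "smooth_on (ball x0 r) pot"
  unfolding pot_def[abs_def] by (rule smooth_sol_nth)

lemma smooth_grad: "smooth_on (ball x0 r) (grad B)"
  unfolding grad_def[abs_def] by (rule smooth_sol_nth)

lemma coef_True: "coef i s (Inr True) x = 0"
  by (cases "(i, s, Inr True :: ('n + 'r) + bool)" rule: coef.cases) auto

lemma coef_False: "coef i (Inr False) t x = 0"
  by (cases "(i, Inr False :: ('n + 'r) + bool, t)" rule: coef.cases) auto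

text \<open>The row of c vanishes, so c keeps its initial value on the convex ball; in this way the
  enlarged homogeneous system encodes an inhomogeneous one.\<close>

lemma sol_False: "x \<in> ball x0 r \<Longrightarrow> sol w x $ Inr False = w $ Inr False"
proof -
  assume x: "x \<in> ball x0 r"
  have "((\<lambda>x. sol w x $ Inr False) has_derivative (\<lambda>v. 0)) (at y within ball x0 r)" if "y \<in> ball x0 r" for y
    using has_derivative_at_withinI[OF sol_deriv[OF that, of w "Inr False"]] by (simp add: coef_False)
  from has_derivative_zero_constant[OF convex_ball this]
  obtain c where c: "\<And>y. y \<in> ball x0 r \<Longrightarrow> sol w y $ Inr False = c"
    by blast
  have "x0 \<in> ball x0 r" using r by simp
  from c[OF this] c[OF x] show ?thesis by (simp add: sol_x0)
qed

lemma sol_deriv': "x \<in> ball x0 r \<Longrightarrow> ((\<lambda>x. sol w x $ s) has_derivative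
    (\<lambda>v. \<Sum>i\<in>UNIV. v $ i * ((\<Sum>C\<in>UNIV. coef i s (Inl C) x * sol w x $ Inl C) + coef i s (Inr False) x * w $ Inr False))) (at x)"
  using sol_deriv[of x w s] by (simp add: sum_UNIV_sum[of "\<lambda>t. coef _ _ t _ * _ t"] UNIV_bool coef_True sol_False)

lemma frame_deriv: "x \<in> ball x0 r \<Longrightarrow> (frame B has_derivative
    (\<lambda>v. \<Sum>i\<in>UNIV. v $ i *\<^sub>R (\<Sum>C\<in>UNIV. coef i (Inl B) (Inl C) x *\<^sub>R frame C x))) (at x)"
  unfolding has_derivative_vec_iff frame_def
proof
  fix A assume "x \<in> ball x0 r"
  from sol_deriv'[OF this, of "axis (Inl A) 1" "Inl B"]
  show "((\<lambda>x. (\<chi> A. sol (axis (Inl A) 1) x $ Inl B) $ A) has_derivative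
    (\<lambda>v. (\<Sum>i\<in>UNIV. v $ i *\<^sub>R (\<Sum>C\<in>UNIV. coef i (Inl B) (Inl C) x *\<^sub>R (\<chi> A. sol (axis (Inl A) 1) x $ Inl C))) $ A)) (at x)"
    by (simp add: axis_nth)
qed

lemma imm_deriv: "x \<in> ball x0 r \<Longrightarrow> (imm has_derivative (\<lambda>v. \<Sum>i\<in>UNIV. v $ i *\<^sub>R frame (Inl i) x)) (at x)"
  unfolding has_derivative_vec_iff frame_def imm_def
  using sol_deriv'[of x _ "Inr True"] by (simp add: axis_nth sum_UNIV_sum[where 'a='n] sum_delta_mult)

lemma grad_deriv: "x \<in> ball x0 r \<Longrightarrow> (grad B has_derivative
    (\<lambda>v. \<Sum>i\<in>UNIV. v $ i * ((\<Sum>C\<in>UNIV. coef i (Inl B) (Inl C) x * grad C x) + coef i (Inl B) (Inr False) x))) (at x)"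
  unfolding grad_def[abs_def] using sol_deriv'[of x "axis (Inr False) 1" "Inl B"] by (simp add: axis_nth)

lemma pot_deriv: "x \<in> ball x0 r \<Longrightarrow> (pot has_derivative (\<lambda>v. \<Sum>i\<in>UNIV. v $ i * grad (Inl i) x)) (at x)"
  unfolding grad_def[abs_def] pot_def[abs_def]
  using sol_deriv'[of x "axis (Inr False) 1" "Inr True"] by (simp add: axis_nth sum_UNIV_sum[where 'a='n] sum_delta_mult)

lemma frame_x0: "frame B x0 = axis B 1"
  by (simp add: frame_def sol_x0 axis_nth vec_eq_iff)

lemma partial_imm: "x \<in> ball x0 r \<Longrightarrow> partial i imm x = frame (Inl i) x"
  using partial_eqI[OF imm_deriv] by (simp add: axis_nth sum_delta_scaleR)

lemma partial_frame: "x \<in> ball x0 r \<Longrightarrow> partial i (frame B) x = (\<Sum>C\<in>UNIV. coef i (Inl B) (Inl C) x *\<^sub>R frame C x)"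
  using partial_eqI[OF frame_deriv] by (simp add: axis_nth sum_delta_scaleR)

text \<open>The Gauss formula of the immersion: the row of p_j, read for all ambient coordinates at
  once, splits the second derivative into a tangential part with coefficients \<open>Gm\<close> and
  a transversal part with coefficients \<open>h\<close>.\<close>

lemma partial_partial_imm:
  assumes "x \<in> ball x0 r"
  shows "partial i (partial j imm) x = (\<Sum>k\<in>UNIV. Gm k i j x *\<^sub>R partial k imm x) + (\<Sum>a\<in>UNIV. h a i j x *\<^sub>R frame (Inr a) x)"
proof -
  have "partial i (partial j imm) x = partial i (frame (Inl j)) x"
    using frechet_derivative_cong_open[OF open_ball assms, of "partial j imm" "frame (Inl j)"] partial_imm by simp
  then show ?thesis by (simp only: partial_frame[OF assms] sum_UNIV_sum partial_imm[OF assms] coef.simps)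
qed

section \<open>Tubular coordinates around the immersed chart\<close>

definition base :: "real^('n + 'r) \<Rightarrow> real^'n" where
  "base z = (\<chi> i. z $ Inl i)"

definition zero_section :: "real^'n \<Rightarrow> real^('n + 'r)" where
  "zero_section x = (\<chi> B. case B of Inl i \<Rightarrow> x $ i | Inr a \<Rightarrow> 0)"

lemma base_linear: "bounded_linear base"
  unfolding linear_conv_bounded_linear[symmetric]
  by (rule linearI) (auto simp: base_def vec_eq_iff)

lemma zero_section_linear: "bounded_linear zero_section"
  unfolding linear_conv_bounded_linear[symmetric]
  by (rule linearI) (auto simp: zero_section_def vec_eq_iff split: sum.split)

lemma base_zero_section [simp]: "base (zero_section x) = x"
  by (simp add: base_def zero_section_def vec_eq_iff)

lemma zero_section_Inr [simp]: "zero_section x $ Inr a = 0"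
  by (simp add: zero_section_def)

definition dom :: "(real^('n + 'r)) set" where
  "dom = base -` ball x0 r"

lemma open_dom: "open dom"
  unfolding dom_def
  by (rule open_vimage[OF open_ball]) (rule linear_continuous_on[OF base_linear])

definition tube :: "real^('n + 'r) \<Rightarrow> real^('n + 'r)" where
  "tube z = imm (base z) + (\<Sum>a\<in>UNIV. z $ Inr a *\<^sub>R frame (Inr a) (base z))"

text \<open>The quadratic term makes the Hessian of \<open>tube_pot\<close>, transported by \<open>tube\<close>, positive in the
  transversal directions.\<close>

definition tube_pot :: "real^('n + 'r) \<Rightarrow> real" where
  "tube_pot z = pot (base z) + (\<Sum>a\<in>UNIV. z $ Inr a * grad (Inr a) (base z)) + (\<Sum>a\<in>UNIV. z $ Inr a * z $ Inr a) / 2"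

lemma smooth_on_base: "smooth_on (ball x0 r) F \<Longrightarrow> smooth_on dom (\<lambda>z. F (base z))"
  by (rule smooth_on_compose[OF open_dom open_ball _ smooth_on_linear[OF base_linear open_dom]])
    (auto simp: dom_def)

lemma smooth_coord: "smooth_on dom (\<lambda>z. z $ A)"
  by (rule smooth_on_linear[OF bounded_linear_vec_nth open_dom])

lemma smooth_tube: "smooth_on dom tube"
  unfolding tube_def[abs_def]
  by (intro smooth_on_add smooth_on_sum smooth_on_scaleR smooth_on_base smooth_imm smooth_frame smooth_coord open_dom)

lemma smooth_tube_pot: "smooth_on dom tube_pot"
  unfolding tube_pot_def[abs_def] divide_inverse
  by (intro smooth_on_add smooth_on_sum smooth_on_mult smooth_on_base smooth_pot smooth_grad smooth_coord
      smooth_on_const open_dom)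

lemma base_deriv: "(base has_derivative base) (at z)"
  by (rule bounded_linear_imp_has_derivative[OF base_linear])

lemma coord_deriv: "((\<lambda>z. z $ A) has_derivative (\<lambda>v. v $ A)) (at z)"
  by (rule bounded_linear_imp_has_derivative[OF bounded_linear_vec_nth])

lemma tube_deriv:
  assumes "z \<in> dom"
  shows "(tube has_derivative (\<lambda>v. (\<Sum>i\<in>UNIV. base v $ i *\<^sub>R frame (Inl i) (base z)) +
    (\<Sum>a\<in>UNIV. z $ Inr a *\<^sub>R (\<Sum>i\<in>UNIV. base v $ i *\<^sub>R (\<Sum>C\<in>UNIV. coef i (Inl (Inr a)) (Inl C) (base z) *\<^sub>R frame C (base z)))
      + v $ Inr a *\<^sub>R frame (Inr a) (base z)))) (at z)"
proof -
  have x: "base z \<in> ball x0 r" using assms by (simp add: dom_def)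
  show ?thesis
    unfolding tube_def[abs_def]
    by (intro has_derivative_add has_derivative_sum bounded_bilinear.FDERIV[OF bounded_bilinear_scaleR] coord_deriv
        has_derivative_compose[OF base_deriv imm_deriv[OF x]] has_derivative_compose[OF base_deriv frame_deriv[OF x]])
qed

lemma tube_pot_deriv:
  assumes "z \<in> dom"
  shows "(tube_pot has_derivative (\<lambda>v. (\<Sum>i\<in>UNIV. base v $ i * grad (Inl i) (base z)) +
    (\<Sum>a\<in>UNIV. z $ Inr a * (\<Sum>i\<in>UNIV. base v $ i * ((\<Sum>C\<in>UNIV. coef i (Inl (Inr a)) (Inl C) (base z) * grad C (base z))
        + coef i (Inl (Inr a)) (Inr False) (base z)))
      + v $ Inr a * grad (Inr a) (base z)) + (\<Sum>a\<in>UNIV. z $ Inr a * v $ Inr a + v $ Inr a * z $ Inr a) / 2)) (at z)"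
proof -
  have x: "base z \<in> ball x0 r" using assms by (simp add: dom_def)
  show ?thesis
    unfolding tube_pot_def[abs_def]
    by (intro has_derivative_add has_derivative_sum has_derivative_mult has_derivative_divide' coord_deriv
        has_derivative_compose[OF base_deriv pot_deriv[OF x]] has_derivative_compose[OF base_deriv grad_deriv[OF x]]
        bounded_linear.has_derivative[OF bounded_linear_divide])
qed

lemma base_axis_Inr [simp]: "base (axis (Inr a) 1) = 0"
  by (simp add: base_def axis_nth vec_eq_iff)

lemma base_axis_Inl [simp]: "base (axis (Inl i) 1) = axis i 1"
  by (simp add: base_def axis_nth vec_eq_iff)

lemma partial_tube_Inr: "z \<in> dom \<Longrightarrow> partial (Inr a) tube z = frame (Inr a) (base z)"
  using partial_eqI[OF tube_deriv, of z "Inr a"] by (simp add: axis_nth sum_delta_scaleR)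

lemma partial_tube_pot_Inr: "z \<in> dom \<Longrightarrow> partial (Inr a) tube_pot z = grad (Inr a) (base z) + z $ Inr a"
  using partial_eqI[OF tube_pot_deriv, of z "Inr a"] by (simp add: axis_nth sum_delta_mult sum_mult_delta add_divide_distrib flip: sum_distrib_left)

lemma zero_section_dom: "x \<in> ball x0 r \<Longrightarrow> zero_section x \<in> dom"
  by (simp add: dom_def)

lemma partial_tube_zero: "x \<in> ball x0 r \<Longrightarrow> partial B tube (zero_section x) = frame B x"
  using partial_eqI[OF tube_deriv[OF zero_section_dom], of x B]
  by (cases B) (simp_all add: axis_nth sum_delta_scaleR)

lemma partial_tube_pot_zero: "x \<in> ball x0 r \<Longrightarrow> partial B tube_pot (zero_section x) = grad B x"
  using partial_eqI[OF tube_pot_deriv[OF zero_section_dom], of x B]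
  by (cases B) (simp_all add: axis_nth sum_delta_mult)

lemma tube_zero: "tube (zero_section x) = imm x"
  by (simp add: tube_def)

text \<open>The initial values were unit vectors, so the frame at \<open>x0\<close> is the standard
  basis and the derivative is the identity.\<close>

lemma inj_tube_deriv: "inj (frechet_derivative tube (at (zero_section x0)))"
proof -
  have x0: "x0 \<in> ball x0 r" using r by simp
  have D: "(tube has_derivative frechet_derivative tube (at (zero_section x0))) (at (zero_section x0))"
    by (rule smooth_on_has_derivative[OF smooth_tube zero_section_dom[OF x0]])
  have "frechet_derivative tube (at (zero_section x0)) v = v" for v
    unfolding linear_axis_sum[OF has_derivative_linear[OF D], of v]
    using basis_expansion[of v] by (simp only: partial_tube_zero[OF x0] frame_x0 scalar_mult_eq_scaleR)
  then show ?thesis by (metis injI)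
qed

end

section \<open>The Hessian metric near the immersed chart\<close>

text \<open>The product rule for d\<phi>(F) along \<open>u\<close>, in which the derivative of
  d\<phi> produces the Hessian of \<phi>. It is applied with \<open>u = imm\<close> to find the
  Hessian in tangential directions and with \<open>u = tube\<close> for the transversal
  ones.\<close>

lemma differentiate_pairing:
  fixes F u :: "real^'k \<Rightarrow> real^'m" and \<phi> :: "real^'m \<Rightarrow> real"
  assumes \<phi>: "smooth_on V \<phi>" and V: "u z \<in> V" and N: "open N" "z \<in> N"
    and eq: "\<And>z. z \<in> N \<Longrightarrow> (\<Sum>C\<in>UNIV. F z $ C * partial C \<phi> (u z)) = R z"
    and F: "(F has_derivative F') (at z)" and u: "(u has_derivative u') (at z)"
    and R: "(R has_derivative R') (at z)"
  shows "(\<Sum>C\<in>UNIV. F z $ C * (\<Sum>A\<in>UNIV. u' v $ A * partial A (partial C \<phi>) (u z)) +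
      F' v $ C * partial C \<phi> (u z)) = R' v"
proof -
  have "((\<lambda>z. \<Sum>C\<in>UNIV. F z $ C * partial C \<phi> (u z)) has_derivative
    (\<lambda>v. \<Sum>C\<in>UNIV. F z $ C * (\<Sum>A\<in>UNIV. u' v $ A *\<^sub>R partial A (partial C \<phi>) (u z)) +
      F' v $ C * partial C \<phi> (u z))) (at z)"
    by (intro has_derivative_sum has_derivative_mult
        has_derivative_compose[OF u smooth_on_partials[OF smooth_on_partial[OF \<phi>] V]]
        bounded_linear.has_derivative[OF bounded_linear_vec_nth F])
  then have "(R has_derivative
    (\<lambda>v. \<Sum>C\<in>UNIV. F z $ C * (\<Sum>A\<in>UNIV. u' v $ A *\<^sub>R partial A (partial C \<phi>) (u z)) +
      F' v $ C * partial C \<phi> (u z))) (at z)"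
    by (rule iffD1[OF has_derivative_cong_open[OF N], rotated]) (rule eq)
  from has_derivative_unique[OF this R] show ?thesis
    by (simp add: fun_eq_iff)
qed

lemma partial_commute:
  fixes f :: "real^'m \<Rightarrow> real"
  assumes "smooth_on V f" "open V" "y \<in> V"
  shows "partial i (partial j f) y = partial j (partial i f) y"
  by (rule frechet_derivative_commute[OF smooth_onD[OF assms(1)] assms(2,3)])

context gcr_solution
begin

lemma local_embedding_aux:
  obtains B W k G where "open B" "x0 \<in> B" "B \<subseteq> ball x0 r" "open W" "imm ` B \<subseteq> W"
    "homeomorphism B (imm ` B) imm k"
    "\<And>A C. smooth_on W (G A C)" "\<And>y A C. y \<in> W \<Longrightarrow> G A C y = G C A y"
    "\<And>y A C E. y \<in> W \<Longrightarrow> partial E (G A C) y = partial A (G E C) y"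
    "\<And>y u. y \<in> W \<Longrightarrow> u \<noteq> (\<lambda>_. 0) \<Longrightarrow> (\<Sum>A\<in>UNIV. \<Sum>C\<in>UNIV. G A C y * u A * u C) > 0"
    "\<And>x i C. x \<in> B \<Longrightarrow> (\<Sum>A\<in>UNIV. \<Sum>E\<in>UNIV. G A E (imm x) * frame (Inl i) x $ A * frame C x $ E) =
       coef i (Inl C) (Inr False) x"
proof -
  have x0: "x0 \<in> ball x0 r" using r by simp
  obtain U V \<Psi> where U: "open U" "U \<subseteq> dom" "zero_section x0 \<in> U" and V: "open V"
    and hom: "homeomorphism U V tube \<Psi>" and \<Psi>: "smooth_on V \<Psi>"
    using smooth_inverse_function[OF open_dom smooth_tube zero_section_dom[OF x0] inj_tube_deriv]
    by blast
  have tubeV: "tube z \<in> V" and \<Psi>_tube: "\<Psi> (tube z) = z" if "z \<in> U" for z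
    using hom that unfolding homeomorphism_def by auto
  have \<Psi>U: "\<Psi> ` V \<subseteq> dom" using hom U(2) unfolding homeomorphism_def by blast
  define \<phi> where "\<phi> y = tube_pot (\<Psi> y)" for y
  have \<phi>: "smooth_on V \<phi>"
    unfolding \<phi>_def[abs_def] by (rule smooth_on_compose[OF V open_dom \<Psi>U \<Psi> smooth_tube_pot])
  \<comment> \<open>As a matrix of second derivatives, \<open>G\<close> gets its symmetry and that
    of its derivative from commuting partial derivatives.\<close>
  define G where "G A C = partial A (partial C \<phi>)" for A C
  have smooth_G: "smooth_on V (G A C)" for A C
    unfolding G_def by (intro smooth_on_partial \<phi>)
  have G_sym: "G A C y = G C A y" if "y \<in> V" for A C y
    unfolding G_def by (rule partial_commute[OF \<phi> V that])
  have G_tot: "partial E (G A C) y = partial A (G E C) y" if "y \<in> V" for A C E y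
    unfolding G_def by (rule partial_commute[OF smooth_on_partial[OF \<phi>] V that])
  have pairing: "(\<Sum>C\<in>UNIV. partial B tube z $ C * partial C \<phi> (tube z)) = partial B tube_pot z" if z: "z \<in> U" for z B
  proof -
    have zd: "z \<in> dom" using z U by blast
    have "((\<lambda>z. \<phi> (tube z)) has_derivative (\<lambda>v. \<Sum>C\<in>UNIV. (frechet_derivative tube (at z) v $ C) *\<^sub>R partial C \<phi> (tube z))) (at z)"
      by (rule has_derivative_compose[OF smooth_on_has_derivative[OF smooth_tube zd] smooth_on_partials[OF \<phi> tubeV[OF z]]])
    then have "(tube_pot has_derivative (\<lambda>v. \<Sum>C\<in>UNIV. (frechet_derivative tube (at z) v $ C) *\<^sub>R partial C \<phi> (tube z))) (at z)"
      by (rule iffD1[OF has_derivative_cong_open[OF U(1) z], rotated]) (simp add: \<phi>_def \<Psi>_tube)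
    from partial_eqI[OF this, of B] show ?thesis by simp
  qed
  define B1 where "B1 = ball x0 r \<inter> zero_section -` U"
  have B1: "open B1" "x0 \<in> B1" "B1 \<subseteq> ball x0 r"
    unfolding B1_def using U x0 open_vimage[OF U(1) linear_continuous_on[OF zero_section_linear]] by auto
  have immV: "imm x \<in> V" if "x \<in> B1" for x
    using tubeV[of "zero_section x"] that by (simp add: B1_def tube_zero)
  have pairing0: "(\<Sum>C\<in>UNIV. frame B x $ C * partial C \<phi> (imm x)) = grad B x" if "x \<in> B1" for x B
    using pairing[of "zero_section x" B] that
    by (auto simp: B1_def partial_tube_zero partial_tube_pot_zero tube_zero simp del: mem_ball)
  \<comment> \<open>Differentiate d\<phi>(\<open>frame C\<close>) = \<open>grad C\<close> along the
    i-th coordinate. Frame and gradient obey equations with the same coefficients, so the terms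
    without a Hessian cancel except for the source of the inhomogeneous system: g for tangential
    \<open>C\<close>, zero for transversal \<open>C\<close>.\<close>
  have hess: "(\<Sum>A\<in>UNIV. \<Sum>E\<in>UNIV. G A E (imm x) * frame (Inl i) x $ A * frame C x $ E) =
       coef i (Inl C) (Inr False) x" if x: "x \<in> B1" for x i C
  proof -
    have xb: "x \<in> ball x0 r" using x B1 by blast
    let ?c = "\<lambda>D. coef i (Inl C) (Inl D) x"
    have "(\<Sum>E\<in>UNIV. frame C x $ E * (\<Sum>A\<in>UNIV. partial i imm x $ A * partial A (partial E \<phi>) (imm x)) +
      partial i (frame C) x $ E * partial E \<phi> (imm x)) = partial i (grad C) x"
      by (rule differentiate_pairing[where F = "frame C" and u = imm and R = "grad C", OF \<phi> immV[OF x] B1(1) x pairing0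
            smooth_on_has_derivative[OF smooth_frame xb] smooth_on_has_derivative[OF smooth_imm xb]
            smooth_on_has_derivative[OF smooth_grad xb]])
    also have "partial i (grad C) x = (\<Sum>D\<in>UNIV. ?c D * grad D x) + coef i (Inl C) (Inr False) x"
      using partial_eqI[OF grad_deriv[OF xb, of C], of i] by (simp add: axis_nth sum_delta_mult)
    also have "(\<Sum>E\<in>UNIV. frame C x $ E * (\<Sum>A\<in>UNIV. partial i imm x $ A * partial A (partial E \<phi>) (imm x)) +
      partial i (frame C) x $ E * partial E \<phi> (imm x)) =
      (\<Sum>E\<in>UNIV. \<Sum>A\<in>UNIV. G A E (imm x) * frame (Inl i) x $ A * frame C x $ E) +
      (\<Sum>E\<in>UNIV. \<Sum>D\<in>UNIV. ?c D * (frame D x $ E * partial E \<phi> (imm x)))"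
      unfolding partial_imm[OF xb] partial_frame[OF xb] G_def
      by (simp add: sum.distrib sum_distrib_left sum_distrib_right mult_ac)
    also have "(\<Sum>E\<in>UNIV. \<Sum>D\<in>UNIV. ?c D * (frame D x $ E * partial E \<phi> (imm x))) = (\<Sum>D\<in>UNIV. ?c D * grad D x)"
      by (subst sum.swap) (simp add: pairing0[OF x] flip: sum_distrib_left)
    finally show ?thesis by (subst sum.swap) simp
  qed
  have z0: "zero_section x0 \<in> dom" "base (zero_section x0) = x0" using zero_section_dom[OF x0] by auto
  \<comment> \<open>Differentiate along the fibre direction \<open>a\<close> at the zero section:
    the transversal fields are constant on fibres, and the coordinate left over from the quadratic
    term gives the identity matrix. The point \<open>imm x0\<close> is enough, as positivity spreads
    by continuity.\<close>
  have transversal: "G (Inr a) (Inr b) (imm x0) = (if a = b then 1 else 0)" for a b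
  proof -
    have eq: "(\<Sum>C\<in>UNIV. frame (Inr b) (base z) $ C * partial C \<phi> (tube z)) = grad (Inr b) (base z) + z $ Inr b"
      if "z \<in> U" for z
      using pairing[OF that, of "Inr b"] that U(2) partial_tube_Inr partial_tube_pot_Inr by auto
    have F: "((\<lambda>z. frame (Inr b) (base z)) has_derivative (\<lambda>v. frechet_derivative (frame (Inr b)) (at x0) (base v))) (at (zero_section x0))"
      by (rule has_derivative_compose[OF base_deriv]) (simp only: z0, rule smooth_on_has_derivative[OF smooth_frame x0])
    have R: "((\<lambda>z. grad (Inr b) (base z) + z $ Inr b) has_derivative (\<lambda>v. frechet_derivative (grad (Inr b)) (at x0) (base v) + v $ Inr b)) (at (zero_section x0))"
      by (intro has_derivative_add coord_deriv has_derivative_compose[OF base_deriv]) (simp only: z0, rule smooth_on_has_derivative[OF smooth_grad x0])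
    have lin0: "frechet_derivative (frame (Inr b)) (at x0) 0 = 0" "frechet_derivative (grad (Inr b)) (at x0) 0 = 0"
      using has_derivative_linear[OF smooth_on_has_derivative[OF smooth_frame x0]]
        has_derivative_linear[OF smooth_on_has_derivative[OF smooth_grad x0]] linear_0 by blast+
    have "(\<Sum>C\<in>UNIV. frame (Inr b) (base (zero_section x0)) $ C *
        (\<Sum>A\<in>UNIV. partial (Inr a) tube (zero_section x0) $ A * partial A (partial C \<phi>) (tube (zero_section x0))) +
      frechet_derivative (frame (Inr b)) (at x0) (base (axis (Inr a) 1)) $ C * partial C \<phi> (tube (zero_section x0)))
      = frechet_derivative (grad (Inr b)) (at x0) (base (axis (Inr a) 1)) + (axis (Inr a) 1 :: real^('n + 'r)) $ Inr b"
      using differentiate_pairing[where F = "\<lambda>z. frame (Inr b) (base z)" and u = tube and v = "axis (Inr a) 1",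
          OF \<phi> tubeV[OF U(3)] U(1) U(3) eq F smooth_on_has_derivative[OF smooth_tube z0(1)] R]
      by blast
    then show ?thesis
      by (simp add: partial_tube_zero[OF x0] frame_x0 axis_nth sum_delta_mult lin0 tube_zero G_def)
  qed
  have tangential: "G (Inl i) C (imm x0) = coef i (Inl C) (Inr False) x0" for i C
    using hess[OF B1(2), of i C] by (simp add: frame_x0 axis_nth sum_delta_mult sum_mult_delta)
  have y0: "imm x0 \<in> V" using immV B1 by blast
  \<comment> \<open>At \<open>imm x0\<close> the frame is the standard basis, so \<open>G\<close> is
    block diagonal with blocks g and the identity matrix.\<close>
  have pos: "(\<Sum>A\<in>UNIV. \<Sum>C\<in>UNIV. G A C (imm x0) * u A * u C) > 0" if u: "u \<noteq> (\<lambda>_. 0)" for u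
  proof -
    have G1: "G (Inl i) (Inl j) (imm x0) = g i j x0" for i j by (simp add: tangential)
    have G2: "G (Inl i) (Inr a) (imm x0) = 0" for i a by (simp add: tangential)
    have G3: "G (Inr a) (Inl i) (imm x0) = 0" for i a using G_sym[OF y0] G2 by simp
    have eq: "(\<Sum>A\<in>UNIV. \<Sum>C\<in>UNIV. G A C (imm x0) * u A * u C) =
       (\<Sum>i\<in>UNIV. \<Sum>j\<in>UNIV. g i j x0 * u (Inl i) * u (Inl j)) + (\<Sum>a\<in>UNIV. u (Inr a) * u (Inr a))"
      by (simp add: sum_UNIV_sum[where 'a='n] G1 G2 G3 transversal if_distrib[of "\<lambda>c. c * _"] cong: if_cong)
    have x0S: "x0 \<in> S" using x0 ball_S by blast
    have nn: "(\<Sum>a\<in>UNIV. u (Inr a) * u (Inr a)) \<ge> 0" by (intro sum_nonneg) simp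
    show ?thesis
    proof (cases "(\<lambda>i. u (Inl i)) = (\<lambda>_. 0)")
      case False
      from g_pos[OF x0S this] nn show ?thesis unfolding eq by linarith
    next
      case True
      then have l: "u (Inl i) = 0" for i by (simp add: fun_eq_iff)
      obtain A where "u A \<noteq> 0" using u by auto
      then obtain a where a: "u (Inr a) \<noteq> 0" using l by (cases A) auto
      have "(\<Sum>a\<in>UNIV. u (Inr a) * u (Inr a)) > 0"
        by (rule sum_pos2[of _ a]) (use a in \<open>auto simp: zero_less_mult_iff\<close>)
      then show ?thesis unfolding eq by (simp add: l)
    qed
  qed
  obtain W where W: "open W" "imm x0 \<in> W" "W \<subseteq> V"
    "\<And>y u. y \<in> W \<Longrightarrow> u \<noteq> (\<lambda>_. 0) \<Longrightarrow> (\<Sum>A\<in>UNIV. \<Sum>C\<in>UNIV. G A C y * u A * u C) > 0"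
    by (rule positive_definite_near[where G = "\<lambda>y A C. G A C y", OF V y0 smooth_on_continuous[OF smooth_G] pos])
      (assumption, rule that)
  have cont_imm: "continuous_on B1 imm"
    using continuous_on_subset[OF smooth_on_continuous[OF smooth_imm] B1(3)] .
  define B where "B = B1 \<inter> imm -` W"
  have B: "open B" unfolding B_def
    using continuous_openin_preimage_gen[OF cont_imm W(1)] B1(1) by (simp add: openin_open_eq)
  have B_sub: "B \<subseteq> B1" "imm ` B \<subseteq> W" "x0 \<in> B" unfolding B_def using B1 W by auto
  \<comment> \<open>The inverse of \<open>tube\<close> followed by the projection to the base is a
    continuous inverse of \<open>imm\<close>.\<close>
  have k: "homeomorphism B (imm ` B) imm (\<lambda>y. base (\<Psi> y))"
  proof (rule homeomorphismI)
    show "continuous_on B imm" using continuous_on_subset[OF cont_imm B_sub(1)] .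
    show "continuous_on (imm ` B) (\<lambda>y. base (\<Psi> y))"
      by (rule continuous_on_compose2[OF linear_continuous_on[OF base_linear, of UNIV]])
        (use B_sub W(3) in \<open>auto intro: continuous_on_subset[OF smooth_on_continuous[OF \<Psi>]]\<close>)
    show inv: "base (\<Psi> (imm x)) = x" if "x \<in> B" for x
    proof -
      have "zero_section x \<in> U" using that by (simp add: B_def B1_def)
      from \<Psi>_tube[OF this] show ?thesis by (simp add: tube_zero)
    qed
    show "imm (base (\<Psi> y)) = y" if "y \<in> imm ` B" for y using that inv by auto
    show "(\<lambda>y. base (\<Psi> y)) ` imm ` B \<subseteq> B" using inv by auto
  qed simp
  show ?thesis
  proof (rule that[where G = G, OF B B_sub(3) _ W(1) B_sub(2) k])
    show "B \<subseteq> ball x0 r" using B_sub B1 by blast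
    show "smooth_on W (G A C)" for A C using smooth_on_subset[OF smooth_G W(3)] .
  qed (use W G_sym G_tot hess B_sub in blast)+
qed

end

text \<open>This interface hides the linear system. That \<open>f\<close> is an immersion is not
  listed: it follows from the positivity of the metric that \<open>G\<close> induces.\<close>

theorem (in gcr_chart) local_embedding:
  assumes x0: "x0 \<in> S"
  obtains B W and f :: "real^'n \<Rightarrow> real^('n + 'r)" and \<xi> k G
  where "open B" "x0 \<in> B" "B \<subseteq> S" "open W" "f ` B \<subseteq> W" "smooth_on B f"
    "homeomorphism B (f ` B) f k"
    "\<And>x i j. x \<in> B \<Longrightarrow> partial i (partial j f) x =
       (\<Sum>k\<in>UNIV. Gm k i j x *\<^sub>R partial k f x) + (\<Sum>a\<in>UNIV. h a i j x *\<^sub>R \<xi> a x)"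
    "\<And>A C. smooth_on W (G A C)" "\<And>y A C. y \<in> W \<Longrightarrow> G A C y = G C A y"
    "\<And>y A C E. y \<in> W \<Longrightarrow> partial E (G A C) y = partial A (G E C) y"
    "\<And>y u. y \<in> W \<Longrightarrow> u \<noteq> (\<lambda>_. 0) \<Longrightarrow> (\<Sum>A\<in>UNIV. \<Sum>C\<in>UNIV. G A C y * u A * u C) > 0"
    "\<And>x i j. x \<in> B \<Longrightarrow> (\<Sum>A\<in>UNIV. \<Sum>C\<in>UNIV. G A C (f x) * partial i f x $ A * partial j f x $ C) = g i j x"
    "\<And>x i a. x \<in> B \<Longrightarrow> (\<Sum>A\<in>UNIV. \<Sum>C\<in>UNIV. G A C (f x) * partial i f x $ A * \<xi> a x $ C) = 0"
proof -
  obtain r sol where "r > 0" and rS: "ball x0 r \<subseteq> S" and "\<And>w. sol w x0 = w" "\<And>w. smooth_on (ball x0 r) (sol w)"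
    "\<And>w x s. x \<in> ball x0 r \<Longrightarrow> ((\<lambda>x. sol w x $ s) has_derivative
       (\<lambda>v. \<Sum>i\<in>UNIV. v $ i * (\<Sum>t\<in>UNIV. coef i s t x * sol w x $ t))) (at x)"
    by (rule solution_family[OF x0]) (rule that)
  then interpret gcr_solution S g Gm h K \<tau> x0 r sol by unfold_locales
  obtain B W k G where B: "open B" "x0 \<in> B" "B \<subseteq> ball x0 r" and W: "open W" "imm ` B \<subseteq> W"
    "homeomorphism B (imm ` B) imm k"
    and G: "\<And>A C. smooth_on W (G A C)" "\<And>y A C. y \<in> W \<Longrightarrow> G A C y = G C A y"
    "\<And>y A C E. y \<in> W \<Longrightarrow> partial E (G A C) y = partial A (G E C) y"
    "\<And>y u. y \<in> W \<Longrightarrow> u \<noteq> (\<lambda>_. 0) \<Longrightarrow> (\<Sum>A\<in>UNIV. \<Sum>C\<in>UNIV. G A C y * u A * u C) > 0"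
    and hess: "\<And>x i C. x \<in> B \<Longrightarrow> (\<Sum>A\<in>UNIV. \<Sum>E\<in>UNIV. G A E (imm x) * frame (Inl i) x $ A * frame C x $ E) =
       coef i (Inl C) (Inr False) x"
    by (rule local_embedding_aux) (rule that)
  have xb: "x \<in> ball x0 r" if "x \<in> B" for x using that B by blast
  show ?thesis
  proof (rule that[OF B(1,2) _ W(1,2) _ W(3) _ G])
    show "B \<subseteq> S" using B rS by blast
    show "smooth_on B imm" using smooth_on_subset[OF smooth_imm B(3)] .
    show "partial i (partial j imm) x =
       (\<Sum>k\<in>UNIV. Gm k i j x *\<^sub>R partial k imm x) + (\<Sum>a\<in>UNIV. h a i j x *\<^sub>R frame (Inr a) x)" if "x \<in> B" for x i j
      by (rule partial_partial_imm[OF xb[OF that]])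
    show "(\<Sum>A\<in>UNIV. \<Sum>C\<in>UNIV. G A C (imm x) * partial i imm x $ A * partial j imm x $ C) = g i j x" if "x \<in> B" for x i j
      using hess[OF that, of i "Inl j"] by (simp add: partial_imm[OF xb[OF that]])
    show "(\<Sum>A\<in>UNIV. \<Sum>C\<in>UNIV. G A C (imm x) * partial i imm x $ A * frame (Inr a) x $ C) = 0" if "x \<in> B" for x i a
      using hess[OF that, of i "Inr a"] by (simp add: partial_imm[OF xb[OF that]])
  qed
qed

section \<open>From charts to manifolds\<close>

lemma positive_definite_det:
  fixes A :: "real^'n^'n"
  assumes "\<And>u. u \<noteq> (\<lambda>_. 0) \<Longrightarrow> (\<Sum>i\<in>UNIV. \<Sum>j\<in>UNIV. A $ i $ j * u i * u j) > 0"
  shows "det A \<noteq> 0"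
proof -
  have "v = 0" if v: "A *v v = 0" for v
  proof (rule ccontr)
    assume "v \<noteq> 0"
    then have "(\<lambda>i. v $ i) \<noteq> (\<lambda>_. 0)" by (auto simp: fun_eq_iff vec_eq_iff)
    from assms[OF this] have "(\<Sum>i\<in>UNIV. v $ i * (A *v v) $ i) > 0"
      by (simp add: matrix_vector_mult_def sum_distrib_left mult_ac)
    then show False using v by simp
  qed
  then show ?thesis
    by (metis invertible_det_nz invertible_left_inverse matrix_left_invertible_ker)
qed

section \<open>Raising of indices and curvature in one chart\<close>

context
  fixes M :: "('a, 'c, 'n::finite) stat_manifold"
  assumes M: "statistical_manifold M"
begin

lemma smooth_M: "smooth_manifold M"
  using M by (simp add: statistical_manifold_def)

context
  fixes \<alpha>
  assumes \<alpha>: "\<alpha> \<in> charts M"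
begin

lemma chart_facts:
  shows "openin (mspace M) (cdom M \<alpha>)" "open (cmap M \<alpha> ` cdom M \<alpha>)"
    "homeomorphic_map (subtopology (mspace M) (cdom M \<alpha>)) (top_of_set (cmap M \<alpha> ` cdom M \<alpha>)) (cmap M \<alpha>)"
  using smooth_M \<alpha> by (auto simp: smooth_manifold_def)

lemma chart_subset: "cdom M \<alpha> \<subseteq> topspace (mspace M)"
  using chart_facts(1) openin_subset by blast

lemma chart_inj: "inj_on (cmap M \<alpha>) (cdom M \<alpha>)"
  using homeomorphic_imp_injective_map[OF chart_facts(3)] chart_subset by (simp add: Int_absorb1)

lemma cinv_cmap: "p \<in> cdom M \<alpha> \<Longrightarrow> cinv M \<alpha> (cmap M \<alpha> p) = p"
  unfolding cinv_def by (rule inv_into_f_f[OF chart_inj])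

lemma cmap_cinv: "x \<in> cmap M \<alpha> ` cdom M \<alpha> \<Longrightarrow> cmap M \<alpha> (cinv M \<alpha> x) = x"
  unfolding cinv_def by (rule f_inv_into_f)

lemma cinv_cdom: "x \<in> cmap M \<alpha> ` cdom M \<alpha> \<Longrightarrow> cinv M \<alpha> x \<in> cdom M \<alpha>"
  unfolding cinv_def by (rule inv_into_into)

lemma pd_cinv: "x \<in> cmap M \<alpha> ` cdom M \<alpha> \<Longrightarrow> pd M \<alpha> i F (cinv M \<alpha> x) = partial i (\<lambda>x. F (cinv M \<alpha> x)) x"
  by (simp add: pd_def cmap_cinv)

lemma riemannian_M: "riemannian_metric M (met M)"
  using M by (simp add: statistical_manifold_def)

lemma met_det: "p \<in> cdom M \<alpha> \<Longrightarrow> det (\<chi> i j. met M \<alpha> p i j) \<noteq> 0"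
  by (rule positive_definite_det) (use riemannian_M \<alpha> in \<open>simp add: riemannian_metric_def\<close>)

lemma met_sym: "p \<in> cdom M \<alpha> \<Longrightarrow> met M \<alpha> p i j = met M \<alpha> p j i"
  using riemannian_M \<alpha> by (simp add: riemannian_metric_def symmetric_2tensor_field_def)

lemma met_inv_left: "p \<in> cdom M \<alpha> \<Longrightarrow> (\<Sum>k\<in>UNIV. met_inv M \<alpha> p i k * met M \<alpha> p k j) = (if i = j then 1 else 0)"
  using arg_cong[OF matrix_inv_nonsingular(2)[OF met_det[of p]], of "\<lambda>B. B $ i $ j"]
  by (simp add: met_inv_def matrix_matrix_mult_def mat_def)

lemma met_inv_right: "p \<in> cdom M \<alpha> \<Longrightarrow> (\<Sum>k\<in>UNIV. met M \<alpha> p i k * met_inv M \<alpha> p k j) = (if i = j then 1 else 0)"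
  using arg_cong[OF matrix_inv_nonsingular(1)[OF met_det[of p]], of "\<lambda>B. B $ i $ j"]
  by (simp add: met_inv_def matrix_matrix_mult_def mat_def)

lemma lower_raise: "p \<in> cdom M \<alpha> \<Longrightarrow> (\<Sum>k\<in>UNIV. raise M \<alpha> t p i k * met M \<alpha> p j k) = t p i j"
proof -
  assume p: "p \<in> cdom M \<alpha>"
  have "(\<Sum>k\<in>UNIV. raise M \<alpha> t p i k * met M \<alpha> p j k) =
      (\<Sum>k\<in>UNIV. \<Sum>l\<in>UNIV. t p i l * (met M \<alpha> p j k * met_inv M \<alpha> p k l))"
    by (simp add: raise_def sum_distrib_left sum_distrib_right mult_ac)
  also have "\<dots> = (\<Sum>l\<in>UNIV. t p i l * (\<Sum>k\<in>UNIV. met M \<alpha> p j k * met_inv M \<alpha> p k l))"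
    by (subst sum.swap) (simp add: sum_distrib_left)
  also have "\<dots> = t p i j"
    by (simp add: met_inv_right[OF p] if_distrib[of "\<lambda>c. _ * c"] cong: if_cong)
  finally show ?thesis .
qed

lemma curv_raise:
  assumes p: "p \<in> cdom M \<alpha>"
  shows "curv M \<alpha> p i j m l = (\<Sum>k\<in>UNIV. met_inv M \<alpha> p m k * curv_low M \<alpha> p i j k l)"
proof -
  have "(\<Sum>k\<in>UNIV. met_inv M \<alpha> p m k * curv_low M \<alpha> p i j k l) =
    (\<Sum>k\<in>UNIV. \<Sum>n\<in>UNIV. (met_inv M \<alpha> p m k * met M \<alpha> p k n) * curv M \<alpha> p i j n l)"
    by (simp add: curv_low_def sum_distrib_left mult_ac)
  also have "\<dots> = (\<Sum>n\<in>UNIV. (\<Sum>k\<in>UNIV. met_inv M \<alpha> p m k * met M \<alpha> p k n) * curv M \<alpha> p i j n l)"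
    by (subst sum.swap) (simp add: sum_distrib_right)
  also have "\<dots> = curv M \<alpha> p i j m l"
    by (simp add: met_inv_left[OF p] if_distrib[of "\<lambda>c. c * _"] cong: if_cong)
  finally show ?thesis ..
qed

lemma chris_sym: "p \<in> cdom M \<alpha> \<Longrightarrow> chris M \<alpha> p k i j = chris M \<alpha> p k j i"
  using M \<alpha> by (simp add: statistical_manifold_def torsion_def)

text \<open>The classical coordinate formula. The terms with \<Gamma>^m_ij, which come from
  differentiating the derivative of the coordinate field as a (1,1) tensor, are symmetric in i and j
  and cancel.\<close>

lemma curv_eq:
  assumes p: "p \<in> cdom M \<alpha>"
  shows "curv M \<alpha> p i j k l =
    (pd M \<alpha> i (\<lambda>q. chris M \<alpha> q k j l) p + (\<Sum>m\<in>UNIV. chris M \<alpha> p m j l * chris M \<alpha> p k i m)) -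
    (pd M \<alpha> j (\<lambda>q. chris M \<alpha> q k i l) p + (\<Sum>m\<in>UNIV. chris M \<alpha> p m i l * chris M \<alpha> p k j m))"
proof -
  have e: "cov_vec M \<alpha> (\<lambda>_ m. if m = l then 1 else 0) = (\<lambda>q j k. chris M \<alpha> q k j l)"
    by (simp add: cov_vec_def fun_eq_iff pd_def if_distrib[of "\<lambda>c. _ * c"] cong: if_cong)
  show ?thesis
    unfolding curv_def Let_def e cov_endo_def using chris_sym[OF p, of _ i j] by (simp add: mult.commute)
qed

text \<open>In the skew-symmetrized equations the terms with \<Gamma>^m_ij and the factor 1/2 drop
  out. The Gauss equation is multiplied by the inverse metric to become an identity for
  \<open>Gm\<close>, and the symmetry of h^* turns into \<open>K_sym\<close> by lowering the raised
  index again.\<close>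

lemma gcr_chart_of:
  fixes h hs :: "'r::finite \<Rightarrow> 'c \<Rightarrow> 'a \<Rightarrow> 'n \<Rightarrow> 'n \<Rightarrow> real"
    and \<tau> :: "'r \<Rightarrow> 'r \<Rightarrow> 'c \<Rightarrow> 'a \<Rightarrow> 'n \<Rightarrow> real"
  assumes h: "\<And>a. symmetric_2tensor_field M (h a)"
    and hs: "\<And>a. symmetric_2tensor_field M (hs a)"
    and \<tau>: "\<And>a b. covector_field M (\<tau> a b)"
    and gauss: "gauss_eq M h hs"
    and codazzi: "codazzi_eq M h \<tau>"
    and codazzi_dual: "codazzi_dual_eq M hs \<tau>"
    and ricci: "ricci_eq M h hs \<tau>"
  shows "gcr_chart (cmap M \<alpha> ` cdom M \<alpha>)
    (\<lambda>i j x. met M \<alpha> (cinv M \<alpha> x) i j) (\<lambda>k i j x. chris M \<alpha> (cinv M \<alpha> x) k i j)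
    (\<lambda>a i j x. h a \<alpha> (cinv M \<alpha> x) i j) (\<lambda>a i k x. raise M \<alpha> (hs a \<alpha>) (cinv M \<alpha> x) i k)
    (\<lambda>a b i x. \<tau> a b \<alpha> (cinv M \<alpha> x) i)"
proof -
  let ?O = "cmap M \<alpha> ` cdom M \<alpha>" and ?q = "cinv M \<alpha>"
  have O: "open ?O" by (rule chart_facts(2))
  have smooth_met: "smooth_on ?O (\<lambda>x. met M \<alpha> (?q x) i j)" for i j
    using riemannian_M \<alpha> by (simp add: riemannian_metric_def symmetric_2tensor_field_def smooth_in_chart_def)
  have smooth_hs: "smooth_on ?O (\<lambda>x. hs a \<alpha> (?q x) i j)" for a i j
    using hs[of a] \<alpha> by (simp add: symmetric_2tensor_field_def smooth_in_chart_def)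
  have cov_met: "cov_2tensor M \<alpha> (met M \<alpha>) p i j l = cov_2tensor M \<alpha> (met M \<alpha>) p j i l" if "p \<in> cdom M \<alpha>" for p i j l
    using M \<alpha> that by (simp add: statistical_manifold_def)
  show ?thesis
  proof
    show "open ?O" by (rule O)
    show "smooth_on ?O (\<lambda>x. met M \<alpha> (?q x) i j)" for i j by (rule smooth_met)
    show "smooth_on ?O (\<lambda>x. chris M \<alpha> (?q x) k i j)" for k i j
      using M \<alpha> by (simp add: statistical_manifold_def affine_connection_def smooth_in_chart_def)
    show "smooth_on ?O (\<lambda>x. h a \<alpha> (?q x) i j)" for a i j
      using h[of a] \<alpha> by (simp add: symmetric_2tensor_field_def smooth_in_chart_def)
    show "smooth_on ?O (\<lambda>x. raise M \<alpha> (hs a \<alpha>) (?q x) i k)" for a i k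
      unfolding raise_def met_inv_def
      by (intro smooth_on_sum smooth_on_mult smooth_on_matrix_inv O smooth_hs)
        (simp_all add: smooth_met met_det cinv_cdom)
    show "smooth_on ?O (\<lambda>x. \<tau> a b \<alpha> (?q x) i)" for a b i
      using \<tau>[of a b] \<alpha> by (simp add: covector_field_def smooth_in_chart_def)
  next
    fix x assume x: "x \<in> ?O"
    define p where "p = ?q x"
    have p: "p \<in> cdom M \<alpha>" unfolding p_def by (rule cinv_cdom[OF x])
    have pd: "pd M \<alpha> i F p = partial i (\<lambda>x. F (?q x)) x" for i and F :: "'a \<Rightarrow> real"
      unfolding p_def by (rule pd_cinv[OF x])
    note cs = chris_sym[OF p]
    have h_sym: "h a \<alpha> p i j = h a \<alpha> p j i" for a i j
      using h[of a] \<alpha> p by (simp add: symmetric_2tensor_field_def)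
    have hs_sym: "hs a \<alpha> p i j = hs a \<alpha> p j i" for a i j
      using hs[of a] \<alpha> p by (simp add: symmetric_2tensor_field_def)
    show "met M \<alpha> (?q x) i j = met M \<alpha> (?q x) j i" for i j
      using met_sym[OF p] unfolding p_def .
    show "(\<Sum>i\<in>UNIV. \<Sum>j\<in>UNIV. met M \<alpha> (?q x) i j * u i * u j) > 0" if "u \<noteq> (\<lambda>_. 0)" for u
      using riemannian_M \<alpha> p that unfolding p_def by (simp add: riemannian_metric_def)
    show "chris M \<alpha> (?q x) k i j = chris M \<alpha> (?q x) k j i" for k i j
      using cs unfolding p_def .
    show "h a \<alpha> (?q x) i j = h a \<alpha> (?q x) j i" for a i j
      using h_sym unfolding p_def .
    show "(\<Sum>k\<in>UNIV. raise M \<alpha> (hs a \<alpha>) (?q x) j k * met M \<alpha> (?q x) i k) =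
        (\<Sum>k\<in>UNIV. raise M \<alpha> (hs a \<alpha>) (?q x) i k * met M \<alpha> (?q x) j k)" for a i j
      unfolding p_def[symmetric] lower_raise[OF p] by (rule hs_sym)
    show "partial i (\<lambda>x. met M \<alpha> (?q x) j k) x + (\<Sum>m\<in>UNIV. chris M \<alpha> (?q x) m j k * met M \<alpha> (?q x) i m) =
      partial j (\<lambda>x. met M \<alpha> (?q x) i k) x + (\<Sum>m\<in>UNIV. chris M \<alpha> (?q x) m i k * met M \<alpha> (?q x) j m)" for i j k
      unfolding p_def[symmetric] using cov_met[OF p, of i j k] cs[of _ i j] by (simp add: pd cov_2tensor_def)
    show "partial i (\<lambda>x. chris M \<alpha> (?q x) l j k) x + (\<Sum>m\<in>UNIV. chris M \<alpha> (?q x) m j k * chris M \<alpha> (?q x) l i m) -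
        (\<Sum>a\<in>UNIV. h a \<alpha> (?q x) j k * raise M \<alpha> (hs a \<alpha>) (?q x) i l) =
      partial j (\<lambda>x. chris M \<alpha> (?q x) l i k) x + (\<Sum>m\<in>UNIV. chris M \<alpha> (?q x) m i k * chris M \<alpha> (?q x) l j m) -
        (\<Sum>a\<in>UNIV. h a \<alpha> (?q x) i k * raise M \<alpha> (hs a \<alpha>) (?q x) j l)" for i j k l
    proof -
      have "curv M \<alpha> p i j l k = (\<Sum>n\<in>UNIV. \<Sum>a\<in>UNIV. met_inv M \<alpha> p l n * (hs a \<alpha> p i n * h a \<alpha> p j k - hs a \<alpha> p j n * h a \<alpha> p i k))"
        unfolding curv_raise[OF p] using gauss \<alpha> p by (simp add: gauss_eq_def sum_distrib_left)
      also have "\<dots> = (\<Sum>a\<in>UNIV. h a \<alpha> p j k * raise M \<alpha> (hs a \<alpha>) p i l - h a \<alpha> p i k * raise M \<alpha> (hs a \<alpha>) p j l)"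
        by (subst sum.swap) (simp add: raise_def sum_distrib_left sum_subtractf algebra_simps)
      finally show ?thesis
        unfolding p_def[symmetric] curv_eq[OF p] pd by (simp add: sum_subtractf)
    qed
    show "partial i (\<lambda>x. h b \<alpha> (?q x) j k) x + (\<Sum>m\<in>UNIV. chris M \<alpha> (?q x) m j k * h b \<alpha> (?q x) i m) +
        (\<Sum>a\<in>UNIV. h a \<alpha> (?q x) j k * \<tau> b a \<alpha> (?q x) i) =
      partial j (\<lambda>x. h b \<alpha> (?q x) i k) x + (\<Sum>m\<in>UNIV. chris M \<alpha> (?q x) m i k * h b \<alpha> (?q x) j m) +
        (\<Sum>a\<in>UNIV. h a \<alpha> (?q x) i k * \<tau> b a \<alpha> (?q x) j)" for i j k b
    proof -
      have "skew (\<lambda>i j. cov_2tensor M \<alpha> (h b \<alpha>) p i j k) i j - (\<Sum>a\<in>UNIV. skew (\<lambda>i j. h a \<alpha> p k i * \<tau> b a \<alpha> p j) i j) = 0"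
        using codazzi \<alpha> p by (simp add: codazzi_eq_def)
      then show ?thesis
        unfolding p_def[symmetric] using cs[of _ i j] h_sym[of _ k]
        by (simp add: pd cov_2tensor_def skew_def sum_subtractf flip: sum_divide_distrib)
    qed
    show "partial i (\<lambda>x. raise M \<alpha> (hs a \<alpha>) (?q x) j k) x + (\<Sum>l\<in>UNIV. raise M \<alpha> (hs a \<alpha>) (?q x) j l * chris M \<alpha> (?q x) k i l) +
        (\<Sum>b\<in>UNIV. \<tau> b a \<alpha> (?q x) j * raise M \<alpha> (hs b \<alpha>) (?q x) i k) =
      partial j (\<lambda>x. raise M \<alpha> (hs a \<alpha>) (?q x) i k) x + (\<Sum>l\<in>UNIV. raise M \<alpha> (hs a \<alpha>) (?q x) i l * chris M \<alpha> (?q x) k j l) +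
        (\<Sum>b\<in>UNIV. \<tau> b a \<alpha> (?q x) i * raise M \<alpha> (hs b \<alpha>) (?q x) j k)" for i j k a
    proof -
      have "skew (\<lambda>i j. cov_endo M \<alpha> (raise M \<alpha> (hs a \<alpha>)) p i j k) i j
          + (\<Sum>b\<in>UNIV. skew (\<lambda>i j. raise M \<alpha> (hs b \<alpha>) p i k * \<tau> b a \<alpha> p j) i j) = 0"
        using codazzi_dual \<alpha> p by (simp add: codazzi_dual_eq_def)
      then have "cov_endo M \<alpha> (raise M \<alpha> (hs a \<alpha>)) p i j k - cov_endo M \<alpha> (raise M \<alpha> (hs a \<alpha>)) p j i k
          + (\<Sum>b\<in>UNIV. raise M \<alpha> (hs b \<alpha>) p i k * \<tau> b a \<alpha> p j - raise M \<alpha> (hs b \<alpha>) p j k * \<tau> b a \<alpha> p i) = 0"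
        by (simp add: skew_def flip: sum_divide_distrib add_divide_distrib)
      then show ?thesis
        unfolding p_def[symmetric] using cs[of _ i j]
        by (simp add: pd cov_endo_def sum_subtractf mult.commute)
    qed
    show "partial i (\<lambda>x. \<tau> b a \<alpha> (?q x) j) x + (\<Sum>c\<in>UNIV. \<tau> c a \<alpha> (?q x) j * \<tau> b c \<alpha> (?q x) i) -
        (\<Sum>l\<in>UNIV. raise M \<alpha> (hs a \<alpha>) (?q x) j l * h b \<alpha> (?q x) i l) =
      partial j (\<lambda>x. \<tau> b a \<alpha> (?q x) i) x + (\<Sum>c\<in>UNIV. \<tau> c a \<alpha> (?q x) i * \<tau> b c \<alpha> (?q x) j) -
        (\<Sum>l\<in>UNIV. raise M \<alpha> (hs a \<alpha>) (?q x) i l * h b \<alpha> (?q x) j l)" for i j a b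
    proof -
      have "skew (\<lambda>i j. cov_covec M \<alpha> (\<tau> b a \<alpha>) p i j) i j
          + (\<Sum>c\<in>UNIV. skew (\<lambda>i j. \<tau> b c \<alpha> p i * \<tau> c a \<alpha> p j) i j)
          - (\<Sum>l\<in>UNIV. skew (\<lambda>i j. h b \<alpha> p l i * raise M \<alpha> (hs a \<alpha>) p j l) i j) = 0"
        using ricci \<alpha> p by (simp add: ricci_eq_def)
      then have "cov_covec M \<alpha> (\<tau> b a \<alpha>) p i j - cov_covec M \<alpha> (\<tau> b a \<alpha>) p j i
          + (\<Sum>c\<in>UNIV. \<tau> b c \<alpha> p i * \<tau> c a \<alpha> p j - \<tau> b c \<alpha> p j * \<tau> c a \<alpha> p i)
          - (\<Sum>l\<in>UNIV. h b \<alpha> p l i * raise M \<alpha> (hs a \<alpha>) p j l - h b \<alpha> p l j * raise M \<alpha> (hs a \<alpha>) p i l) = 0"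
        by (simp add: skew_def flip: sum_divide_distrib add_divide_distrib diff_divide_distrib)
      then show ?thesis
        unfolding p_def[symmetric] using cs[of _ i j] h_sym[of b _ i] h_sym[of b _ j]
        by (simp add: pd cov_covec_def sum_subtractf mult.commute)
    qed
  qed
qed

end

end

definition hessian_manifold :: "(real^'m) set \<Rightarrow> ('m \<Rightarrow> 'm \<Rightarrow> real^'m \<Rightarrow> real) \<Rightarrow> (real^'m, nat, 'm::finite) stat_manifold" where
  "hessian_manifold W G = \<lparr>mspace = top_of_set W, charts = {0}, cdom = (\<lambda>_. W), cmap = (\<lambda>_ y. y),
     met = (\<lambda>_ y A C. G A C y), chris = (\<lambda>_ _ _ _ _. 0)\<rparr>"

lemma hessian_manifold_simps [simp]:
  "mspace (hessian_manifold W G) = top_of_set W" "charts (hessian_manifold W G) = {0}"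
  "cdom (hessian_manifold W G) a = W" "cmap (hessian_manifold W G) a = (\<lambda>y. y)"
  "met (hessian_manifold W G) a = (\<lambda>y A C. G A C y)" "chris (hessian_manifold W G) a = (\<lambda>_ _ _ _. 0)"
  by (simp_all add: hessian_manifold_def)

lemma second_countable_euclidean: "second_countable (euclidean :: 'a::second_countable_topology topology)"
proof -
  obtain B :: "'a set set" where B: "countable B" "topological_basis B"
    using ex_countable_basis by blast
  have "\<exists>V\<in>B. x \<in> V \<and> V \<subseteq> U" if U: "open U" "x \<in> U" for U x
  proof -
    obtain V where "V \<in> B" "x \<in> V" "V \<subseteq> U"
      by (rule topological_basisE[OF B(2) U])
    then show ?thesis by blast
  qed
  then have "countable B \<and> (\<forall>V\<in>B. openin euclidean V) \<and>
      (\<forall>U x. openin euclidean U \<and> x \<in> U \<longrightarrow> (\<exists>V\<in>B. x \<in> V \<and> V \<subseteq> U))"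
    using B(1) topological_basis_open[OF B(2)] by (simp only: open_openin[symmetric]) blast
  then show ?thesis unfolding second_countable_def by (rule exI)
qed

text \<open>The identity chart gives flat coordinates: the Christoffel symbols are zero, so
  \<nabla>G is the array of partial derivatives and its total symmetry is \<open>tot\<close>
  together with \<open>sym\<close>.\<close>

lemma hessian_manifold_flat:
  fixes G :: "'m::finite \<Rightarrow> 'm \<Rightarrow> real^'m \<Rightarrow> real"
  assumes W: "open W" and smooth: "\<And>A C. smooth_on W (G A C)"
    and sym: "\<And>y A C. y \<in> W \<Longrightarrow> G A C y = G C A y"
    and tot: "\<And>y A C E. y \<in> W \<Longrightarrow> partial E (G A C) y = partial A (G E C) y"
    and pos: "\<And>y u. y \<in> W \<Longrightarrow> u \<noteq> (\<lambda>_. 0) \<Longrightarrow> (\<Sum>A\<in>UNIV. \<Sum>C\<in>UNIV. G A C y * u A * u C) > 0"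
  shows "statistical_manifold (hessian_manifold W G)" "flat (hessian_manifold W G)"
proof -
  let ?H = "hessian_manifold W G"
  \<comment> \<open>\<open>cinv\<close> is known to be the identity only on \<open>W\<close>;
    derivatives are therefore transferred by congruence on this open set.\<close>
  have cinv: "cinv ?H a y = y" if "y \<in> W" for a y
    using inv_into_f_f[of "\<lambda>y. y" W y] that by (simp add: cinv_def inj_on_def)
  have pd: "pd ?H a i F y = partial i F y" if "y \<in> W" for a i F y
    unfolding pd_def by (simp, rule fun_cong[OF frechet_derivative_cong_open[OF W that]]) (simp add: cinv)
  have jac: "jac ?H a b y k i = (if k = i then 1 else 0)" if "y \<in> W" for a b y k i
    unfolding jac_def pd[OF that]
    using partial_eqI[OF bounded_linear_imp_has_derivative[OF bounded_linear_vec_nth], of k y i] by (simp add: axis_nth)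
  have pd_jac: "pd ?H a i (\<lambda>q. jac ?H b c q k j) y = 0" if "y \<in> W" for a b c i j k y
    unfolding pd[OF that]
    using fun_cong[OF frechet_derivative_cong_open[OF W that, of "\<lambda>q. jac ?H b c q k j" "\<lambda>_. if k = j then 1 else 0"], of "axis i 1"]
    by (simp add: jac)
  have smooth_chart: "smooth_in_chart ?H a F \<longleftrightarrow> smooth_on W F" for a F
    unfolding smooth_in_chart_def by (simp, rule smooth_on_cong[OF W]) (simp add: cinv)
  have "smooth_manifold ?H"
    unfolding smooth_manifold_def
  proof (intro conjI ballI)
    show "Hausdorff_space (mspace ?H)" by (simp add: Hausdorff_space_subtopology)
    show "second_countable (mspace ?H)" by (simp add: second_countable_subtopology second_countable_euclidean)
    show "homeomorphic_map (subtopology (mspace ?H) (cdom ?H a)) (top_of_set (cmap ?H a ` cdom ?H a)) (cmap ?H a)" for a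
      using homeomorphic_map_id[of "top_of_set W" "top_of_set W"] by (simp add: subtopology_subtopology id_def)
    show "smooth_on (cmap ?H a ` (cdom ?H a \<inter> cdom ?H b)) (\<lambda>x. cmap ?H b (cinv ?H a x))" for a b
      using smooth_on_cong[OF W, of "\<lambda>x. cinv ?H a x" "\<lambda>x. x"] smooth_on_linear[OF bounded_linear_ident W] by (simp add: cinv)
  qed (use W in \<open>auto simp: openin_open_eq\<close>)
  moreover have "riemannian_metric ?H (met ?H)"
    unfolding riemannian_metric_def symmetric_2tensor_field_def
    by (auto simp: smooth_chart smooth pos jac sym if_distrib[of "\<lambda>c. _ * c"] cong: if_cong)
  moreover have "affine_connection ?H (chris ?H)"
    unfolding affine_connection_def by (simp add: smooth_chart smooth_on_const W pd_jac)
  moreover have "cov_2tensor ?H a (met ?H a) y i j l = partial i (G j l) y" if "y \<in> W" for a y i j l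
    by (simp add: cov_2tensor_def pd[OF that])
  moreover have "partial i (G j l) y = partial i (G l j) y" if "y \<in> W" for y i j l
    using fun_cong[OF frechet_derivative_cong_open[OF W that, of "G j l" "G l j"]] sym by blast
  ultimately show "statistical_manifold ?H"
    unfolding statistical_manifold_def using tot by (simp add: torsion_def)
  have "cov_vec ?H a (\<lambda>_ m. if m = l then 1 else 0) = (\<lambda>_ _ _. 0)" for a and l :: 'm
    by (simp add: cov_vec_def fun_eq_iff pd_def)
  then show "flat ?H"
    unfolding flat_def curv_def Let_def by (simp add: cov_endo_def pd_def)
qed

section \<open>Behaviour under change of charts\<close>

lemma partial_nth:
  fixes f :: "real^'n \<Rightarrow> real^'m"
  assumes "smooth_on S f" "x \<in> S"
  shows "partial i (\<lambda>x. f x $ k) x = partial i f x $ k"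
  using partial_eqI[OF bounded_linear.has_derivative[OF bounded_linear_vec_nth smooth_on_has_derivative[OF assms]]] .

lemma partial_compose:
  fixes f :: "real^'n \<Rightarrow> real^'m" and T :: "real^'k \<Rightarrow> real^'n"
  assumes "smooth_on N T" "x \<in> N" "smooth_on B f" "T x \<in> B"
  shows "partial i (\<lambda>x. f (T x)) x = (\<Sum>k\<in>UNIV. partial i (\<lambda>x. T x $ k) x *\<^sub>R partial k f (T x))"
  using partial_eqI[OF has_derivative_compose[OF smooth_on_has_derivative[OF assms(1,2)] smooth_on_partials[OF assms(3,4)]]]
  by (simp add: partial_nth[OF assms(1,2)])

text \<open>The Gauss formula is obtained in a single chart, but the definition of a statistical
  embedding quantifies over all charts. The second derivatives of \<open>T\<close> in the chain rule
  are just the inhomogeneous term in the transformation law of the Christoffel symbols, while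
  \<open>h\<close> transforms as a tensor; so the formula keeps its shape with the same
  \<open>\<xi>\<close>.\<close>

lemma change_chart:
  fixes f :: "real^'n \<Rightarrow> real^'m" and T :: "real^'n \<Rightarrow> real^'n" and \<xi> :: "'r::finite \<Rightarrow> real^'m"
  assumes N: "open N" "y \<in> N" and B: "open B" and TB: "T ` N \<subseteq> B" and T: "smooth_on N T" and f: "smooth_on B f"
    and J: "\<And>k j. J k j = partial j (\<lambda>x. T x $ k) y"
    and second: "\<And>l k. partial l (partial k f) (T y) = (\<Sum>m\<in>UNIV. Gm m l k *\<^sub>R partial m f (T y)) + (\<Sum>a\<in>UNIV. h a l k *\<^sub>R \<xi> a)"
    and Gm': "\<And>k. (\<Sum>m\<in>UNIV. Gm' m * J k m) = partial i (\<lambda>x. partial j (\<lambda>x. T x $ k) x) y +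
        (\<Sum>l\<in>UNIV. \<Sum>m\<in>UNIV. Gm k l m * J l i * J m j)"
    and h': "\<And>a. h' a = (\<Sum>k\<in>UNIV. \<Sum>l\<in>UNIV. h a k l * J k i * J l j)"
  shows "partial i (partial j (\<lambda>x. f (T x))) y = (\<Sum>m\<in>UNIV. Gm' m *\<^sub>R partial m (\<lambda>x. f (T x)) y) + (\<Sum>a\<in>UNIV. h' a *\<^sub>R \<xi> a)"
proof -
  have TyB: "T y \<in> B" using TB N by blast
  have Tk: "smooth_on N (\<lambda>x. T x $ k)" for k
    by (rule smooth_on_bounded_linear[OF bounded_linear_vec_nth N(1) T])
  let ?f = "\<lambda>k. partial k f (T y)"
  have "partial i (partial j (\<lambda>x. f (T x))) y =
      partial i (\<lambda>x. \<Sum>k\<in>UNIV. partial j (\<lambda>x. T x $ k) x *\<^sub>R partial k f (T x)) y"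
    by (rule fun_cong[OF frechet_derivative_cong_open[OF N]]) (rule partial_compose[OF T _ f], use TB in auto)
  also have "\<dots> = (\<Sum>k\<in>UNIV. J k j *\<^sub>R partial i (\<lambda>x. partial k f (T x)) y + partial i (\<lambda>x. partial j (\<lambda>x. T x $ k) x) y *\<^sub>R ?f k)"
  proof -
    have d: "((\<lambda>x. partial k f (T x)) has_derivative frechet_derivative (\<lambda>x. partial k f (T x)) (at y)) (at y)" for k
      by (rule smooth_on_has_derivative[OF smooth_on_compose[OF N(1) B TB T smooth_on_partial[OF f]] N(2)])
    have "((\<lambda>x. \<Sum>k\<in>UNIV. partial j (\<lambda>x. T x $ k) x *\<^sub>R partial k f (T x)) has_derivative
      (\<lambda>v. \<Sum>k\<in>UNIV. partial j (\<lambda>x. T x $ k) y *\<^sub>R frechet_derivative (\<lambda>x. partial k f (T x)) (at y) v +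
         frechet_derivative (\<lambda>x. partial j (\<lambda>x. T x $ k) x) (at y) v *\<^sub>R partial k f (T y))) (at y)"
      by (intro has_derivative_sum bounded_bilinear.FDERIV[OF bounded_bilinear_scaleR] d
          smooth_on_has_derivative[OF smooth_on_partial[OF Tk] N(2)])
    from partial_eqI[OF this] show ?thesis by (simp add: J)
  qed
  also have "\<dots> = (\<Sum>k\<in>UNIV. J k j *\<^sub>R (\<Sum>l\<in>UNIV. J l i *\<^sub>R ((\<Sum>m\<in>UNIV. Gm m l k *\<^sub>R ?f m) + (\<Sum>a\<in>UNIV. h a l k *\<^sub>R \<xi> a)))
       + partial i (\<lambda>x. partial j (\<lambda>x. T x $ k) x) y *\<^sub>R ?f k)"
    by (simp add: partial_compose[OF T N(2) smooth_on_partial[OF f] TyB] J second)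
  also have "\<dots> = (\<Sum>k\<in>UNIV. \<Sum>l\<in>UNIV. \<Sum>m\<in>UNIV. (Gm m l k * J l i * J k j) *\<^sub>R ?f m)
      + (\<Sum>k\<in>UNIV. \<Sum>l\<in>UNIV. \<Sum>a\<in>UNIV. (h a l k * J l i * J k j) *\<^sub>R \<xi> a)
      + (\<Sum>k\<in>UNIV. partial i (\<lambda>x. partial j (\<lambda>x. T x $ k) x) y *\<^sub>R ?f k)"
    by (simp add: sum.distrib scaleR_sum_right scaleR_add_right mult_ac)
  also have "(\<Sum>k\<in>UNIV. \<Sum>l\<in>UNIV. \<Sum>m\<in>UNIV. (Gm m l k * J l i * J k j) *\<^sub>R ?f m) =
      (\<Sum>m\<in>UNIV. (\<Sum>l\<in>UNIV. \<Sum>k\<in>UNIV. Gm m l k * J l i * J k j) *\<^sub>R ?f m)"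
  proof -
    have "(\<Sum>k\<in>UNIV. \<Sum>l\<in>UNIV. \<Sum>m\<in>UNIV. (Gm m l k * J l i * J k j) *\<^sub>R ?f m) =
        (\<Sum>l\<in>UNIV. \<Sum>k\<in>UNIV. \<Sum>m\<in>UNIV. (Gm m l k * J l i * J k j) *\<^sub>R ?f m)"
      by (rule sum.swap)
    also have "\<dots> = (\<Sum>l\<in>UNIV. \<Sum>m\<in>UNIV. \<Sum>k\<in>UNIV. (Gm m l k * J l i * J k j) *\<^sub>R ?f m)"
      by (intro sum.cong refl sum.swap)
    also have "\<dots> = (\<Sum>m\<in>UNIV. \<Sum>l\<in>UNIV. \<Sum>k\<in>UNIV. (Gm m l k * J l i * J k j) *\<^sub>R ?f m)"
      by (rule sum.swap)
    finally show ?thesis by (simp add: scaleR_sum_left)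
  qed
  also have "(\<Sum>k\<in>UNIV. \<Sum>l\<in>UNIV. \<Sum>a\<in>UNIV. (h a l k * J l i * J k j) *\<^sub>R \<xi> a) =
      (\<Sum>a\<in>UNIV. (\<Sum>l\<in>UNIV. \<Sum>k\<in>UNIV. h a l k * J l i * J k j) *\<^sub>R \<xi> a)"
  proof -
    have "(\<Sum>k\<in>UNIV. \<Sum>l\<in>UNIV. \<Sum>a\<in>UNIV. (h a l k * J l i * J k j) *\<^sub>R \<xi> a) =
        (\<Sum>l\<in>UNIV. \<Sum>k\<in>UNIV. \<Sum>a\<in>UNIV. (h a l k * J l i * J k j) *\<^sub>R \<xi> a)"
      by (rule sum.swap)
    also have "\<dots> = (\<Sum>l\<in>UNIV. \<Sum>a\<in>UNIV. \<Sum>k\<in>UNIV. (h a l k * J l i * J k j) *\<^sub>R \<xi> a)"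
      by (intro sum.cong refl sum.swap)
    also have "\<dots> = (\<Sum>a\<in>UNIV. \<Sum>l\<in>UNIV. \<Sum>k\<in>UNIV. (h a l k * J l i * J k j) *\<^sub>R \<xi> a)"
      by (rule sum.swap)
    finally show ?thesis by (simp add: scaleR_sum_left)
  qed
  finally have "partial i (partial j (\<lambda>x. f (T x))) y =
      (\<Sum>m\<in>UNIV. (\<Sum>n\<in>UNIV. Gm' n * J m n) *\<^sub>R ?f m) + (\<Sum>a\<in>UNIV. h' a *\<^sub>R \<xi> a)"
    by (simp add: Gm' h' scaleR_add_left sum.distrib)
  also have "(\<Sum>m\<in>UNIV. (\<Sum>n\<in>UNIV. Gm' n * J m n) *\<^sub>R ?f m) = (\<Sum>n\<in>UNIV. Gm' n *\<^sub>R partial n (\<lambda>x. f (T x)) y)"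
    unfolding partial_compose[OF T N(2) f TyB] J
    by (simp add: scaleR_sum_left scaleR_sum_right) (rule sum.swap)
  finally show ?thesis .
qed

lemma bilinear_form_sum_sum:
  fixes Q :: "real^'m \<Rightarrow> real^'m \<Rightarrow> real"
  assumes "bilinear Q"
  shows "Q (\<Sum>i\<in>I. u i *\<^sub>R e i) (\<Sum>j\<in>J. v j *\<^sub>R f j) = (\<Sum>i\<in>I. \<Sum>j\<in>J. Q (e i) (f j) * u i * v j)"
proof -
  have l: "linear (\<lambda>x. Q x y)" and r: "linear (Q y)" for y
    using assms by (auto simp: bilinear_def)
  show ?thesis
    by (simp add: linear_sum[OF l] linear_sum[OF r] linear_cmul[OF l] linear_cmul[OF r] sum_distrib_left mult_ac) (rule sum.swap)
qed

section \<open>The embedding tested in an arbitrary chart\<close>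

locale chart_embedding =
  fixes M :: "('a, 'c, 'n::finite) stat_manifold"
    and h :: "'r::finite \<Rightarrow> 'c \<Rightarrow> 'a \<Rightarrow> 'n \<Rightarrow> 'n \<Rightarrow> real"
    and \<alpha> :: 'c
    and B :: "(real^'n) set" and W :: "(real^'m::finite) set"
    and f :: "real^'n \<Rightarrow> real^'m" and \<xi> :: "'r \<Rightarrow> real^'n \<Rightarrow> real^'m" and finv
    and G :: "'m \<Rightarrow> 'm \<Rightarrow> real^'m \<Rightarrow> real"
  assumes M: "statistical_manifold M"
    and h: "\<And>a. symmetric_2tensor_field M (h a)"
    and \<alpha>: "\<alpha> \<in> charts M"
    and B: "open B" "B \<subseteq> cmap M \<alpha> ` cdom M \<alpha>"
    and W: "open W" "f ` B \<subseteq> W"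
    and f: "smooth_on B f" "homeomorphism B (f ` B) f finv"
    and second: "\<And>x i j. x \<in> B \<Longrightarrow> partial i (partial j f) x =
       (\<Sum>k\<in>UNIV. chris M \<alpha> (cinv M \<alpha> x) k i j *\<^sub>R partial k f x) + (\<Sum>a\<in>UNIV. h a \<alpha> (cinv M \<alpha> x) i j *\<^sub>R \<xi> a x)"
    and G_sym: "\<And>y A C. y \<in> W \<Longrightarrow> G A C y = G C A y"
    and tangential: "\<And>x i j. x \<in> B \<Longrightarrow> (\<Sum>A\<in>UNIV. \<Sum>C\<in>UNIV. G A C (f x) * partial i f x $ A * partial j f x $ C)
       = met M \<alpha> (cinv M \<alpha> x) i j"
    and orthogonal: "\<And>x i a. x \<in> B \<Longrightarrow> (\<Sum>A\<in>UNIV. \<Sum>C\<in>UNIV. G A C (f x) * partial i f x $ A * \<xi> a x $ C) = 0"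
begin

definition nbhd :: "'a set" where
  "nbhd = {p \<in> cdom M \<alpha>. cmap M \<alpha> p \<in> B}"

definition emb :: "'a \<Rightarrow> real^'m" where
  "emb p = f (cmap M \<alpha> p)"

abbreviation "M' \<equiv> restrict_to M nbhd"
abbreviation "S \<equiv> hessian_manifold W G"

lemma restrict_simps [simp]:
  "mspace M' = subtopology (mspace M) nbhd" "charts M' = charts M" "cdom M' \<beta> = cdom M \<beta> \<inter> nbhd"
  "cmap M' = cmap M" "met M' = met M" "chris M' = chris M"
  by (simp_all add: restrict_to_def)

lemma nbhd_open: "openin (mspace M) nbhd"
proof -
  have "openin (subtopology (mspace M) (cdom M \<alpha>)) {p \<in> topspace (subtopology (mspace M) (cdom M \<alpha>)). cmap M \<alpha> p \<in> B}"
    by (rule openin_continuous_map_preimage[OF homeomorphic_imp_continuous_map[OF chart_facts(3)[OF M \<alpha>]]])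
      (use B chart_facts(2)[OF M \<alpha>] in \<open>auto simp: openin_open_eq\<close>)
  moreover have "{p \<in> topspace (subtopology (mspace M) (cdom M \<alpha>)). cmap M \<alpha> p \<in> B} = nbhd"
    using chart_subset[OF M \<alpha>] by (auto simp: nbhd_def)
  ultimately show ?thesis
    using chart_facts(1)[OF M \<alpha>] openin_trans_full by fastforce
qed

lemma cmap_nbhd: "cmap M \<alpha> ` nbhd = B"
  using B(2) by (auto simp: nbhd_def)

lemma emb_W: "p \<in> nbhd \<Longrightarrow> emb p \<in> W"
  using W(2) by (auto simp: nbhd_def emb_def)

lemma emb_embedding: "embedding_map (mspace M') (mspace S) emb"
proof -
  have top: "topspace (mspace M') = nbhd"
    using openin_subset[OF nbhd_open] by auto
  have "homeomorphic_map (subtopology (subtopology (mspace M) (cdom M \<alpha>)) nbhd)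
      (subtopology (top_of_set (cmap M \<alpha> ` cdom M \<alpha>)) B) (cmap M \<alpha>)"
    by (rule homeomorphic_map_subtopologies[OF chart_facts(3)[OF M \<alpha>]])
      (use chart_subset[OF M \<alpha>] B(2) in \<open>auto simp: nbhd_def\<close>)
  moreover have "cdom M \<alpha> \<inter> nbhd = nbhd" by (auto simp: nbhd_def)
  ultimately have c: "homeomorphic_map (mspace M') (top_of_set B) (cmap M \<alpha>)"
    using B(2) by (simp add: subtopology_subtopology Int_absorb1)
  have "homeomorphic_maps (top_of_set B) (top_of_set (f ` B)) f finv"
    using f(2) unfolding homeomorphism_def homeomorphic_maps_def by auto
  then have "homeomorphic_map (top_of_set B) (top_of_set (f ` B)) f"
    using homeomorphic_map_maps by blast
  from homeomorphic_map_compose[OF c this]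
  have "homeomorphic_map (mspace M') (top_of_set (f ` B)) emb"
    by (simp add: emb_def[abs_def] o_def)
  moreover have "subtopology (mspace S) (emb ` topspace (mspace M')) = top_of_set (f ` B)"
    unfolding top using W(2) cmap_nbhd by (simp add: emb_def[abs_def] image_image[symmetric] subtopology_subtopology Int_absorb1)
  ultimately show ?thesis
    unfolding embedding_map_def by simp
qed

context
  fixes \<beta>
  assumes \<beta>: "\<beta> \<in> charts M"
begin

definition img :: "(real^'n) set" where
  "img = cmap M \<beta> ` (cdom M \<beta> \<inter> nbhd)"

definition transition :: "real^'n \<Rightarrow> real^'n" where
  "transition x = cmap M \<alpha> (cinv M \<beta> x)"

definition local_emb :: "real^'n \<Rightarrow> real^'m" where
  "local_emb x = f (transition x)"

lemma img_subset: "img \<subseteq> cmap M \<beta> ` cdom M \<beta>"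
  by (auto simp: img_def)

lemma open_img: "open img"
proof -
  have "openin (subtopology (mspace M) (cdom M \<beta>)) (cdom M \<beta> \<inter> nbhd)"
    by (rule openin_subtopology_Int2[OF nbhd_open])
  then have "openin (top_of_set (cmap M \<beta> ` cdom M \<beta>)) img"
    using homeomorphic_imp_open_map[OF chart_facts(3)[OF M \<beta>]] unfolding open_map_def img_def by blast
  then show ?thesis
    using chart_facts(2)[OF M \<beta>] by (simp add: openin_open_eq)
qed

lemma cinv_img: "x \<in> img \<Longrightarrow> cinv M \<beta> x \<in> cdom M \<beta> \<inter> nbhd"
  by (auto simp: img_def cinv_cmap[OF M \<beta>])

lemma cmap_cinv_img: "x \<in> img \<Longrightarrow> cmap M \<beta> (cinv M \<beta> x) = x"
  using cmap_cinv[OF M \<beta>] img_subset by blast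

text \<open>Restriction changes \<open>cinv\<close>, since \<open>inv_into\<close> then refers to
  the smaller domain; on \<open>img\<close> the two inverses agree by injectivity.\<close>

lemma cinv_restrict: "x \<in> img \<Longrightarrow> cinv M' \<beta> x = cinv M \<beta> x"
proof -
  assume x: "x \<in> img"
  have "inv_into (cdom M \<beta> \<inter> nbhd) (cmap M \<beta>) x = cinv M \<beta> x"
    by (rule inv_into_f_eq[OF inj_on_subset[OF chart_inj[OF M \<beta>]]]) (use cinv_img[OF x] cmap_cinv_img[OF x] in auto)
  then show ?thesis by (simp add: cinv_def)
qed

lemma transition_img: "transition ` img \<subseteq> B"
  using cinv_img by (force simp: transition_def nbhd_def)

lemma smooth_transition: "smooth_on img transition"
proof -
  have "smooth_on (cmap M \<beta> ` (cdom M \<beta> \<inter> cdom M \<alpha>)) transition"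
    unfolding transition_def[abs_def] using smooth_M[OF M] \<alpha> \<beta> by (simp add: smooth_manifold_def)
  then show ?thesis
    by (rule smooth_on_subset) (auto simp: img_def nbhd_def)
qed

lemma smooth_local_emb: "smooth_on img local_emb"
  unfolding local_emb_def[abs_def] by (rule smooth_on_compose[OF open_img B(1) transition_img smooth_transition f(1)])

lemma emb_cinv: "x \<in> img \<Longrightarrow> emb (cinv M' \<beta> x) = local_emb x"
  by (simp add: cinv_restrict emb_def local_emb_def transition_def)

lemma pd_restrict:
  assumes "p \<in> cdom M \<beta> \<inter> nbhd" "\<And>x. x \<in> img \<Longrightarrow> F (cinv M' \<beta> x) = F' x"
  shows "pd M' \<beta> i F p = partial i F' (cmap M \<beta> p)"
proof -
  have "cmap M \<beta> p \<in> img" using assms(1) by (auto simp: img_def)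
  from frechet_derivative_cong_open[OF open_img this, of "\<lambda>x. F (cinv M' \<beta> x)" F'] assms(2)
  show ?thesis by (simp add: pd_def)
qed

lemma diff_map_eq:
  assumes p: "p \<in> cdom M \<beta> \<inter> nbhd"
  shows "diff_map M' S emb \<beta> 0 p b i = partial i local_emb (cmap M \<beta> p) $ b"
proof -
  have y: "cmap M \<beta> p \<in> img" using p by (auto simp: img_def)
  show ?thesis
    unfolding diff_map_def using pd_restrict[OF p, of "\<lambda>q. emb q $ b" "\<lambda>x. local_emb x $ b"]
    by (simp add: emb_cinv partial_nth[OF smooth_local_emb y])
qed

context
  fixes p y x
  assumes p: "p \<in> cdom M \<beta> \<inter> nbhd"
    and y_def: "y = cmap M \<beta> p" and x_def: "x = cmap M \<alpha> p"
begin

lemma point_facts: "y \<in> img" "transition y = x" "x \<in> B" "cinv M \<alpha> x = p" "cinv M \<beta> y = p" "local_emb y = emb p"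
  "p \<in> cdom M \<alpha>" "p \<in> cdom M \<alpha> \<inter> cdom M \<beta>" "p \<in> cdom M \<beta> \<inter> cdom M \<alpha>"
  using p cinv_cmap[OF M \<alpha>, of p] cinv_cmap[OF M \<beta>, of p]
  by (auto simp: x_def y_def img_def nbhd_def transition_def local_emb_def emb_def)

lemma jac_eq: "jac M \<beta> \<alpha> p k j = partial j (\<lambda>x. transition x $ k) y"
  by (simp add: jac_def pd_def transition_def y_def)

lemma local_emb_second:
  "partial i (partial j local_emb) y =
    (\<Sum>m\<in>UNIV. chris M \<beta> p m i j *\<^sub>R partial m local_emb y) + (\<Sum>a\<in>UNIV. h a \<beta> p i j *\<^sub>R \<xi> a x)"
  unfolding local_emb_def[abs_def]
proof (rule change_chart[OF open_img point_facts(1) B(1) transition_img smooth_transition f(1) jac_eq])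
  show "partial l (partial k f) (transition y) =
      (\<Sum>m\<in>UNIV. chris M \<alpha> p m l k *\<^sub>R partial m f (transition y)) + (\<Sum>a\<in>UNIV. h a \<alpha> p l k *\<^sub>R \<xi> a x)" for l k
    using second[OF point_facts(3), where i = l and j = k] by (simp add: point_facts)
  have "pd M \<beta> i (\<lambda>q. jac M \<beta> \<alpha> q k j) p = partial i (\<lambda>x. partial j (\<lambda>x. transition x $ k) x) y" for k
  proof -
    have "jac M \<beta> \<alpha> (cinv M \<beta> z) k j = partial j (\<lambda>x. transition x $ k) z" if "z \<in> img" for z
      by (simp add: jac_def pd_def transition_def cmap_cinv_img[OF that])
    from frechet_derivative_cong_open[OF open_img point_facts(1), of "\<lambda>z. jac M \<beta> \<alpha> (cinv M \<beta> z) k j", OF this]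
    show ?thesis by (simp add: pd_def y_def)
  qed
  then show "(\<Sum>m\<in>UNIV. chris M \<beta> p m i j * jac M \<beta> \<alpha> p k m) = partial i (\<lambda>x. partial j (\<lambda>x. transition x $ k) x) y +
      (\<Sum>l\<in>UNIV. \<Sum>m\<in>UNIV. chris M \<alpha> p k l m * jac M \<beta> \<alpha> p l i * jac M \<beta> \<alpha> p m j)" for k
    using M \<alpha> \<beta> point_facts by (simp add: statistical_manifold_def affine_connection_def)
  show "h a \<beta> p i j = (\<Sum>k\<in>UNIV. \<Sum>l\<in>UNIV. h a \<alpha> p k l * jac M \<beta> \<alpha> p k i * jac M \<beta> \<alpha> p l j)" for a
    using h[of a, unfolded symmetric_2tensor_field_def, THEN conjunct2, THEN conjunct2, rule_format, OF \<beta> \<alpha> point_facts(9)] .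
qed

definition form :: "real^'m \<Rightarrow> real^'m \<Rightarrow> real" where
  "form u v = (\<Sum>A\<in>UNIV. \<Sum>C\<in>UNIV. G A C (emb p) * u $ A * v $ C)"

lemma form_bilinear: "bilinear form"
  unfolding bilinear_def form_def
  by (auto intro!: linearI simp: sum.distrib sum_distrib_left algebra_simps)

lemma form_sym: "form u v = form v u"
  unfolding form_def using G_sym[OF emb_W] p by (subst sum.swap) (simp add: mult_ac)

abbreviation "e i \<equiv> partial i local_emb y"

lemma e_eq: "e i = (\<Sum>k\<in>UNIV. jac M \<beta> \<alpha> p k i *\<^sub>R partial k f x)"
  unfolding local_emb_def[abs_def] jac_eq
  using partial_compose[OF smooth_transition point_facts(1) f(1), of i] by (simp only: point_facts(2,3))

lemma form_e_e: "form (e i) (e j) = met M \<beta> p i j"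
proof -
  have "form (e i) (e j) = (\<Sum>k\<in>UNIV. \<Sum>l\<in>UNIV. met M \<alpha> p k l * jac M \<beta> \<alpha> p k i * jac M \<beta> \<alpha> p l j)"
    unfolding e_eq bilinear_form_sum_sum[OF form_bilinear]
    using tangential[OF point_facts(3)] by (simp add: form_def point_facts emb_def x_def[symmetric])
  also have "\<dots> = met M \<beta> p i j"
    using riemannian_M[OF M, unfolded riemannian_metric_def symmetric_2tensor_field_def, THEN conjunct1,
        THEN conjunct2, THEN conjunct2, rule_format, OF \<beta> \<beta> \<alpha> point_facts(9)] by (rule sym)
  finally show ?thesis .
qed

lemma form_xi_e: "form (\<xi> a x) (e j) = 0"
proof -
  have "form (partial k f x) (\<xi> a x) = 0" for k
    using orthogonal[OF point_facts(3), where i = k and a = a] by (simp add: form_def emb_def x_def[symmetric])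
  moreover have lin: "linear (\<lambda>u. form u (\<xi> a x))"
    using form_bilinear by (simp add: bilinear_def)
  ultimately show ?thesis
    unfolding e_eq form_sym[of "\<xi> a x"] by (simp add: linear_sum[OF lin] linear_cmul[OF lin])
qed

lemma met_at_form: "met_at S 0 (emb p) u v = form (\<chi> A. u A) (\<chi> A. v A)"
  by (simp add: met_at_def form_def)

lemma met_at_e: "met_at M' \<beta> p u v = form (\<Sum>i\<in>UNIV. u i *\<^sub>R e i) (\<Sum>j\<in>UNIV. v j *\<^sub>R e j)"
  unfolding bilinear_form_sum_sum[OF form_bilinear] form_e_e by (simp add: met_at_def)

lemma push_eq: "(\<chi> A. push M' S emb \<beta> 0 Y p A) = (\<Sum>i\<in>UNIV. Y p i *\<^sub>R e i)"
  by (simp add: vec_eq_iff push_def diff_map_eq[OF p] y_def mult.commute)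

lemma emb_isometric:
  "met_at M' \<beta> p (X p) (Y p) = met_at S 0 (emb p) (push M' S emb \<beta> 0 X p) (push M' S emb \<beta> 0 Y p)"
  unfolding met_at_form push_eq met_at_e ..

text \<open>The Gauss formula gives D_X(f_* Y) = f_*(\<nabla>_X Y) + h^a(X, Y) \<xi>_a, and pairing
  with the tangent vector f_* Z removes the \<xi>_a by orthogonality.\<close>

lemma emb_connection:
  assumes Y: "vector_field M' Y"
  shows "met_at M' \<beta> p (nabla M' X Y \<beta> p) (Z p) =
    met_at S 0 (emb p) (pullback_nabla M' S emb \<beta> 0 (X \<beta>) (push M' S emb \<beta> 0 (Y \<beta>)) p) (push M' S emb \<beta> 0 Z p)"
proof -
  let ?Y = "\<lambda>j z. Y \<beta> (cinv M' \<beta> z) j"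
  have sY: "smooth_on img (?Y j)" for j
    using Y \<beta> by (simp add: vector_field_def smooth_in_chart_def img_def)
  have Yy: "?Y j y = Y \<beta> p j" for j
    using cinv_restrict[OF point_facts(1)] point_facts by simp
  have cov: "cov_vec M' \<beta> (Y \<beta>) p i k = partial i (?Y k) y + (\<Sum>m\<in>UNIV. chris M \<beta> p k i m * Y \<beta> p m)" for i k
    by (simp add: cov_vec_def pd_def y_def)
  have pd_push: "pd M' \<beta> i (\<lambda>q. push M' S emb \<beta> 0 (Y \<beta>) q c) p =
      ((\<Sum>k\<in>UNIV. cov_vec M' \<beta> (Y \<beta>) p i k *\<^sub>R e k) + (\<Sum>a\<in>UNIV. (\<Sum>j\<in>UNIV. Y \<beta> p j * h a \<beta> p i j) *\<^sub>R \<xi> a x)) $ c" for i c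
  proof -
    have "pd M' \<beta> i (\<lambda>q. push M' S emb \<beta> 0 (Y \<beta>) q c) p = partial i (\<lambda>z. \<Sum>j\<in>UNIV. partial j local_emb z $ c * ?Y j z) y"
      unfolding y_def
      by (rule pd_restrict[OF p]) (simp add: push_def cinv_restrict diff_map_eq[OF cinv_img] cmap_cinv_img)
    also have "\<dots> = (\<Sum>j\<in>UNIV. e j $ c * partial i (?Y j) y + partial i (partial j local_emb) y $ c * Y \<beta> p j)"
    proof -
      have "((\<lambda>z. \<Sum>j\<in>UNIV. partial j local_emb z $ c * ?Y j z) has_derivative
        (\<lambda>v. \<Sum>j\<in>UNIV. e j $ c * frechet_derivative (?Y j) (at y) v +
          frechet_derivative (partial j local_emb) (at y) v $ c * ?Y j y)) (at y)"
        by (intro has_derivative_sum has_derivative_mult smooth_on_has_derivative[OF sY point_facts(1)]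
            bounded_linear.has_derivative[OF bounded_linear_vec_nth
              smooth_on_has_derivative[OF smooth_on_partial[OF smooth_local_emb] point_facts(1)]])
      from partial_eqI[OF this] show ?thesis by (simp add: Yy)
    qed
    \<comment> \<open>The second derivatives of the embedding are replaced by the Gauss formula; its
      \<open>chris\<close> part completes the derivative of \<open>Y\<close> to a covariant
      one.\<close>
    also have "\<dots> = (\<Sum>k\<in>UNIV. partial i (?Y k) y * e k $ c) +
        (\<Sum>j\<in>UNIV. \<Sum>k\<in>UNIV. chris M \<beta> p k i j * Y \<beta> p j * e k $ c) +
        (\<Sum>j\<in>UNIV. \<Sum>a\<in>UNIV. Y \<beta> p j * h a \<beta> p i j * \<xi> a x $ c)"
      unfolding local_emb_second by (simp add: sum.distrib distrib_left sum_distrib_left mult_ac)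
    also have "(\<Sum>j\<in>UNIV. \<Sum>k\<in>UNIV. chris M \<beta> p k i j * Y \<beta> p j * e k $ c) = (\<Sum>k\<in>UNIV. (\<Sum>j\<in>UNIV. chris M \<beta> p k i j * Y \<beta> p j) * e k $ c)"
      by (subst sum.swap) (simp add: sum_distrib_right)
    also have "(\<Sum>j\<in>UNIV. \<Sum>a\<in>UNIV. Y \<beta> p j * h a \<beta> p i j * \<xi> a x $ c) = (\<Sum>a\<in>UNIV. (\<Sum>j\<in>UNIV. Y \<beta> p j * h a \<beta> p i j) * \<xi> a x $ c)"
      by (subst sum.swap) (simp add: sum_distrib_right)
    finally show ?thesis
      by (simp add: cov sum.distrib distrib_right)
  qed
  \<comment> \<open>\<open>?c a\<close> is h^a(X, Y), the coefficient of the transversal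
    part.\<close>
  let ?n = "nabla M' X Y \<beta> p" and ?c = "\<lambda>a. \<Sum>i\<in>UNIV. X \<beta> p i * (\<Sum>j\<in>UNIV. Y \<beta> p j * h a \<beta> p i j)"
  have "(\<chi> A. pullback_nabla M' S emb \<beta> 0 (X \<beta>) (push M' S emb \<beta> 0 (Y \<beta>)) p A) =
      (\<Sum>i\<in>UNIV. X \<beta> p i *\<^sub>R ((\<Sum>k\<in>UNIV. cov_vec M' \<beta> (Y \<beta>) p i k *\<^sub>R e k) + (\<Sum>a\<in>UNIV. (\<Sum>j\<in>UNIV. Y \<beta> p j * h a \<beta> p i j) *\<^sub>R \<xi> a x)))"
    by (simp add: vec_eq_iff pullback_nabla_def pd_push)
  also have "\<dots> = (\<Sum>i\<in>UNIV. \<Sum>k\<in>UNIV. (X \<beta> p i * cov_vec M' \<beta> (Y \<beta>) p i k) *\<^sub>R e k) +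
      (\<Sum>i\<in>UNIV. \<Sum>a\<in>UNIV. (X \<beta> p i * (\<Sum>j\<in>UNIV. Y \<beta> p j * h a \<beta> p i j)) *\<^sub>R \<xi> a x)"
    by (simp add: scaleR_add_right scaleR_sum_right sum.distrib)
  also have "(\<Sum>i\<in>UNIV. \<Sum>k\<in>UNIV. (X \<beta> p i * cov_vec M' \<beta> (Y \<beta>) p i k) *\<^sub>R e k) = (\<Sum>k\<in>UNIV. ?n k *\<^sub>R e k)"
    by (subst sum.swap) (simp add: nabla_def scaleR_sum_left)
  also have "(\<Sum>i\<in>UNIV. \<Sum>a\<in>UNIV. (X \<beta> p i * (\<Sum>j\<in>UNIV. Y \<beta> p j * h a \<beta> p i j)) *\<^sub>R \<xi> a x) = (\<Sum>a\<in>UNIV. ?c a *\<^sub>R \<xi> a x)"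
    by (subst sum.swap) (simp add: scaleR_sum_left)
  finally have "(\<chi> A. pullback_nabla M' S emb \<beta> 0 (X \<beta>) (push M' S emb \<beta> 0 (Y \<beta>)) p A) =
      (\<Sum>k\<in>UNIV. ?n k *\<^sub>R e k) + (\<Sum>a\<in>UNIV. ?c a *\<^sub>R \<xi> a x)" .
  moreover have "form (u + (\<Sum>a\<in>UNIV. ?c a *\<^sub>R \<xi> a x)) (\<Sum>j\<in>UNIV. Z p j *\<^sub>R e j) = form u (\<Sum>j\<in>UNIV. Z p j *\<^sub>R e j)" for u
    using bilinear_ladd[OF form_bilinear] bilinear_form_sum_sum[OF form_bilinear, of ?c "\<lambda>a. \<xi> a x" UNIV "Z p" e UNIV]
    by (simp add: form_xi_e)
  ultimately show ?thesis
    unfolding met_at_form push_eq met_at_e by simp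
qed

text \<open>A kernel vector of the derivative has length zero for g, because \<open>G\<close> pulls
  back to g.\<close>

lemma local_emb_inj: "inj (frechet_derivative local_emb (at y))"
proof -
  let ?D = "frechet_derivative local_emb (at y)"
  have lin: "linear ?D"
    by (rule has_derivative_linear[OF smooth_on_has_derivative[OF smooth_local_emb point_facts(1)]])
  have "v = 0" if "?D v = 0" for v
  proof (rule ccontr)
    assume "v \<noteq> 0"
    then have "(\<lambda>i. v $ i) \<noteq> (\<lambda>_. 0)" by (auto simp: fun_eq_iff vec_eq_iff)
    then have "(\<Sum>i\<in>UNIV. \<Sum>j\<in>UNIV. met M \<beta> p i j * v $ i * v $ j) > 0"
      using riemannian_M[OF M] \<beta> p unfolding riemannian_metric_def by blast
    also have "(\<Sum>i\<in>UNIV. \<Sum>j\<in>UNIV. met M \<beta> p i j * v $ i * v $ j) = form (?D v) (?D v)"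
      unfolding linear_axis_sum[OF lin, of v] bilinear_form_sum_sum[OF form_bilinear] form_e_e ..
    finally show False using that by (simp add: form_def)
  qed
  then show ?thesis using lin linear_injective_0 by blast
qed

end

end

lemma emb_statistical_embedding: "statistical_embedding M' S emb"
  unfolding statistical_embedding_def
proof (intro conjI allI impI ballI)
  show "smooth_embedding M' S emb"
    unfolding smooth_embedding_def
  proof (intro conjI ballI)
    show "embedding_map (mspace M') (mspace S) emb" by (rule emb_embedding)
    fix \<beta> b assume "\<beta> \<in> charts M'" "b \<in> charts S"
    then have \<beta>: "\<beta> \<in> charts M" and b: "b = 0" by auto
    have set: "cdom M' \<beta> \<inter> emb -` cdom S b = cdom M \<beta> \<inter> nbhd"
      using emb_W by auto
    have "smooth_on (img \<beta>) (\<lambda>x. emb (cinv M' \<beta> x))"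
      using smooth_on_cong[where f = "\<lambda>x. emb (cinv M' \<beta> x)" and g = "local_emb \<beta>", OF open_img[OF \<beta>] emb_cinv[OF \<beta>]]
        smooth_local_emb[OF \<beta>] by blast
    then show "smooth_on (cmap M' \<beta> ` (cdom M' \<beta> \<inter> emb -` cdom S b)) (\<lambda>x. cmap S b (emb (cinv M' \<beta> x)))"
      unfolding set by (simp add: img_def[OF \<beta>])
    fix p assume "p \<in> cdom M' \<beta> \<inter> emb -` cdom S b"
    then have p: "p \<in> cdom M \<beta> \<inter> nbhd" unfolding set .
    have "frechet_derivative (\<lambda>x. emb (cinv M' \<beta> x)) (at (cmap M \<beta> p)) = frechet_derivative (local_emb \<beta>) (at (cmap M \<beta> p))"
      by (rule frechet_derivative_cong_open[OF open_img[OF \<beta>] point_facts(1)[OF \<beta> p refl refl] emb_cinv[OF \<beta>]])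
    then show "inj (frechet_derivative (\<lambda>x. cmap S b (emb (cinv M' \<beta> x))) (at (cmap M' \<beta> p)))"
      using local_emb_inj[OF \<beta> p refl refl] by simp
  qed
  fix X Y Z \<beta> b p
  assume XYZ: "vector_field M' X \<and> vector_field M' Y \<and> vector_field M' Z" and "\<beta> \<in> charts M'" "b \<in> charts S"
    and "p \<in> cdom M' \<beta> \<inter> emb -` cdom S b"
  then have \<beta>: "\<beta> \<in> charts M" and b: "b = 0" and p: "p \<in> cdom M \<beta> \<inter> nbhd" by auto
  show "met_at M' \<beta> p (X \<beta> p) (Y \<beta> p) =
      met_at S b (emb p) (push M' S emb \<beta> b (X \<beta>) p) (push M' S emb \<beta> b (Y \<beta>) p)"
    unfolding b by (rule emb_isometric[OF \<beta> p refl refl])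
  show "met_at M' \<beta> p (nabla M' X Y \<beta> p) (Z \<beta> p) =
      met_at S b (emb p) (pullback_nabla M' S emb \<beta> b (X \<beta>) (push M' S emb \<beta> b (Y \<beta>)) p) (push M' S emb \<beta> b (Z \<beta>) p)"
    unfolding b by (rule emb_connection[OF \<beta> p refl refl]) (use XYZ in blast)
qed

end

section \<open>Local embeddability around every point\<close>

theorem theorem1p1:
  fixes M :: "('a, 'c, 'n::finite) stat_manifold"
    and h hs :: "'r::finite \<Rightarrow> 'c \<Rightarrow> 'a \<Rightarrow> 'n \<Rightarrow> 'n \<Rightarrow> real"
    and \<tau> :: "'r \<Rightarrow> 'r \<Rightarrow> 'c \<Rightarrow> 'a \<Rightarrow> 'n \<Rightarrow> real"
  assumes "statistical_manifold M"
    and "\<And>a. symmetric_2tensor_field M (h a)"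
    and "\<And>a. symmetric_2tensor_field M (hs a)"
    and "\<And>a b. covector_field M (\<tau> a b)"
    and "gauss_eq M h hs"
    and "codazzi_eq M h \<tau>"
    and "codazzi_dual_eq M hs \<tau>"
    and "ricci_eq M h hs \<tau>"
  shows "locally_embeddable_to_flat TYPE('n + 'r) M"
  unfolding locally_embeddable_to_flat_def
proof
  fix x assume "x \<in> topspace (mspace M)"
  then obtain \<alpha> where \<alpha>: "\<alpha> \<in> charts M" and x: "x \<in> cdom M \<alpha>"
    using smooth_M[OF assms(1)] unfolding smooth_manifold_def by blast
  interpret gcr_chart "cmap M \<alpha> ` cdom M \<alpha>"
    "\<lambda>i j x. met M \<alpha> (cinv M \<alpha> x) i j" "\<lambda>k i j x. chris M \<alpha> (cinv M \<alpha> x) k i j"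
    "\<lambda>a i j x. h a \<alpha> (cinv M \<alpha> x) i j" "\<lambda>a i k x. raise M \<alpha> (hs a \<alpha>) (cinv M \<alpha> x) i k"
    "\<lambda>a b i x. \<tau> a b \<alpha> (cinv M \<alpha> x) i"
    by (rule gcr_chart_of[OF assms(1) \<alpha> assms(2-)])
  have x0: "cmap M \<alpha> x \<in> cmap M \<alpha> ` cdom M \<alpha>" using x by blast
  show "\<exists>U (S :: (real^('n + 'r), nat, 'n + 'r) stat_manifold) f.
      openin (mspace M) U \<and> x \<in> U \<and> statistical_manifold S \<and> flat S \<and> statistical_embedding (restrict_to M U) S f"
  proof (rule local_embedding[OF x0])
    fix B W and f :: "real^'n \<Rightarrow> real^('n + 'r)" and \<xi> k G
    assume B: "open B" "cmap M \<alpha> x \<in> B" "B \<subseteq> cmap M \<alpha> ` cdom M \<alpha>" and W: "open W" "f ` B \<subseteq> W"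
      and f: "smooth_on B f" "homeomorphism B (f ` B) f k"
      and second: "\<And>x i j. x \<in> B \<Longrightarrow> partial i (partial j f) x =
        (\<Sum>k\<in>UNIV. chris M \<alpha> (cinv M \<alpha> x) k i j *\<^sub>R partial k f x) + (\<Sum>a\<in>UNIV. h a \<alpha> (cinv M \<alpha> x) i j *\<^sub>R \<xi> a x)"
      and G: "\<And>A C. smooth_on W (G A C)" "\<And>y A C. y \<in> W \<Longrightarrow> G A C y = G C A y"
        "\<And>y A C E. y \<in> W \<Longrightarrow> partial E (G A C) y = partial A (G E C) y"
        "\<And>y u. y \<in> W \<Longrightarrow> u \<noteq> (\<lambda>_. 0) \<Longrightarrow> (\<Sum>A\<in>UNIV. \<Sum>C\<in>UNIV. G A C y * u A * u C) > 0"
      and tangential: "\<And>x i j. x \<in> B \<Longrightarrow> (\<Sum>A\<in>UNIV. \<Sum>C\<in>UNIV. G A C (f x) * partial i f x $ A * partial j f x $ C)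
        = met M \<alpha> (cinv M \<alpha> x) i j"
      and orthogonal: "\<And>x i a. x \<in> B \<Longrightarrow> (\<Sum>A\<in>UNIV. \<Sum>C\<in>UNIV. G A C (f x) * partial i f x $ A * \<xi> a x $ C) = 0"
    define U where "U = {p \<in> cdom M \<alpha>. cmap M \<alpha> p \<in> B}"
    have "x \<in> U" using x B(2) by (simp add: U_def)
    interpret chart_embedding M h \<alpha> B W f \<xi> k G
      by unfold_locales (fact assms(1,2) \<alpha> B(1,3) W f second G(2) tangential orthogonal)+
    have "openin (mspace M) U"
      using nbhd_open unfolding nbhd_def U_def .
    moreover have "statistical_embedding (restrict_to M U) (hessian_manifold W G) emb"
      using emb_statistical_embedding unfolding nbhd_def U_def .
    ultimately show ?thesis
      using \<open>x \<in> U\<close> hessian_manifold_flat[OF W(1) G] by (intro exI conjI)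
  qed
qed

end
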